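(* Let $q\in(-1,1)$ and $x\in\left(-\frac{2}{\sqrt{1-q}},\frac{2}{\sqrt{1-q}}\right)$. Let $X^{(q)}=\{X^{(q)}_t\}_{t\in\mathbb{R}}$ be the $q$-Ornstein--Uhlenbeck process, and for $\epsilon>0$ put $$Y^{(\epsilon)}_t:=\frac{X^{(q)}_{\epsilon t}-X^{(q)}_0}{\epsilon},\qquad t\ge 0.$$ Then, under the law $\mathbb{P}(\cdot\mid X^{(q)}_0=x)$, as $\epsilon\downarrow 0$, $$\{Y^{(\epsilon)}_t\}_{t\in[0,\infty)}\Longrightarrow c_{q,x}\{\mathbb{Z}^{(1)}_t\}_{t\in[0,\infty)}\quad\text{with}\quad c_{q,x}=\sqrt{\frac{4}{1-q}-x^2},$$ where $\Rightarrow$ denotes weak convergence in $D([0,\infty))$ equipped with the Skorohod topology and $\mathbb{Z}^{(1)}$ is the Cauchy process.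
   Context: Notation: $(a;q)_\infty=\prod_{k=0}^\infty(1-aq^k)$ and $(q)_\infty=\prod_{k=1}^\infty(1-q^k)$ (with $q^0=1$, also for $q=0$). The $q$-Ornstein--Uhlenbeck process $X^{(q)}=\{X^{(q)}_t\}_{t\in\mathbb{R}}$, $q\in(-1,1)$, is the stationary Markov process with càdlàg (right-continuous with left limits) trajectories and state space $[-2/\sqrt{1-q},2/\sqrt{1-q}]$, whose marginal probability density is $$p(x)=\frac{\sqrt{1-q}\,(q)_\infty}{2\pi}\sqrt{4-(1-q)x^2}\prod_{k=1}^\infty\left[(1+q^k)^2-(1-q)x^2q^k\right],$$ and whose transition probability density from $x$ at time $s$ to $y$ at time $t>s$ is, for $x,y\in[-2/\sqrt{1-q},2/\sqrt{1-q}]$, $$p_{s,t}(x,y)=(e^{-2(t-s)};q)_\infty\prod_{k=0}^\infty\frac{1}{\varphi_{q,k}(t-s,x,y)}\cdot p(y),$$ where $$\varphi_{q,k}(\delta,x,y)=(1-e^{-2\delta}q^{2k})^2-(1-q)e^{-\delta}q^k(1+e^{-2\delta}q^{2k})xy+(1-q)e^{-2\delta}q^{2k}(x^2+y^2).$$ These are Feller transition probabilities. $\mathbb{P}(\cdot\mid X_0^{(q)}=x)$ denotes the law of the càdlàg Markov process $\{X^{(q)}_t\}_{t\ge0}$ started at $x$ at time $0$ with these transition densities. The Cauchy process $\mathbb{Z}^{(1)}=\{\mathbb{Z}^{(1)}_t\}_{t\ge0}$ is the (càdlàg) symmetric $1$-stable Lévy process starting from $0$ with transition probability density $$f^{(1)}_{t_1,t_2}(y_1,y_2)=\frac1\pi\,\frac{t_2-t_1}{(y_2-y_1)^2+(t_2-t_1)^2},\quad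 0\le t_1<t_2<\infty,\ y_1,y_2\in\mathbb{R}.$$ *)

theory Defs
  imports "HOL-Probability.Probability"
begin

section \<open>The Skorohod space \<open>D([0,\<infinity>))\<close>\<close>

text \<open>A function on \<open>[0,\<infinity>)\<close> is represented by its extension to \<open>real\<close> that is \<open>undefined\<close>
  on the negative half-line.\<close>

definition cadlag :: "(real \<Rightarrow> real) set" where
  "cadlag = {\<alpha> \<in> extensional {0..}.
      (\<forall>t\<ge>0. continuous (at_right t) \<alpha>) \<and> (\<forall>t>0. \<exists>l. (\<alpha> \<longlongrightarrow> l) (at_left t))}"

text \<open>Increasing bijections of \<open>[0,\<infinity>)\<close>; these are automatically homeomorphisms fixing \<open>0\<close>.\<close>

definition time_changes :: "(real \<Rightarrow> real) set" where
  "time_changes = {\<theta>. strict_mono_on {0..} \<theta> \<and> \<theta> ` {0..} = {0..}}"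

definition skorohod_nbhd :: "(real \<Rightarrow> real) \<Rightarrow> real \<Rightarrow> (real \<Rightarrow> real) set" where
  "skorohod_nbhd \<alpha> \<epsilon> = {\<beta> \<in> cadlag. \<exists>\<theta>\<in>time_changes.
      (\<forall>s\<ge>0. \<bar>\<theta> s - s\<bar> < \<epsilon>) \<and> (\<forall>s\<in>{0..1/\<epsilon>}. \<bar>\<beta> (\<theta> s) - \<alpha> s\<bar> < \<epsilon>)}"

text \<open>Skorohod's \<open>J\<^sub>1\<close> topology on \<open>D([0,\<infinity>))\<close>. It is the metrizable topology in which
  \<open>\<alpha>\<^sub>n \<longlonglongrightarrow> \<alpha>\<close> iff there are time changes \<open>\<theta>\<^sub>n\<close> with \<open>\<theta>\<^sub>n(s) - s \<longlonglongrightarrow> 0\<close>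
  uniformly in \<open>s \<ge> 0\<close> and \<open>\<alpha>\<^sub>n(\<theta>\<^sub>n(s)) - \<alpha>(s) \<longlonglongrightarrow> 0\<close> uniformly in \<open>s \<in> [0,N]\<close> for every \<open>N\<close>
  (Jacod and Shiryaev, Limit Theorems for Stochastic Processes, Theorem VI.1.14).
  Such convergence says exactly that \<open>\<alpha>\<^sub>n\<close> is eventually in every \<open>skorohod_nbhd \<alpha> \<epsilon>\<close>,
  so the (sequentially) open sets are the ones below.\<close>

definition skorohod :: "(real \<Rightarrow> real) topology" where
  "skorohod = topology (\<lambda>U. U \<subseteq> cadlag \<and> (\<forall>\<alpha>\<in>U. \<exists>\<epsilon>>0. skorohod_nbhd \<alpha> \<epsilon> \<subseteq> U))"

lemma skorohod_nbhd_mono: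
  assumes "0 < \<epsilon>" "\<epsilon> \<le> \<delta>"
  shows "skorohod_nbhd \<alpha> \<epsilon> \<subseteq> skorohod_nbhd \<alpha> \<delta>"
proof
  fix \<beta> assume "\<beta> \<in> skorohod_nbhd \<alpha> \<epsilon>"
  then obtain \<theta> where \<theta>: "\<beta> \<in> cadlag" "\<theta> \<in> time_changes" "\<And>s. s \<ge> 0 \<Longrightarrow> \<bar>\<theta> s - s\<bar> < \<epsilon>"
    "\<And>s. s \<in> {0..1/\<epsilon>} \<Longrightarrow> \<bar>\<beta> (\<theta> s) - \<alpha> s\<bar> < \<epsilon>"
    unfolding skorohod_nbhd_def by auto
  have "1 / \<delta> \<le> 1 / \<epsilon>"
    using assms by (simp add: frac_le)
  then have "\<bar>\<beta> (\<theta> s) - \<alpha> s\<bar> < \<delta>" if "s \<in> {0..1/\<delta>}" for s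
    using \<theta>(4)[of s] that assms(2) by simp
  moreover have "\<bar>\<theta> s - s\<bar> < \<delta>" if "s \<ge> 0" for s
    using \<theta>(3)[OF that] assms(2) by simp
  ultimately show "\<beta> \<in> skorohod_nbhd \<alpha> \<delta>"
    unfolding skorohod_nbhd_def using \<theta>(1,2) by blast
qed

lemma openin_skorohod:
  "openin skorohod U \<longleftrightarrow> U \<subseteq> cadlag \<and> (\<forall>\<alpha>\<in>U. \<exists>\<epsilon>>0. skorohod_nbhd \<alpha> \<epsilon> \<subseteq> U)"
proof -
  define P where "P U \<longleftrightarrow> U \<subseteq> cadlag \<and> (\<forall>\<alpha>\<in>U. \<exists>\<epsilon>>0. skorohod_nbhd \<alpha> \<epsilon> \<subseteq> U)" for U
  have "P (S \<inter> T)" if S: "P S" and T: "P T" for S T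
    unfolding P_def
  proof (intro conjI ballI)
    show "S \<inter> T \<subseteq> cadlag" using S by (auto simp: P_def)
    fix \<alpha> assume \<alpha>: "\<alpha> \<in> S \<inter> T"
    obtain d where d: "d > 0" "skorohod_nbhd \<alpha> d \<subseteq> S" using S \<alpha> by (auto simp: P_def)
    obtain e where e: "e > 0" "skorohod_nbhd \<alpha> e \<subseteq> T" using T \<alpha> by (auto simp: P_def)
    have "skorohod_nbhd \<alpha> (min d e) \<subseteq> S \<inter> T"
      using d e skorohod_nbhd_mono[of "min d e" d \<alpha>] skorohod_nbhd_mono[of "min d e" e \<alpha>] by auto
    then show "\<exists>\<epsilon>>0. skorohod_nbhd \<alpha> \<epsilon> \<subseteq> S \<inter> T"
      using d(1) e(1) by (intro exI[of _ "min d e"]) simp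
  qed
  moreover have "P (\<Union>\<K>)" if K: "\<forall>K\<in>\<K>. P K" for \<K>
    unfolding P_def
  proof (intro conjI ballI)
    show "\<Union>\<K> \<subseteq> cadlag" using K by (auto simp: P_def)
    fix \<alpha> assume "\<alpha> \<in> \<Union>\<K>"
    then obtain K where "K \<in> \<K>" "\<alpha> \<in> K" by blast
    moreover from this obtain e where "e > 0" "skorohod_nbhd \<alpha> e \<subseteq> K"
      using K unfolding P_def by meson
    ultimately show "\<exists>\<epsilon>>0. skorohod_nbhd \<alpha> \<epsilon> \<subseteq> \<Union>\<K>" by blast
  qed
  ultimately have "istopology P"
    by (simp add: istopology_def)
  then have "openin (topology P) U \<longleftrightarrow> P U"
    by (simp only: topology_inverse')
  then show ?thesis
    unfolding skorohod_def P_def .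
qed

lemma topspace_skorohod: "topspace skorohod = cadlag"
proof
  have "openin skorohod cadlag"
    unfolding openin_skorohod skorohod_nbhd_def by (auto intro: exI[of _ "1::real"])
  then show "cadlag \<subseteq> topspace skorohod"
    by (rule openin_subset)
  show "topspace skorohod \<subseteq> cadlag"
    using openin_topspace[of skorohod] unfolding openin_skorohod by simp
qed


section \<open>Weak convergence in a topological space\<close>

definition borel_sets_of :: "'a topology \<Rightarrow> 'a measure" where
  "borel_sets_of T = sigma (topspace T) {U. openin T U}"

text \<open>Convergence in law of random elements \<open>Y i\<close> of \<open>T\<close> to the random element \<open>Z\<close> of \<open>T\<close>,
  i.e. weak convergence of their laws. Borel measurability is part of the notion.\<close>

definition converges_in_law ::
  "'b topology \<Rightarrow> ('i \<Rightarrow> 'a measure) \<Rightarrow> ('i \<Rightarrow> 'a \<Rightarrow> 'b) \<Rightarrow> 'c measure \<Rightarrow> ('c \<Rightarrow> 'b) \<Rightarrow> 'i filter \<Rightarrow> bool"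
where
  "converges_in_law T M Y N Z F \<longleftrightarrow>
     (\<forall>\<^sub>F i in F. Y i \<in> M i \<rightarrow>\<^sub>M borel_sets_of T) \<and>
     Z \<in> N \<rightarrow>\<^sub>M borel_sets_of T \<and>
     (\<forall>f. continuous_map T euclideanreal f \<and> bounded (f ` topspace T) \<longrightarrow>
        ((\<lambda>i. LINT w|distr (M i) (borel_sets_of T) (Y i). f w) \<longlongrightarrow>
          (LINT w|distr N (borel_sets_of T) Z. f w)) F)"


section \<open>Markov and L\'evy processes on \<open>[0,\<infinity>)\<close>\<close>

text \<open>The value \<open>X t\<close> is only relevant for \<open>t \<ge> 0\<close>.\<close>

definition trajectory :: "(real \<Rightarrow> 'a \<Rightarrow> real) \<Rightarrow> 'a \<Rightarrow> real \<Rightarrow> real" where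
  "trajectory X \<omega> = (\<lambda>t\<in>{0..}. X t \<omega>)"

definition cadlag_process :: "'a measure \<Rightarrow> (real \<Rightarrow> 'a \<Rightarrow> real) \<Rightarrow> bool" where
  "cadlag_process M X \<longleftrightarrow> prob_space M \<and> (\<forall>t\<ge>0. X t \<in> borel_measurable M) \<and>
     (\<forall>\<omega>\<in>space M. trajectory X \<omega> \<in> cadlag)"

text \<open>The \<open>\<sigma>\<close>-algebra generated by \<open>X u\<close>, \<open>0 \<le> u \<le> s\<close>.\<close>

definition past :: "'a measure \<Rightarrow> (real \<Rightarrow> 'a \<Rightarrow> real) \<Rightarrow> real \<Rightarrow> 'a measure" where
  "past M X s = sigma (space M) {X u -` B \<inter> space M | u B. 0 \<le> u \<and> u \<le> s \<and> B \<in> sets borel}"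

text \<open>\<open>X\<close> is a Markov process with state space \<open>S\<close> and transition density \<open>p s t x y\<close> from \<open>x\<close> at
  time \<open>s\<close> to \<open>y\<close> at time \<open>t\<close>:
  \<open>P(X\<^sub>t \<in> B | past up to s) = \<integral>\<^bsub>B \<inter> S\<^esub> p s t X\<^sub>s y dy\<close> a.s.\<close>

definition markov_process ::
  "'a measure \<Rightarrow> (real \<Rightarrow> 'a \<Rightarrow> real) \<Rightarrow> real set \<Rightarrow> (real \<Rightarrow> real \<Rightarrow> real \<Rightarrow> real \<Rightarrow> real) \<Rightarrow> bool"
where
  "markov_process M X S p \<longleftrightarrow>
     (\<forall>t\<ge>0. \<forall>\<omega>\<in>space M. X t \<omega> \<in> S) \<and>
     (\<forall>s t B. 0 \<le> s \<and> s < t \<and> B \<in> sets borel \<longrightarrow>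
        (AE \<omega> in M. real_cond_exp M (past M X s) (\<lambda>\<omega>'. indicator B (X t \<omega>')) \<omega> =
          (LINT y:B \<inter> S|lborel. p s t (X s \<omega>) y)))"

definition levy_process :: "'a measure \<Rightarrow> (real \<Rightarrow> 'a \<Rightarrow> real) \<Rightarrow> bool" where
  "levy_process M Z \<longleftrightarrow> cadlag_process M Z \<and> (AE \<omega> in M. Z 0 \<omega> = 0) \<and>
     (\<forall>s t. 0 \<le> s \<and> s < t \<longrightarrow>
        prob_space.indep_set M (sets (past M Z s))
          {(\<lambda>\<omega>. Z t \<omega> - Z s \<omega>) -` B \<inter> space M | B. B \<in> sets borel} \<and>
        distr M borel (\<lambda>\<omega>. Z t \<omega> - Z s \<omega>) = distr M borel (\<lambda>\<omega>. Z (t - s) \<omega> - Z 0 \<omega>))"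


section \<open>The \<open>q\<close>-Ornstein--Uhlenbeck process\<close>

definition q_pochhammer_inf :: "real \<Rightarrow> real \<Rightarrow> real" where
  "q_pochhammer_inf a q = (\<Prod>k. 1 - a * q ^ k)"

definition qou_states :: "real \<Rightarrow> real set" where
  "qou_states q = {- 2 / sqrt (1 - q) .. 2 / sqrt (1 - q)}"

text \<open>The stationary density, meaningful for \<open>x \<in> qou_states q\<close>; \<open>q_pochhammer_inf q q\<close> is the
  product of \<open>1 - q\<^sup>k\<close> over \<open>k \<ge> 1\<close>.\<close>

definition qou_density :: "real \<Rightarrow> real \<Rightarrow> real" where
  "qou_density q x = sqrt (1 - q) * q_pochhammer_inf q q / (2 * pi) * sqrt (4 - (1 - q) * x\<^sup>2) *
     (\<Prod>k. (1 + q ^ Suc k)\<^sup>2 - (1 - q) * x\<^sup>2 * q ^ Suc k)"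

definition qou_phi :: "real \<Rightarrow> nat \<Rightarrow> real \<Rightarrow> real \<Rightarrow> real \<Rightarrow> real" where
  "qou_phi q k \<delta> x y =
     (1 - exp (- 2 * \<delta>) * q ^ (2 * k))\<^sup>2
     - (1 - q) * exp (- \<delta>) * q ^ k * (1 + exp (- 2 * \<delta>) * q ^ (2 * k)) * x * y
     + (1 - q) * exp (- 2 * \<delta>) * q ^ (2 * k) * (x\<^sup>2 + y\<^sup>2)"

definition qou_transition :: "real \<Rightarrow> real \<Rightarrow> real \<Rightarrow> real \<Rightarrow> real \<Rightarrow> real" where
  "qou_transition q s t x y =
     q_pochhammer_inf (exp (- 2 * (t - s))) q * (\<Prod>k. 1 / qou_phi q k (t - s) x y) * qou_density q y"

text \<open>\<open>X\<close> is, under \<open>M\<close>, the \<open>q\<close>-Ornstein--Uhlenbeck process on \<open>[0,\<infinity>)\<close> started at \<open>x\<close>; the law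
  of its path is the conditional law of the stationary process given \<open>X\<^sub>0 = x\<close>.\<close>

definition qou_process_from :: "real \<Rightarrow> real \<Rightarrow> 'a measure \<Rightarrow> (real \<Rightarrow> 'a \<Rightarrow> real) \<Rightarrow> bool" where
  "qou_process_from q x M X \<longleftrightarrow> cadlag_process M X \<and> (AE \<omega> in M. X 0 \<omega> = x) \<and>
     markov_process M X (qou_states q) (qou_transition q)"


section \<open>The Cauchy process\<close>

definition cauchy_transition :: "real \<Rightarrow> real \<Rightarrow> real \<Rightarrow> real \<Rightarrow> real" where
  "cauchy_transition s t x y = 1 / pi * ((t - s) / ((y - x)\<^sup>2 + (t - s)\<^sup>2))"

text \<open>Symmetry and \<open>1\<close>-stability are consequences of the transition density.\<close>

definition cauchy_process :: "'a measure \<Rightarrow> (real \<Rightarrow> 'a \<Rightarrow> real) \<Rightarrow> bool" where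
  "cauchy_process N Z \<longleftrightarrow> levy_process N Z \<and> markov_process N Z UNIV cauchy_transition"

end

theory Submission
  imports Defs
begin

text \<open>
  Let \<open>Y\<^sup>\<epsilon>\<close> be the rescaled process and \<open>c Z\<close> the Cauchy process of speed \<open>c\<close>.  The heart of the
  proof is the one-sided estimate \<open>E f(c Z) \<le> liminf E f(Y\<^sup>\<epsilon>)\<close> for nonnegative bounded continuous
  \<open>f\<close> on the Skorohod space (\<open>qou_liminf\<close>); applied to \<open>K + f\<close> and to \<open>K - f\<close> it yields
  convergence of the expectations.

  Locally the process is Cauchy because of two factors of its transition density.  With
  \<open>a = e\<^sup>-\<^sup>t\<close>, the prefactor contains \<open>1 - a\<^sup>2\<close>, which is of order \<open>t\<close>, and the denominator contains
  \<open>(1 - a\<^sup>2)\<^sup>2 - (1 - q) a (1 - a)\<^sup>2 x y + (1 - q) a\<^sup>2 (x - y)\<^sup>2\<close>, which for \<open>x\<close> in the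
  interior of the state space is of order \<open>t\<^sup>2 + (x - y)\<^sup>2\<close>.  The remaining infinite products converge,
  and at time zero on the diagonal they cancel.  Hence the rescaled transition densities converge to
  the Cauchy density pointwise (\<open>qou_transition_scaling_limit\<close>), and they are dominated by
  \<open>C t / (x - y)\<^sup>2\<close> uniformly on the whole state space (\<open>qou_transition_le\<close>).  The first fact gives
  the convergence of finite-dimensional distributions, in the form of Fatou's lemma applied to one
  coordinate at a time (\<open>step_density_liminf\<close>).  The second one replaces a tightness argument.

  Passing from finitely many times to paths rests on sampling at distance \<open>1/n\<close>.  The step function
  through the samples of a fixed cadlag path converges to the path as \<open>n\<close> grows
  (\<open>step_path_sample_tendsto\<close>).  Hence open sets are determined by samples (\<open>open_iff_samples\<close>),
  which makes the trajectories Borel measurable; for the limit process this pointwise convergence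
  suffices.  For \<open>Y\<^sup>\<epsilon>\<close> the sampling error has to be small uniformly in \<open>\<epsilon>\<close>.  It is small unless within
  some time of order \<open>1/n\<close> the path makes two large moves (\<open>step_path_coarsen\<close>): a single jump inside a
  block is absorbed by a time change.  By the domination of the densities and Ottaviani's inequality
  two large moves in a given block have probability \<open>O(n\<^sup>-\<^sup>2)\<close> (\<open>two_large_moves\<close>), and there are
  \<open>O(n)\<close> blocks, so that the total error is \<open>O(1/n)\<close> for all \<open>\<epsilon>\<close> at once (\<open>qou_sample_error\<close>).

  Since \<open>f\<close> is merely continuous, closeness in the Skorohod topology controls \<open>f\<close> only at a given
  path.  The functionals \<open>sample_inf\<close> bridge this gap: they are Borel functions of finitely many
  samples that lie below \<open>f\<close> on a whole neighbourhood of the step function and still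
  recover \<open>f\<close> in the limit (\<open>le_liminf_sample_inf\<close>).
\<close>

section \<open>Infinite products with factors close to one\<close>

lemma prod_near_one_le:
  fixes g :: "nat \<Rightarrow> real"
  assumes "0 \<le> r" "r < 1" "\<And>k. \<bar>g k - 1\<bar> \<le> B * r ^ k"
  shows "\<bar>\<Prod>k<n. g k\<bar> \<le> exp (B / (1 - r))"
proof -
  have B: "0 \<le> B"
    using assms(3)[of 0] by simp
  have "\<bar>\<Prod>k<n. g k\<bar> = (\<Prod>k<n. \<bar>g k\<bar>)"
    by (simp add: abs_prod)
  also have "\<dots> \<le> (\<Prod>k<n. 1 + B * r ^ k)"
    using assms(3) by (intro prod_mono) (smt (verit))
  also have "\<dots> \<le> exp (\<Sum>k<n. B * r ^ k)"
    using B assms by (intro prod_le_exp_sum) auto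
  also have "\<dots> \<le> exp (\<Sum>k. B * r ^ k)"
    using B assms by (intro iffD2[OF exp_le_cancel_iff] sum_le_suminf summable_mult) (auto intro: summable_geometric)
  also have "(\<Sum>k. B * r ^ k) = B / (1 - r)"
    using assms by (simp add: suminf_mult suminf_geometric)
  finally show ?thesis .
qed

lemma convergent_prod_near_one:
  fixes g :: "nat \<Rightarrow> real"
  assumes "0 \<le> r" "r < 1" "\<And>k. \<bar>g k - 1\<bar> \<le> B * r ^ k" "\<And>k. g k \<noteq> 0"
  shows "convergent_prod g"
proof -
  have "summable (\<lambda>k. \<bar>g k - 1\<bar>)"
    by (rule summable_comparison_test'[of "\<lambda>k. B * r ^ k" 0])
       (use assms in \<open>auto intro!: summable_mult summable_geometric\<close>)
  then have "convergent_prod (\<lambda>k. 1 + (g k - 1))"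
    using assms(4) by (intro summable_imp_convergent_prod_real) auto
  then show ?thesis by simp
qed

lemma prodinf_near_one_LIMSEQ:
  fixes g :: "nat \<Rightarrow> real"
  assumes "0 \<le> r" "r < 1" "\<And>k. \<bar>g k - 1\<bar> \<le> B * r ^ k" "\<And>k. g k \<noteq> 0"
  shows "(\<lambda>n. \<Prod>k<n. g k) \<longlonglongrightarrow> prodinf g"
  using convergent_prod_LIMSEQ[OF convergent_prod_near_one[OF assms]] LIMSEQ_lessThan_iff_atMost
  by blast

lemma prodinf_near_one_le:
  fixes g :: "nat \<Rightarrow> real"
  assumes "0 \<le> r" "r < 1" "\<And>k. \<bar>g k - 1\<bar> \<le> B * r ^ k" "\<And>k. g k \<noteq> 0"
  shows "\<bar>prodinf g\<bar> \<le> exp (B / (1 - r))"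
  by (rule LIMSEQ_le_const2[OF tendsto_rabs[OF prodinf_near_one_LIMSEQ[OF assms]]])
     (use prod_near_one_le[OF assms(1-3)] in auto)

lemma prodinf_near_one_bounds:
  fixes g :: "nat \<Rightarrow> real"
  assumes "0 \<le> r" "r < 1" "\<And>k. \<bar>g k - 1\<bar> \<le> B * r ^ k" "\<And>k. 0 < g k"
  shows "0 < prodinf g" "prodinf g \<le> exp (B / (1 - r))"
proof -
  have nz: "g k \<noteq> 0" for k
    using assms(4)[of k] by simp
  show "0 < prodinf g"
    by (rule less_0_prodinf[OF convergent_prod_near_one[OF assms(1-3) nz] assms(4)])
  show "prodinf g \<le> exp (B / (1 - r))"
    using prodinf_near_one_le[OF assms(1-3) nz] by simp
qed

text \<open>The partial products telescope, so the product is one plus a series whose terms are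
  dominated by a geometric series; Tannery's theorem for series then applies.\<close>

lemma tendsto_prodinf_near_one:
  fixes g :: "nat \<Rightarrow> nat \<Rightarrow> real"
  assumes r: "0 \<le> r" "r < 1"
    and near: "\<And>j k. \<bar>g j k - 1\<bar> \<le> B * r ^ k" "\<And>j k. g j k \<noteq> 0"
    and lim: "\<And>k. (\<lambda>j. g j k) \<longlonglongrightarrow> l k" and l: "\<And>k. l k \<noteq> 0"
  shows "(\<lambda>j. prodinf (g j)) \<longlonglongrightarrow> prodinf l"
proof -
  have nearl: "\<bar>l k - 1\<bar> \<le> B * r ^ k" for k
    by (rule LIMSEQ_le_const2[OF tendsto_rabs[OF tendsto_diff[OF lim tendsto_const]]])
       (use near in auto)
  define P where "P = (\<lambda>(h :: nat \<Rightarrow> real) n. \<Prod>k<n. h k)"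
  have sums: "(\<lambda>n. P h (Suc n) - P h n) sums (prodinf h - 1)"
    if "\<And>k. \<bar>h k - 1\<bar> \<le> B * r ^ k" "\<And>k. h k \<noteq> 0" for h
    using telescope_sums[OF prodinf_near_one_LIMSEQ[OF r that]] by (simp add: P_def)
  have "\<forall>\<^sub>F (n, j) in at_top \<times>\<^sub>F sequentially.
      norm (P (g j) (Suc n) - P (g j) n) \<le> exp (B / (1 - r)) * (B * r ^ n)"
  proof (rule always_eventually, clarify)
    fix n j :: nat
    have "P (g j) (Suc n) - P (g j) n = P (g j) n * (g j n - 1)"
      by (simp add: P_def algebra_simps)
    then show "norm (P (g j) (Suc n) - P (g j) n) \<le> exp (B / (1 - r)) * (B * r ^ n)"
      using prod_near_one_le[OF r near(1)[of j], of n] near(1)[of j n]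
      by (auto simp: abs_mult P_def intro!: mult_mono)
  qed
  moreover have "(\<lambda>j. P (g j) (Suc n) - P (g j) n) \<longlonglongrightarrow> P l (Suc n) - P l n" for n
    unfolding P_def by (intro tendsto_diff tendsto_prod lim)
  moreover have "summable (\<lambda>n. exp (B / (1 - r)) * (B * r ^ n))"
    using r by (intro summable_mult summable_geometric) auto
  ultimately have "(\<lambda>j. \<Sum>n. P (g j) (Suc n) - P (g j) n) \<longlonglongrightarrow> (\<Sum>n. P l (Suc n) - P l n)"
    using tannerys_theorem[of "\<lambda>n j. P (g j) (Suc n) - P (g j) n" "\<lambda>n. P l (Suc n) - P l n"
        sequentially "\<lambda>n. exp (B / (1 - r)) * (B * r ^ n)"] by simp
  then have "(\<lambda>j. prodinf (g j) - 1) \<longlonglongrightarrow> prodinf l - 1"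
    using sums_unique[OF sums[OF near]] sums_unique[OF sums[OF nearl l]] by simp
  from tendsto_add[OF this tendsto_const[of 1]] show ?thesis by simp
qed

section \<open>The transition density of the q-Ornstein--Uhlenbeck process\<close>

lemma qou_states_iff:
  assumes "q < 1"
  shows "x \<in> qou_states q \<longleftrightarrow> (1 - q) * x\<^sup>2 \<le> 4"
proof -
  have "x \<in> qou_states q \<longleftrightarrow> \<bar>x\<bar> \<le> 2 / sqrt (1 - q)"
    by (auto simp: qou_states_def)
  also have "\<dots> \<longleftrightarrow> \<bar>x\<bar>\<^sup>2 \<le> (2 / sqrt (1 - q))\<^sup>2"
    using assms abs_le_square_iff[of "\<bar>x\<bar>" "2 / sqrt (1 - q)"] by simp
  also have "\<dots> \<longleftrightarrow> (1 - q) * x\<^sup>2 \<le> 4"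
    using assms by (simp add: power_divide field_simps)
  finally show ?thesis .
qed

lemma qou_states_mult_le:
  assumes "q < 1" "x \<in> qou_states q" "y \<in> qou_states q"
  shows "(1 - q) * \<bar>x * y\<bar> \<le> 4"
proof -
  have "2 * \<bar>x * y\<bar> \<le> x\<^sup>2 + y\<^sup>2"
    using sum_squares_bound[of "\<bar>x\<bar>" "\<bar>y\<bar>"] by (simp add: abs_mult)
  then have "(1 - q) * (2 * \<bar>x * y\<bar>) \<le> (1 - q) * (x\<^sup>2 + y\<^sup>2)"
    using assms(1) by (intro mult_left_mono) auto
  then show ?thesis
    using assms qou_states_iff[of q x] qou_states_iff[of q y] by (simp add: algebra_simps)
qed

lemma qou_speed_pos:
  assumes "q < 1" "x \<in> {- 2 / sqrt (1 - q) <..< 2 / sqrt (1 - q)}"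
  shows "0 < sqrt (4 / (1 - q) - x\<^sup>2)"
proof -
  have "\<bar>x\<bar> < 2 / sqrt (1 - q)"
    using assms(2) by auto
  then have "\<bar>x\<bar>\<^sup>2 < (2 / sqrt (1 - q))\<^sup>2"
    by (intro power_strict_mono) auto
  then show ?thesis
    using assms(1) by (simp add: power_divide)
qed

text \<open>The polynomial behind the factors \<open>\<phi>\<^sub>k\<close>: they depend on \<open>k\<close> and the time only
  through \<open>b = e\<^sup>-\<^sup>\<delta> q\<^sup>k\<close>, which makes bounds uniform in \<open>k\<close> and in time a matter of bounding \<open>b\<close>.\<close>

definition phi_poly :: "real \<Rightarrow> real \<Rightarrow> real \<Rightarrow> real \<Rightarrow> real" where
  "phi_poly q b x y = (1 - b\<^sup>2)\<^sup>2 - (1 - q) * b * (1 + b\<^sup>2) * x * y + (1 - q) * b\<^sup>2 * (x\<^sup>2 + y\<^sup>2)"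

lemma qou_phi_eq: "qou_phi q k \<delta> x y = phi_poly q (exp (- \<delta>) * q ^ k) x y"
proof -
  have "exp (- 2 * \<delta>) = (exp (- \<delta>))\<^sup>2"
    by (simp add: power2_eq_square flip: exp_add)
  moreover have "q ^ (2 * k) = (q ^ k)\<^sup>2"
    by (simp add: power_mult mult.commute)
  ultimately show ?thesis
    by (simp add: qou_phi_def phi_poly_def power_mult_distrib mult.assoc)
qed

text \<open>The reason is the identity
  \<open>phi_poly q b x y = (1 - b\<^sup>2)\<^sup>2 - (1 - q) b (1 - b)\<^sup>2 x y + (1 - q) b\<^sup>2 (x - y)\<^sup>2\<close> together with
  \<open>(1 - q) x y \<le> 4\<close> on the state space.\<close>

lemma phi_poly_ge_nonneg:
  assumes "q < 1" "x \<in> qou_states q" "y \<in> qou_states q" "0 \<le> b"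
  shows "(1 - b) ^ 4 + (1 - q) * b\<^sup>2 * (x - y)\<^sup>2 \<le> phi_poly q b x y"
proof -
  have "(1 - q) * (x * y) \<le> (1 - q) * \<bar>x * y\<bar>"
    using assms(1) by (intro mult_left_mono) auto
  then have "(1 - q) * (x * y) \<le> 4"
    using qou_states_mult_le[OF assms(1-3)] by linarith
  then have "b * (1 - b)\<^sup>2 * ((1 - q) * (x * y)) \<le> b * (1 - b)\<^sup>2 * 4"
    using assms(4) by (intro mult_left_mono) auto
  moreover have "phi_poly q b x y - (1 - b) ^ 4 - (1 - q) * b\<^sup>2 * (x - y)\<^sup>2
      = b * (1 - b)\<^sup>2 * 4 - b * (1 - b)\<^sup>2 * ((1 - q) * (x * y))"
    by (simp add: phi_poly_def algebra_simps power2_eq_square power4_eq_xxxx)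
  ultimately show ?thesis by linarith
qed

text \<open>Negative \<open>b\<close> is reduced to positive \<open>b\<close> by the symmetry \<open>(b, x) \<mapsto> (- b, - x)\<close>.\<close>

lemma phi_poly_ge:
  assumes "q < 1" "x \<in> qou_states q" "y \<in> qou_states q"
  shows "(1 - \<bar>b\<bar>) ^ 4 \<le> phi_poly q b x y"
proof (cases "0 \<le> b")
  case True
  then show ?thesis
    using phi_poly_ge_nonneg[OF assms True] assms(1) by (smt (verit) mult_nonneg_nonneg zero_le_power2)
next
  case False
  have "- x \<in> qou_states q"
    using assms(2) by (auto simp: qou_states_def)
  from phi_poly_ge_nonneg[OF assms(1) this assms(3), of "- b"] False assms(1)
  have "(1 - \<bar>b\<bar>) ^ 4 \<le> phi_poly q (- b) (- x) y"
    by (smt (verit) mult_nonneg_nonneg zero_le_power2)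
  then show ?thesis by (simp add: phi_poly_def)
qed

lemma phi_poly_pos:
  assumes "q < 1" "x \<in> qou_states q" "y \<in> qou_states q" "\<bar>b\<bar> < 1"
  shows "0 < phi_poly q b x y"
proof -
  have "0 < (1 - \<bar>b\<bar>) ^ 4"
    using assms(4) by (intro zero_less_power) simp
  then show ?thesis
    using phi_poly_ge[OF assms(1-3), of b] by linarith
qed

lemma phi_poly_near_one:
  assumes "q < 1" "x \<in> qou_states q" "y \<in> qou_states q" "\<bar>b\<bar> \<le> 1"
  shows "\<bar>phi_poly q b x y - 1\<bar> \<le> 19 * \<bar>b\<bar>"
proof -
  have "phi_poly q b x y - 1
      = b * (b * (b\<^sup>2 - 2) - (1 + b\<^sup>2) * ((1 - q) * (x * y)) + b * ((1 - q) * x\<^sup>2 + (1 - q) * y\<^sup>2))"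
    by (simp add: phi_poly_def algebra_simps power2_eq_square)
  moreover have "\<bar>b * (b\<^sup>2 - 2) - (1 + b\<^sup>2) * ((1 - q) * (x * y)) + b * ((1 - q) * x\<^sup>2 + (1 - q) * y\<^sup>2)\<bar> \<le> 19"
  proof -
    have b2: "0 \<le> b\<^sup>2" "b\<^sup>2 \<le> 1"
      using assms(4) by (auto simp: abs_square_le_1)
    have "\<bar>b * (b\<^sup>2 - 2)\<bar> \<le> 1 * 2"
      unfolding abs_mult by (intro mult_mono) (use assms b2 in auto)
    moreover have "\<bar>(1 + b\<^sup>2) * ((1 - q) * (x * y))\<bar> \<le> 2 * 4"
      unfolding abs_mult[of "1 + b\<^sup>2"] using qou_states_mult_le[OF assms(1-3)] assms(1) b2
      by (intro mult_mono) (auto simp: abs_mult)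
    moreover have "\<bar>b * ((1 - q) * x\<^sup>2 + (1 - q) * y\<^sup>2)\<bar> \<le> 1 * 8"
      unfolding abs_mult[of b] using assms qou_states_iff[of q] by (intro mult_mono) auto
    ultimately show ?thesis by linarith
  qed
  ultimately show ?thesis
    by (auto simp: abs_mult mult.commute[of "\<bar>b\<bar>"] intro!: mult_right_mono)
qed

lemma inverse_phi_poly_near_one:
  assumes "q < 1" "x \<in> qou_states q" "y \<in> qou_states q" "\<bar>b\<bar> \<le> c" "c < 1"
  shows "\<bar>1 / phi_poly q b x y - 1\<bar> \<le> 19 / (1 - c) ^ 4 * \<bar>b\<bar>"
proof -
  have "(1 - c) ^ 4 \<le> (1 - \<bar>b\<bar>) ^ 4"
    using assms by (intro power_mono) auto
  then have *: "(1 - c) ^ 4 \<le> phi_poly q b x y"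
    using phi_poly_ge[OF assms(1-3), of b] by linarith
  have c: "0 < (1 - c) ^ 4"
    using assms by simp
  have pos: "0 < phi_poly q b x y"
    using * c by linarith
  have "\<bar>1 / phi_poly q b x y - 1\<bar> = \<bar>phi_poly q b x y - 1\<bar> / phi_poly q b x y"
  proof -
    have "1 / phi_poly q b x y - 1 = - (phi_poly q b x y - 1) / phi_poly q b x y"
      using pos by (simp add: field_simps)
    then show ?thesis
      using pos by (simp only: abs_divide abs_minus_cancel abs_of_pos)
  qed
  also have "\<dots> \<le> (19 * \<bar>b\<bar>) / (1 - c) ^ 4"
    using phi_poly_near_one[OF assms(1-3), of b] * c assms by (intro frac_le) auto
  finally show ?thesis by simp
qed

text \<open>Positivity is \<open>(1 + b)\<^sup>2 - 4 b = (1 - b)\<^sup>2 > 0\<close> for \<open>b = q\<^sup>k \<ge> 0\<close>, since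
  \<open>(1 - q) x\<^sup>2 \<le> 4\<close>, and is obvious for \<open>b < 0\<close>.\<close>

lemma density_factor:
  fixes q u :: real
  assumes "\<bar>q\<bar> < 1" "x \<in> qou_states q"
  defines "g \<equiv> \<lambda>k. (1 + q ^ Suc k)\<^sup>2 - (1 - q) * x\<^sup>2 * q ^ Suc k"
  shows "0 < g k" "\<bar>g k - 1\<bar> \<le> 7 * \<bar>q\<bar> ^ k"
proof -
  define b where "b = q ^ Suc k"
  have "\<bar>q\<bar> ^ Suc k \<le> \<bar>q\<bar> ^ k"
    using assms by (intro power_decreasing) auto
  then have bk: "\<bar>b\<bar> \<le> \<bar>q\<bar> ^ k"
    by (simp only: b_def power_abs)
  have "\<bar>q\<bar> ^ Suc k < 1"
    using assms(1) by (intro power_less_one_iff[THEN iffD2]) auto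
  then have b1: "\<bar>b\<bar> < 1"
    by (simp only: b_def power_abs)
  have x: "0 \<le> (1 - q) * x\<^sup>2" "(1 - q) * x\<^sup>2 \<le> 4"
    using assms qou_states_iff[of q x] by auto
  have g: "g k = (1 + b)\<^sup>2 - (1 - q) * x\<^sup>2 * b"
    by (simp add: g_def b_def)
  show "0 < g k"
  proof (cases "0 \<le> b")
    case True
    then have "(1 - q) * x\<^sup>2 * b \<le> 4 * b"
      using x by (intro mult_right_mono)
    moreover have "(1 + b)\<^sup>2 - 4 * b = (1 - b)\<^sup>2"
      by (simp add: power2_eq_square algebra_simps)
    moreover have "0 < (1 - b)\<^sup>2"
      using b1 by simp
    ultimately show ?thesis unfolding g by linarith
  next
    case False
    then have "(1 - q) * x\<^sup>2 * b \<le> 0"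
      using x by (intro mult_nonneg_nonpos) auto
    moreover have "0 < (1 + b)\<^sup>2"
      using b1 by simp
    ultimately show ?thesis unfolding g by linarith
  qed
  have "g k - 1 = b * (2 + b - (1 - q) * x\<^sup>2)"
    by (simp add: g power2_eq_square algebra_simps)
  moreover have "\<bar>2 + b - (1 - q) * x\<^sup>2\<bar> \<le> 7"
    using x b1 by linarith
  ultimately have "\<bar>g k - 1\<bar> \<le> \<bar>q\<bar> ^ k * 7"
    using bk by (auto simp: abs_mult intro!: mult_mono)
  then show "\<bar>g k - 1\<bar> \<le> 7 * \<bar>q\<bar> ^ k" by simp
qed

lemma pochhammer_factor:
  fixes q a :: real
  assumes "\<bar>q\<bar> < 1" "0 \<le> a" "a \<le> 1"
  shows "0 < 1 - a * q ^ Suc k" "\<bar>(1 - a * q ^ Suc k) - 1\<bar> \<le> 1 * \<bar>q\<bar> ^ k"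
proof -
  have "\<bar>q\<bar> ^ Suc k \<le> \<bar>q\<bar> ^ k"
    using assms by (intro power_decreasing) auto
  moreover have "\<bar>a * q ^ Suc k\<bar> \<le> 1 * \<bar>q\<bar> ^ Suc k"
    unfolding abs_mult power_abs[symmetric] by (intro mult_mono) (use assms in \<open>auto simp: power_abs\<close>)
  moreover have "\<bar>q\<bar> ^ Suc k < 1"
    using assms(1) by (intro power_less_one_iff[THEN iffD2]) auto
  ultimately show "0 < 1 - a * q ^ Suc k" "\<bar>(1 - a * q ^ Suc k) - 1\<bar> \<le> 1 * \<bar>q\<bar> ^ k"
    by linarith+
qed

lemma phi_factor:
  fixes q a :: real
  assumes "\<bar>q\<bar> < 1" "0 \<le> a" "a \<le> 1" "x \<in> qou_states q" "y \<in> qou_states q"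
  defines "g \<equiv> \<lambda>k. 1 / phi_poly q (a * q ^ Suc k) x y"
  shows "0 < g k" "\<bar>g k - 1\<bar> \<le> 19 / (1 - \<bar>q\<bar>) ^ 4 * \<bar>q\<bar> ^ k"
proof -
  have 1: "\<bar>q\<bar> ^ Suc k \<le> \<bar>q\<bar> ^ k" "\<bar>q\<bar> ^ Suc k \<le> \<bar>q\<bar> ^ Suc 0"
    using assms by (intro power_decreasing; simp)+
  have "\<bar>a * q ^ Suc k\<bar> \<le> 1 * \<bar>q\<bar> ^ Suc k"
    unfolding abs_mult power_abs[symmetric] by (intro mult_mono) (use assms in \<open>auto simp: power_abs\<close>)
  then have 2: "\<bar>a * q ^ Suc k\<bar> \<le> \<bar>q\<bar>" "\<bar>a * q ^ Suc k\<bar> \<le> \<bar>q\<bar> ^ k"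
    using 1 by auto
  have q: "q < 1"
    using assms by auto
  have "0 < phi_poly q (a * q ^ Suc k) x y"
    by (rule phi_poly_pos[OF q assms(4,5)]) (use 2(1) assms(1) in linarith)
  then show "0 < g k"
    by (simp add: g_def)
  have "\<bar>g k - 1\<bar> \<le> 19 / (1 - \<bar>q\<bar>) ^ 4 * \<bar>a * q ^ Suc k\<bar>"
    unfolding g_def using 2 assms q by (intro inverse_phi_poly_near_one) auto
  also have "\<dots> \<le> 19 / (1 - \<bar>q\<bar>) ^ 4 * \<bar>q\<bar> ^ k"
    using 2 by (intro mult_left_mono) auto
  finally show "\<bar>g k - 1\<bar> \<le> 19 / (1 - \<bar>q\<bar>) ^ 4 * \<bar>q\<bar> ^ k" .
qed

text \<open>The three products that remain once the singular factors at \<open>k = 0\<close> are split off.\<close>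

definition poch_tail :: "real \<Rightarrow> real \<Rightarrow> real" where
  "poch_tail q a = (\<Prod>k. 1 - a * q ^ Suc k)"

definition phi_tail :: "real \<Rightarrow> real \<Rightarrow> real \<Rightarrow> real \<Rightarrow> real" where
  "phi_tail q a x y = (\<Prod>k. 1 / phi_poly q (a * q ^ Suc k) x y)"

definition density_tail :: "real \<Rightarrow> real \<Rightarrow> real" where
  "density_tail q x = (\<Prod>k. (1 + q ^ Suc k)\<^sup>2 - (1 - q) * x\<^sup>2 * q ^ Suc k)"

lemma prodinf_head_times_tail:
  fixes g :: "nat \<Rightarrow> real"
  assumes "0 \<le> r" "r < 1" "\<And>k. \<bar>g (Suc k) - 1\<bar> \<le> B * r ^ k" "\<And>k. g k \<noteq> 0"
  shows "prodinf g = g 0 * prodinf (\<lambda>k. g (Suc k))"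
proof -
  have "convergent_prod (\<lambda>k. g (Suc k))"
    using assms by (intro convergent_prod_near_one[of r _ B]) auto
  then have "convergent_prod g"
    using assms(4) by simp
  then show ?thesis
    using prodinf_split_head[of g] assms(4) by simp
qed

lemma q_pochhammer_inf_self: "q_pochhammer_inf q q = poch_tail q 1"
  by (simp add: q_pochhammer_inf_def poch_tail_def)

text \<open>The factors at \<open>k = 0\<close> are the ones that degenerate as \<open>t - s\<close> and \<open>x - y\<close> tend to zero; the
  remaining products stay bounded and bounded away from zero.\<close>

lemma qou_transition_eq:
  assumes q: "\<bar>q\<bar> < 1" and "s < t" and xy: "x \<in> qou_states q" "y \<in> qou_states q"
  defines "a \<equiv> exp (- (t - s))"
  shows "qou_transition q s t x y =
     (1 - a\<^sup>2) * poch_tail q (a\<^sup>2) * (1 / phi_poly q a x y * phi_tail q a x y) *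
     (sqrt (1 - q) * poch_tail q 1 / (2 * pi) * sqrt (4 - (1 - q) * y\<^sup>2) * density_tail q y)"
proof -
  have a: "0 < a" "a < 1"
    using \<open>s < t\<close> by (auto simp: a_def)
  then have a2: "0 \<le> a\<^sup>2" "a\<^sup>2 < 1"
    by (auto simp: power_less_one_iff)
  have ea: "exp (- 2 * (t - s)) = a\<^sup>2"
    by (simp add: a_def power2_eq_square flip: exp_add)
  have nz: "1 - a\<^sup>2 * q ^ k \<noteq> 0" for k
    using pochhammer_factor(1)[of q "a\<^sup>2" "k - 1"] q a2 by (cases k) auto
  have 1: "q_pochhammer_inf (a\<^sup>2) q = (1 - a\<^sup>2) * poch_tail q (a\<^sup>2)"
    unfolding q_pochhammer_inf_def poch_tail_def
    using prodinf_head_times_tail[of "\<bar>q\<bar>" "\<lambda>k. 1 - a\<^sup>2 * q ^ k" 1]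
      pochhammer_factor(2)[OF q, of "a\<^sup>2"] nz a2 q
    by auto
  have "0 < phi_poly q a x y"
    using a q xy by (intro phi_poly_pos) auto
  then have nz: "1 / phi_poly q (a * q ^ k) x y \<noteq> 0" for k
    using phi_factor(1)[OF q _ _ xy, of a "k - 1"] a by (cases k) auto
  have 2: "(\<Prod>k. 1 / qou_phi q k (t - s) x y) = 1 / phi_poly q a x y * phi_tail q a x y"
    unfolding qou_phi_eq phi_tail_def a_def[symmetric]
    by (subst prodinf_head_times_tail[of "\<bar>q\<bar>" _ "19 / (1 - \<bar>q\<bar>) ^ 4"])
      (use phi_factor(2)[OF q _ _ xy, of a] nz a2 q a in auto)
  show ?thesis
    unfolding qou_transition_def ea 1 2 qou_density_def density_tail_def q_pochhammer_inf_self ..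
qed

lemma poch_tail_bounds:
  assumes "\<bar>q\<bar> < 1" "0 \<le> a" "a \<le> 1"
  shows "0 < poch_tail q a" "poch_tail q a \<le> exp (1 / (1 - \<bar>q\<bar>))"
  unfolding poch_tail_def
  using prodinf_near_one_bounds[of "\<bar>q\<bar>" "\<lambda>k. 1 - a * q ^ Suc k" 1] pochhammer_factor[OF assms] assms(1)
  by auto

lemma phi_tail_bounds:
  assumes "\<bar>q\<bar> < 1" "0 \<le> a" "a \<le> 1" "x \<in> qou_states q" "y \<in> qou_states q"
  shows "0 < phi_tail q a x y" "phi_tail q a x y \<le> exp (19 / (1 - \<bar>q\<bar>) ^ 4 / (1 - \<bar>q\<bar>))"
  unfolding phi_tail_def
  using prodinf_near_one_bounds[of "\<bar>q\<bar>" "\<lambda>k. 1 / phi_poly q (a * q ^ Suc k) x y" "19 / (1 - \<bar>q\<bar>) ^ 4"]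
    phi_factor[OF assms] assms(1)
  by auto

lemma density_tail_bounds:
  assumes "\<bar>q\<bar> < 1" "x \<in> qou_states q"
  shows "0 < density_tail q x" "density_tail q x \<le> exp (7 / (1 - \<bar>q\<bar>))"
  unfolding density_tail_def
  using prodinf_near_one_bounds[of "\<bar>q\<bar>" "\<lambda>k. (1 + q ^ Suc k)\<^sup>2 - (1 - q) * x\<^sup>2 * q ^ Suc k" 7]
    density_factor[OF assms] assms(1)
  by auto

lemma qou_transition_nonneg:
  assumes "\<bar>q\<bar> < 1" "s < t" "x \<in> qou_states q" "y \<in> qou_states q"
  shows "0 \<le> qou_transition q s t x y"
proof -
  define a where "a = exp (- (t - s))"
  have a: "0 < a" "a < 1" "a\<^sup>2 \<le> 1"
    using \<open>s < t\<close> by (auto simp: a_def power_le_one)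
  have "0 < phi_poly q a x y"
    using a assms by (intro phi_poly_pos) auto
  moreover have "(1 - q) * y\<^sup>2 \<le> 4"
    using qou_states_iff[of q y] assms by auto
  ultimately show ?thesis
    unfolding qou_transition_eq[OF assms] a_def[symmetric]
    using poch_tail_bounds(1)[of q "a\<^sup>2"] poch_tail_bounds(1)[of q 1] assms a
      phi_tail_bounds(1)[of q a x y] density_tail_bounds(1)[of q y]
    by (intro mult_nonneg_nonneg divide_nonneg_nonneg) auto
qed

text \<open>This bound takes the place of tightness.  It holds because \<open>\<phi>\<^sub>0 \<ge> (1 - q) a\<^sup>2 (x - y)\<^sup>2\<close> and
  because the prefactor \<open>1 - a\<^sup>2\<close> is at most \<open>2 (t - s)\<close>.  Restricting to \<open>t - s \<le> 1\<close> keeps \<open>a\<close>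
  away from zero.\<close>

lemma qou_transition_le:
  assumes q: "\<bar>q\<bar> < 1"
  obtains C where "0 < C" "\<And>s t x y. s < t \<Longrightarrow> t \<le> s + 1 \<Longrightarrow> x \<in> qou_states q \<Longrightarrow> y \<in> qou_states q \<Longrightarrow>
    qou_transition q s t x y * (x - y)\<^sup>2 \<le> C * (t - s)"
proof
  define A where "A = exp (1 / (1 - \<bar>q\<bar>))"
  define D where "D = exp (19 / (1 - \<bar>q\<bar>) ^ 4 / (1 - \<bar>q\<bar>))"
  define E where "E = sqrt (1 - q) * A / (2 * pi) * 2 * exp (7 / (1 - \<bar>q\<bar>))"
  define C where "C = 2 * A * (exp 2 / (1 - q) * D) * E"
  have pos: "0 < A" "0 < D" "0 < E"
    using q by (auto simp: A_def D_def E_def)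
  then show "0 < C"
    using q by (auto simp: C_def)
  fix s t x y :: real
  assume st: "s < t" "t \<le> s + 1" and xy: "x \<in> qou_states q" "y \<in> qou_states q"
  define a where "a = exp (- (t - s))"
  have a: "0 < a" "a < 1" "0 \<le> a\<^sup>2" "a\<^sup>2 \<le> 1"
    using \<open>s < t\<close> by (auto simp: a_def power_le_one)
  have a2: "a\<^sup>2 = exp (- 2 * (t - s))"
    by (simp add: a_def power2_eq_square flip: exp_add)
  have "1 - a\<^sup>2 \<le> 2 * (t - s)"
    unfolding a2 using exp_ge_add_one_self[of "- 2 * (t - s)"] by linarith
  moreover have "exp (-2) \<le> a\<^sup>2"
    unfolding a2 using st by simp
  ultimately have a2: "1 - a\<^sup>2 \<le> 2 * (t - s)" "1 \<le> exp 2 * a\<^sup>2"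
    by (auto simp: exp_minus field_simps)
  have ph: "0 \<le> (1 - a) ^ 4" "(1 - a) ^ 4 + (1 - q) * a\<^sup>2 * (x - y)\<^sup>2 \<le> phi_poly q a x y"
    using a q xy by (auto intro: phi_poly_ge_nonneg)
  have ph0: "0 < phi_poly q a x y"
    using a q xy by (intro phi_poly_pos) auto
  have "(x - y)\<^sup>2 * 1 \<le> (x - y)\<^sup>2 * (exp 2 * a\<^sup>2)"
    using a2 by (intro mult_left_mono) auto
  also have "\<dots> = exp 2 / (1 - q) * ((1 - q) * a\<^sup>2 * (x - y)\<^sup>2)"
    using q by (simp add: field_simps)
  also have "\<dots> \<le> exp 2 / (1 - q) * phi_poly q a x y"
  proof (rule mult_left_mono)
    show "(1 - q) * a\<^sup>2 * (x - y)\<^sup>2 \<le> phi_poly q a x y"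
      using ph by linarith
  qed (use q in auto)
  finally have phi0: "(x - y)\<^sup>2 / phi_poly q a x y \<le> exp 2 / (1 - q)"
    using ph0 by (simp add: field_simps)
  have y: "0 \<le> 4 - (1 - q) * y\<^sup>2" "4 - (1 - q) * y\<^sup>2 \<le> 2\<^sup>2"
    using qou_states_iff[of q y] q xy by auto
  then have sq: "sqrt (4 - (1 - q) * y\<^sup>2) \<le> 2"
    by (intro real_le_lsqrt) auto
  note bounds = poch_tail_bounds[OF q a(3,4), folded A_def] poch_tail_bounds[OF q, of 1, simplified, folded A_def]
    phi_tail_bounds[OF q _ _ xy, of a, folded D_def] density_tail_bounds[OF q xy(2)]
  have dens: "sqrt (1 - q) * poch_tail q 1 / (2 * pi) * sqrt (4 - (1 - q) * y\<^sup>2) * density_tail q y \<le> E"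
    unfolding E_def using bounds sq y q a
    by (intro mult_mono divide_right_mono) (auto intro!: mult_nonneg_nonneg divide_nonneg_nonneg)
  have dens0: "0 \<le> sqrt (1 - q) * poch_tail q 1 / (2 * pi) * sqrt (4 - (1 - q) * y\<^sup>2) * density_tail q y"
    using bounds y q a by (auto intro!: mult_nonneg_nonneg divide_nonneg_nonneg)
  have "qou_transition q s t x y * (x - y)\<^sup>2 =
     (1 - a\<^sup>2) * poch_tail q (a\<^sup>2) * ((x - y)\<^sup>2 / phi_poly q a x y * phi_tail q a x y) *
     (sqrt (1 - q) * poch_tail q 1 / (2 * pi) * sqrt (4 - (1 - q) * y\<^sup>2) * density_tail q y)"
    unfolding qou_transition_eq[OF q st(1) xy] a_def[symmetric] by simp
  also have "\<dots> \<le> (2 * (t - s)) * A * (exp 2 / (1 - q) * D) * E"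
    using a2 bounds phi0 ph0 dens dens0 st q a pos by (intro mult_mono) auto
  also have "\<dots> = C * (t - s)"
    by (simp add: C_def)
  finally show "qou_transition q s t x y * (x - y)\<^sup>2 \<le> C * (t - s)" .
qed

lemma qou_states_borel [measurable]: "qou_states q \<in> sets borel"
  by (simp add: qou_states_def)

lemma borel_measurable_indicator_prodinf:
  fixes g :: "'c \<Rightarrow> nat \<Rightarrow> real"
  assumes "0 \<le> r" "r < 1"
    and S: "S \<in> sets K"
    and meas: "\<And>k. (\<lambda>w. g w k) \<in> borel_measurable K"
    and near: "\<And>w k. w \<in> S \<Longrightarrow> \<bar>g w k - 1\<bar> \<le> B * r ^ k" "\<And>w k. w \<in> S \<Longrightarrow> g w k \<noteq> 0"
  shows "(\<lambda>w. indicator S w * prodinf (g w)) \<in> borel_measurable K"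
proof (rule borel_measurable_LIMSEQ_real)
  show "(\<lambda>n. indicator S w * (\<Prod>k<n. g w k)) \<longlonglongrightarrow> indicator S w * prodinf (g w)" for w
    using prodinf_near_one_LIMSEQ[of r "g w" B] near[of w] assms(1,2)
    by (cases "w \<in> S") (auto intro: tendsto_mult)
  show "(\<lambda>w. indicator S w * (\<Prod>k<n. g w k)) \<in> borel_measurable K" for n
    using meas S by measurable
qed

lemma qou_transition_measurable:
  assumes q: "\<bar>q\<bar> < 1" and "s < t"
  shows "(\<lambda>(x, y). qou_transition q s t x y * indicator (qou_states q) x * indicator (qou_states q) y)
    \<in> borel_measurable (borel \<Otimes>\<^sub>M borel)"
proof -
  define S where "S = qou_states q \<times> qou_states q"
  define a where "a = exp (- (t - s))"
  have a: "0 \<le> a" "a \<le> 1"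
    using \<open>s < t\<close> by (auto simp: a_def)
  have S: "S \<in> sets (borel \<Otimes>\<^sub>M borel)"
    by (simp add: S_def)
  have 1: "(\<lambda>w. indicator S w * phi_tail q a (fst w) (snd w)) \<in> borel_measurable (borel \<Otimes>\<^sub>M borel)"
    unfolding phi_tail_def
  proof (rule borel_measurable_indicator_prodinf[OF _ _ S])
    show "(\<lambda>w. 1 / phi_poly q (a * q ^ Suc k) (fst w) (snd w)) \<in> borel_measurable (borel \<Otimes>\<^sub>M borel)" for k
      unfolding phi_poly_def by measurable
    fix w k assume "w \<in> S"
    then show "\<bar>1 / phi_poly q (a * q ^ Suc k) (fst w) (snd w) - 1\<bar> \<le> 19 / (1 - \<bar>q\<bar>) ^ 4 * \<bar>q\<bar> ^ k"
      "1 / phi_poly q (a * q ^ Suc k) (fst w) (snd w) \<noteq> 0"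
      using phi_factor[OF q a, of "fst w" "snd w" k] by (auto simp: S_def)
  qed (use q in auto)
  have 2: "(\<lambda>w. indicator S w * density_tail q (snd w)) \<in> borel_measurable (borel \<Otimes>\<^sub>M borel)"
    unfolding density_tail_def
  proof (rule borel_measurable_indicator_prodinf[OF _ _ S])
    fix w k assume "w \<in> S"
    then show "\<bar>(1 + q ^ Suc k)\<^sup>2 - (1 - q) * (snd w)\<^sup>2 * q ^ Suc k - 1\<bar> \<le> 7 * \<bar>q\<bar> ^ k"
      "(1 + q ^ Suc k)\<^sup>2 - (1 - q) * (snd w)\<^sup>2 * q ^ Suc k \<noteq> 0"
      using density_factor[OF q, of "snd w" k] by (auto simp: S_def)
  qed (use q in auto)
  have "(\<lambda>w. (1 - a\<^sup>2) * poch_tail q (a\<^sup>2) * (1 / phi_poly q a (fst w) (snd w) *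
      (indicator S w * phi_tail q a (fst w) (snd w))) *
     (sqrt (1 - q) * poch_tail q 1 / (2 * pi) * sqrt (4 - (1 - q) * (snd w)\<^sup>2) *
      (indicator S w * density_tail q (snd w)))) \<in> borel_measurable (borel \<Otimes>\<^sub>M borel)"
    using 1 2 unfolding phi_poly_def by measurable
  also have "?this \<longleftrightarrow> ?thesis"
  proof (rule measurable_cong)
    fix w :: "real \<times> real"
    obtain x y where w: "w = (x, y)" by (cases w)
    show "(1 - a\<^sup>2) * poch_tail q (a\<^sup>2) * (1 / phi_poly q a (fst w) (snd w) *
      (indicator S w * phi_tail q a (fst w) (snd w))) *
     (sqrt (1 - q) * poch_tail q 1 / (2 * pi) * sqrt (4 - (1 - q) * (snd w)\<^sup>2) *
      (indicator S w * density_tail q (snd w))) =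
      (case w of (x, y) \<Rightarrow> qou_transition q s t x y * indicator (qou_states q) x * indicator (qou_states q) y)"
      unfolding w using qou_transition_eq[OF q \<open>s < t\<close>, of x y, folded a_def]
      by (auto simp: S_def indicator_def)
  qed
  finally show ?thesis .
qed


lemma poch_tail_tendsto:
  assumes q: "\<bar>q\<bar> < 1" and a: "\<And>j. 0 \<le> a j" "\<And>j. a j \<le> 1" "a \<longlonglongrightarrow> 1"
  shows "(\<lambda>j. poch_tail q (a j)) \<longlonglongrightarrow> poch_tail q 1"
  unfolding poch_tail_def
proof (rule tendsto_prodinf_near_one[of "\<bar>q\<bar>"])
  fix j k
  show "\<bar>1 - a j * q ^ Suc k - 1\<bar> \<le> 1 * \<bar>q\<bar> ^ k" "1 - a j * q ^ Suc k \<noteq> 0"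
    using pochhammer_factor[OF q a(1,2), of j k] by auto
  show "(\<lambda>j. 1 - a j * q ^ Suc k) \<longlonglongrightarrow> 1 - 1 * q ^ Suc k"
    by (intro tendsto_intros a)
  show "1 - 1 * q ^ Suc k \<noteq> 0"
    using pochhammer_factor[OF q, of 1 k] by auto
qed (use q in auto)

lemma phi_tail_tendsto:
  assumes q: "\<bar>q\<bar> < 1" and a: "\<And>j. 0 \<le> a j" "\<And>j. a j \<le> 1" "a \<longlonglongrightarrow> 1"
    and X: "\<And>j. X j \<in> qou_states q" "X \<longlonglongrightarrow> x" and Y: "\<And>j. Y j \<in> qou_states q" "Y \<longlonglongrightarrow> x"
    and x: "x \<in> qou_states q"
  shows "(\<lambda>j. phi_tail q (a j) (X j) (Y j)) \<longlonglongrightarrow> phi_tail q 1 x x"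
  unfolding phi_tail_def
proof (rule tendsto_prodinf_near_one[of "\<bar>q\<bar>"])
  fix j k
  show "\<bar>1 / phi_poly q (a j * q ^ Suc k) (X j) (Y j) - 1\<bar> \<le> 19 / (1 - \<bar>q\<bar>) ^ 4 * \<bar>q\<bar> ^ k"
    "1 / phi_poly q (a j * q ^ Suc k) (X j) (Y j) \<noteq> 0"
    using phi_factor[OF q a(1,2)[of j] X(1)[of j] Y(1)[of j], of k] by auto
  show nz: "1 / phi_poly q (1 * q ^ Suc k) x x \<noteq> 0"
    using phi_factor[OF q _ _ x x, of 1 k] by auto
  then show "(\<lambda>j. 1 / phi_poly q (a j * q ^ Suc k) (X j) (Y j)) \<longlonglongrightarrow> 1 / phi_poly q (1 * q ^ Suc k) x x"
    unfolding phi_poly_def by (intro tendsto_intros a X Y) auto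
qed (use q in auto)

lemma density_tail_tendsto:
  assumes q: "\<bar>q\<bar> < 1" and X: "\<And>j. X j \<in> qou_states q" "X \<longlonglongrightarrow> x" and x: "x \<in> qou_states q"
  shows "(\<lambda>j. density_tail q (X j)) \<longlonglongrightarrow> density_tail q x"
  unfolding density_tail_def
proof (rule tendsto_prodinf_near_one[of "\<bar>q\<bar>"])
  fix j k
  show "\<bar>(1 + q ^ Suc k)\<^sup>2 - (1 - q) * (X j)\<^sup>2 * q ^ Suc k - 1\<bar> \<le> 7 * \<bar>q\<bar> ^ k"
    "(1 + q ^ Suc k)\<^sup>2 - (1 - q) * (X j)\<^sup>2 * q ^ Suc k \<noteq> 0"
    using density_factor[OF q X(1)[of j], of k] by auto
  show "(1 + q ^ Suc k)\<^sup>2 - (1 - q) * x\<^sup>2 * q ^ Suc k \<noteq> 0"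
    using density_factor[OF q x, of k] by auto
  show "(\<lambda>j. (1 + q ^ Suc k)\<^sup>2 - (1 - q) * (X j)\<^sup>2 * q ^ Suc k) \<longlonglongrightarrow>
      (1 + q ^ Suc k)\<^sup>2 - (1 - q) * x\<^sup>2 * q ^ Suc k"
    by (intro tendsto_intros X)
qed (use q in auto)

text \<open>Factor by factor, for \<open>b = q\<^sup>k\<close>: \<open>phi_poly q b x x = (1 - b)\<^sup>2 ((1 + b)\<^sup>2 - (1 - q) x\<^sup>2 b)\<close>.\<close>

lemma phi_tail_diagonal:
  assumes q: "\<bar>q\<bar> < 1" and x: "x \<in> qou_states q"
  shows "phi_tail q 1 x x * (poch_tail q 1)\<^sup>2 * density_tail q x = 1"
proof -
  note f = phi_factor[OF q _ _ x x, of 1] pochhammer_factor[OF q, of 1] density_factor[OF q x]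
  have nz: "1 / phi_poly q (1 * q ^ Suc k) x x \<noteq> 0" "1 - 1 * q ^ Suc k \<noteq> 0"
    "(1 + q ^ Suc k)\<^sup>2 - (1 - q) * x\<^sup>2 * q ^ Suc k \<noteq> 0" for k
    using f(1)[of k] f(3)[of k] f(5)[of k] by auto
  have c1: "convergent_prod (\<lambda>k. 1 / phi_poly q (1 * q ^ Suc k) x x)"
    using f(2) nz q by (intro convergent_prod_near_one[of "\<bar>q\<bar>" _ "19 / (1 - \<bar>q\<bar>) ^ 4"]) auto
  have c2: "convergent_prod (\<lambda>k. 1 - 1 * q ^ Suc k)"
    using f(4) nz q by (intro convergent_prod_near_one[of "\<bar>q\<bar>" _ 1]) auto
  have c3: "convergent_prod (\<lambda>k. (1 + q ^ Suc k)\<^sup>2 - (1 - q) * x\<^sup>2 * q ^ Suc k)"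
    using f(6) nz q by (intro convergent_prod_near_one[of "\<bar>q\<bar>" _ 7]) auto
  have "phi_tail q 1 x x * (poch_tail q 1)\<^sup>2 * density_tail q x =
     (\<Prod>k. 1 / phi_poly q (1 * q ^ Suc k) x x * ((1 - 1 * q ^ Suc k) * (1 - 1 * q ^ Suc k)) *
       ((1 + q ^ Suc k)\<^sup>2 - (1 - q) * x\<^sup>2 * q ^ Suc k))"
    unfolding phi_tail_def poch_tail_def density_tail_def power2_eq_square[of "prodinf _"]
      prodinf_mult[OF c2 c2] prodinf_mult[OF c1 convergent_prod_mult[OF c2 c2]]
      prodinf_mult[OF convergent_prod_mult[OF c1 convergent_prod_mult[OF c2 c2]] c3] ..
  also have "\<dots> = (\<Prod>k::nat. 1)"
  proof (rule prodinf_cong)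
    fix k
    have "phi_poly q (1 * q ^ Suc k) x x =
        (1 - 1 * q ^ Suc k) * (1 - 1 * q ^ Suc k) * ((1 + q ^ Suc k)\<^sup>2 - (1 - q) * x\<^sup>2 * q ^ Suc k)"
      unfolding phi_poly_def mult_1 by algebra
    then show "1 / phi_poly q (1 * q ^ Suc k) x x * ((1 - 1 * q ^ Suc k) * (1 - 1 * q ^ Suc k)) *
       ((1 + q ^ Suc k)\<^sup>2 - (1 - q) * x\<^sup>2 * q ^ Suc k) = 1"
      using nz(1)[of k] by (simp add: mult.assoc)
  qed
  finally show ?thesis by simp
qed

text \<open>The singular quotient \<open>(1 - a\<^sup>2) / \<phi>\<^sub>0\<close>, of order \<open>1/e\<close>, produces the Cauchy density; all other
  factors converge to their values at time zero on the diagonal, where they cancel.  The indicators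
  vanish only for finitely many \<open>j\<close>, because \<open>x\<close> is an interior point.\<close>

lemma qou_transition_scaling_limit:
  fixes q x d u v :: real and e s t :: "nat \<Rightarrow> real"
  assumes q: "\<bar>q\<bar> < 1" and x: "x \<in> {- 2 / sqrt (1 - q) <..< 2 / sqrt (1 - q)}"
    and d: "0 < d" and e: "\<And>j. 0 < e j" "e \<longlonglongrightarrow> 0" and st: "\<And>j. t j - s j = e j * d"
  defines "c \<equiv> sqrt (4 / (1 - q) - x\<^sup>2)"
  shows "(\<lambda>j. e j * qou_transition q (s j) (t j) (x + e j * u) (x + e j * v) *
      indicator (qou_states q) (x + e j * u) * indicator (qou_states q) (x + e j * v)) \<longlonglongrightarrow>
      1 / pi * (c * d / ((v - u)\<^sup>2 + (c * d)\<^sup>2))"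
proof -
  have ev: "\<forall>\<^sub>F j in sequentially. x + e j * w \<in> qou_states q" for w
  proof -
    have "(\<lambda>j. x + e j * w) \<longlonglongrightarrow> x + 0 * w"
      by (intro tendsto_intros e)
    then have "\<forall>\<^sub>F j in sequentially. x + e j * w \<in> {- 2 / sqrt (1 - q) <..< 2 / sqrt (1 - q)}"
      using x by (intro topological_tendstoD) auto
    then show ?thesis
      by eventually_elim (auto simp: qou_states_def)
  qed
  have "\<forall>\<^sub>F j in sequentially. x + e j * u \<in> qou_states q \<and> x + e j * v \<in> qou_states q"
    using ev[of u] ev[of v] by (rule eventually_conj)
  then obtain J where J: "\<And>j. J \<le> j \<Longrightarrow> x + e j * u \<in> qou_states q" "\<And>j. J \<le> j \<Longrightarrow> x + e j * v \<in> qou_states q"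
    unfolding eventually_sequentially by blast
  \<comment> \<open>from some index on both rescaled points lie in the state space; the shift does not change the limit\<close>
  define f where "f j = e (j + J)" for j
  define a where "a j = exp (- (f j * d))" for j
  define X where "X j = x + f j * u" for j
  define Y where "Y j = x + f j * v" for j
  have f: "0 < f j" "f \<longlonglongrightarrow> 0" for j
    using e by (auto simp: f_def[abs_def] intro: LIMSEQ_ignore_initial_segment)
  have XS: "X j \<in> qou_states q" "Y j \<in> qou_states q" for j
    using J[of "j + J"] by (auto simp: X_def Y_def f_def)
  have xS: "x \<in> qou_states q"
    using x by (auto simp: qou_states_def)
  have X: "X \<longlonglongrightarrow> x"
    unfolding X_def[abs_def] using tendsto_add[OF tendsto_const tendsto_mult[OF f(2) tendsto_const[of u]], of x] by simp
  have Y: "Y \<longlonglongrightarrow> x"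
    unfolding Y_def[abs_def] using tendsto_add[OF tendsto_const tendsto_mult[OF f(2) tendsto_const[of v]], of x] by simp
  have a01: "0 < a j" "a j < 1" "0 \<le> (a j)\<^sup>2" "(a j)\<^sup>2 \<le> 1" for j
    using f(1)[of j] d by (auto simp: a_def power_le_one)
  have "a \<longlonglongrightarrow> exp (- (0 * d))"
    unfolding a_def[abs_def] by (intro tendsto_intros f)
  then have a1: "a \<longlonglongrightarrow> 1" by simp
  then have a2: "(\<lambda>j. (a j)\<^sup>2) \<longlonglongrightarrow> 1"
    using tendsto_power[OF a1, of 2] by simp
  have da: "(\<lambda>j. (1 - a j) / f j) \<longlonglongrightarrow> d"
  proof -
    have "((\<lambda>h. exp (- (h * d))) has_real_derivative (exp (- (0 * d)) * (- (1 * d)))) (at 0)"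
      by (auto intro!: derivative_eq_intros)
    then have "((\<lambda>h. (exp (- (h * d)) - 1) / h) \<longlongrightarrow> - d) (at 0)"
      by (simp add: has_field_derivative_iff)
    moreover have "filterlim f (at 0) sequentially"
      using f by (auto simp: filterlim_at less_imp_neq[THEN not_sym])
    ultimately have "(\<lambda>j. (exp (- (f j * d)) - 1) / f j) \<longlonglongrightarrow> - d"
      by (rule filterlim_compose)
    from tendsto_minus[OF this] show ?thesis
      by (simp add: a_def minus_divide_left)
  qed
  have da2: "(\<lambda>j. (1 - (a j)\<^sup>2) / f j) \<longlonglongrightarrow> 2 * d"
  proof -
    have "(\<lambda>j. (1 - a j) / f j * (1 + a j)) \<longlonglongrightarrow> d * (1 + 1)"
      by (intro tendsto_intros da a1)
    moreover have "(1 - a j) / f j * (1 + a j) = (1 - (a j)\<^sup>2) / f j" for j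
    proof -
      have "(1 - a j) * (1 + a j) = 1 - (a j)\<^sup>2"
        by (simp add: power2_eq_square algebra_simps)
      then show ?thesis by simp
    qed
    ultimately show ?thesis by (simp only: one_add_one mult.commute[of d])
  qed
  define Q where "Q = (2 * d)\<^sup>2 - (1 - q) * 1 * d\<^sup>2 * (x * x) + (1 - q) * 1 * (u - v)\<^sup>2"
  have phi: "(\<lambda>j. phi_poly q (a j) (X j) (Y j) / (f j)\<^sup>2) \<longlonglongrightarrow> Q"
  proof -
    have "phi_poly q (a j) (X j) (Y j) / (f j)\<^sup>2 =
       ((1 - (a j)\<^sup>2) / f j)\<^sup>2 - (1 - q) * a j * ((1 - a j) / f j)\<^sup>2 * (X j * Y j) + (1 - q) * (a j)\<^sup>2 * (u - v)\<^sup>2" for j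
    proof -
      have "phi_poly q (a j) (X j) (Y j) =
        (1 - (a j)\<^sup>2)\<^sup>2 - (1 - q) * a j * (1 - a j)\<^sup>2 * (X j * Y j) + (1 - q) * (a j)\<^sup>2 * (X j - Y j)\<^sup>2"
        unfolding phi_poly_def by algebra
      also have "X j - Y j = f j * (u - v)"
        by (simp add: X_def Y_def algebra_simps)
      finally show ?thesis
        using f(1)[of j]
        by (simp add: add_divide_distrib diff_divide_distrib[of _ _ "(f j)\<^sup>2"] power_divide power_mult_distrib)
    qed
    then show ?thesis
      unfolding Q_def by (simp only:) (intro tendsto_intros da2 da a1 a2 X Y)
  qed
  have q1: "0 < 1 - q"
    using q by auto
  have c0: "0 < c"
    unfolding c_def using q x by (intro qou_speed_pos) auto
  then have c2: "c\<^sup>2 = 4 / (1 - q) - x\<^sup>2"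
    by (simp add: c_def)
  have Q: "Q = (1 - q) * ((v - u)\<^sup>2 + (c * d)\<^sup>2)"
    unfolding power_mult_distrib c2 Q_def using q1 by (simp add: field_simps power2_eq_square)
  have Q0: "0 < Q"
    unfolding Q using q1 c0 d by (intro mult_pos_pos add_nonneg_pos) auto
  let ?R = "\<lambda>j. (1 - (a j)\<^sup>2) / f j * poch_tail q ((a j)\<^sup>2) *
      (1 / (phi_poly q (a j) (X j) (Y j) / (f j)\<^sup>2) * phi_tail q (a j) (X j) (Y j)) *
      (sqrt (1 - q) * poch_tail q 1 / (2 * pi) * sqrt (4 - (1 - q) * (Y j)\<^sup>2) * density_tail q (Y j))"
  define T where "T j = e j * qou_transition q (s j) (t j) (x + e j * u) (x + e j * v) *
      indicator (qou_states q) (x + e j * u) * indicator (qou_states q) (x + e j * v)" for j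
  define P D where "P = poch_tail q 1" and "D = density_tail q x"
  let ?L = "2 * d * P * (1 / Q * phi_tail q 1 x x) *
      (sqrt (1 - q) * poch_tail q 1 / (2 * pi) * sqrt (4 - (1 - q) * x\<^sup>2) * D)"
  have "?R
    \<longlonglongrightarrow> ?L"
    unfolding P_def D_def
    using Q0 a01(1,2)[THEN less_imp_le] a01
    by (intro tendsto_intros da2 phi Y poch_tail_tendsto[OF q] phi_tail_tendsto[OF q]
        density_tail_tendsto[OF q] a1 a2 XS xS X) auto
  moreover have "?R j
    = T (j + J)" for j
  proof -
    have "s (j + J) < t (j + J)"
      using st[of "j + J"] e(1)[of "j + J"] d by (smt (verit) mult_pos_pos)
    from qou_transition_eq[OF q this XS[of j]]
    have "qou_transition q (s (j + J)) (t (j + J)) (X j) (Y j) = (1 - (a j)\<^sup>2) * poch_tail q ((a j)\<^sup>2) *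
      (1 / (phi_poly q (a j) (X j) (Y j)) * phi_tail q (a j) (X j) (Y j)) *
      (sqrt (1 - q) * poch_tail q 1 / (2 * pi) * sqrt (4 - (1 - q) * (Y j)\<^sup>2) * density_tail q (Y j))"
      by (simp add: st a_def f_def)
    moreover have "e (j + J) = f j" "x + f j * u = X j" "x + f j * v = Y j"
      by (auto simp: f_def X_def Y_def)
    moreover have "A / h * B * (1 / (\<phi> / h\<^sup>2) * T) * R = h * (A * B * (1 / \<phi> * T) * R)"
      if "h \<noteq> 0" for A B T R h \<phi> :: real
      using that by (simp add: power2_eq_square)
    ultimately show ?thesis
      using f(1)[of j] XS[of j] by (simp add: T_def)
  qed
  moreover have "?L =
      1 / pi * (c * d / ((v - u)\<^sup>2 + (c * d)\<^sup>2))"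
  proof -
    have s: "sqrt (4 - (1 - q) * x\<^sup>2) = sqrt (1 - q) * c"
    proof -
      have "4 - (1 - q) * x\<^sup>2 = (1 - q) * (4 / (1 - q) - x\<^sup>2)"
        using q1 by (simp add: field_simps)
      then show ?thesis
        by (simp only: c_def real_sqrt_mult)
    qed
    have alg: "2 * d * P * (1 / Q * T) * (r * P / (2 * pi) * (r * c) * D) = T * P\<^sup>2 * D * ((r * r) * c * d / (pi * Q))"
      for T r by (simp add: power2_eq_square mult_ac)
    have "?L =
      (phi_tail q 1 x x * (poch_tail q 1)\<^sup>2 * density_tail q x) *
      ((sqrt (1 - q) * sqrt (1 - q)) * c * d / (pi * Q))"
      unfolding s P_def[symmetric] D_def[symmetric] by (rule alg)
    also have "\<dots> = (1 - q) * c * d / (pi * Q)"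
      unfolding phi_tail_diagonal[OF q xS] using q1 by simp
    finally show ?thesis
      unfolding Q using q1 by simp
  qed
  ultimately have "(\<lambda>j. T (j + J)) \<longlonglongrightarrow>
      1 / pi * (c * d / ((v - u)\<^sup>2 + (c * d)\<^sup>2))" by simp
  then show ?thesis
    unfolding T_def by (rule LIMSEQ_offset)
qed

section \<open>Time changes and Skorohod neighbourhoods\<close>

lemma partition_index:
  fixes a :: "nat \<Rightarrow> real"
  assumes "a 0 = 0" "\<And>t. \<exists>i. t < a i" "0 \<le> s"
  obtains i where "a i \<le> s" "s < a (Suc i)"
proof -
  define i where "i = (LEAST i. s < a i)"
  have "s < a i"
    unfolding i_def by (rule LeastI_ex) (rule assms)
  moreover have "i \<noteq> 0"
    using \<open>s < a i\<close> assms by (metis not_less)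
  moreover have "\<not> s < a (i - 1)"
    using \<open>i \<noteq> 0\<close> not_less_Least[of "i - 1" "\<lambda>i. s < a i"] by (auto simp: i_def)
  ultimately show ?thesis
    using that[of "i - 1"] by auto
qed

lemma partition_index_unique:
  fixes a :: "nat \<Rightarrow> real"
  assumes "strict_mono a" "a i \<le> s" "s < a (Suc i)" "a j \<le> s" "s < a (Suc j)"
  shows "i = j"
proof -
  have "a i < a (Suc j)" "a j < a (Suc i)"
    using assms by auto
  then show ?thesis
    using assms(1) by (simp add: strict_mono_less)
qed

text \<open>The time change is the piecewise linear interpolation of \<open>a i \<mapsto> b i\<close>; its displacement at a
  point is a convex combination of the displacements at the two neighbouring partition points.\<close>

lemma piecewise_linear_time_change:
  fixes a b :: "nat \<Rightarrow> real"
  assumes a: "strict_mono a" "a 0 = 0" "\<And>t. \<exists>i. t < a i"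
    and b: "strict_mono b" "b 0 = 0" "\<And>t. \<exists>i. t < b i"
    and d: "\<And>i. \<bar>b i - a i\<bar> \<le> d"
  obtains \<theta> where "\<theta> \<in> time_changes" "\<And>s. 0 \<le> s \<Longrightarrow> \<bar>\<theta> s - s\<bar> \<le> d"
    "\<And>i s. a i \<le> s \<Longrightarrow> s < a (Suc i) \<Longrightarrow> b i \<le> \<theta> s \<and> \<theta> s < b (Suc i)"
proof
  define r where "r i = (b (Suc i) - b i) / (a (Suc i) - a i)" for i
  have aS: "a i < a (Suc i)" and bS: "b i < b (Suc i)" for i
    using a(1) b(1) by (auto simp: strict_mono_less)
  then have r: "0 < r i" "r i * (a (Suc i) - a i) = b (Suc i) - b i" for i
    by (auto simp: r_def) (metis diff_gt_0_iff_gt less_irrefl nonzero_eq_divide_eq)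
  define \<theta> where "\<theta> s = (let i = SOME i. a i \<le> s \<and> s < a (Suc i) in b i + r i * (s - a i))" for s
  have \<theta>: "\<theta> s = b i + r i * (s - a i)" if "a i \<le> s" "s < a (Suc i)" for i s
  proof -
    have "(SOME i. a i \<le> s \<and> s < a (Suc i)) = i"
      using that partition_index_unique[OF a(1)] by (intro some_equality) auto
    then show ?thesis by (simp add: \<theta>_def)
  qed
  show range: "b i \<le> \<theta> s \<and> \<theta> s < b (Suc i)" if "a i \<le> s" "s < a (Suc i)" for i s
  proof -
    have "r i * (s - a i) < r i * (a (Suc i) - a i)" "0 \<le> r i * (s - a i)"
      using that r(1)[of i] by auto
    then show ?thesis
      unfolding \<theta>[OF that] using r(2)[of i] by auto
  qed
  show "\<bar>\<theta> s - s\<bar> \<le> d" if s: "0 \<le> s" for s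
  proof -
    obtain i where i: "a i \<le> s" "s < a (Suc i)"
      using partition_index[OF a(2,3) s] .
    define l where "l = (s - a i) / (a (Suc i) - a i)"
    have l: "0 \<le> l" "l \<le> 1" "l * (a (Suc i) - a i) = s - a i"
      using i aS[of i] by (auto simp: l_def field_simps)
    have "r i * (s - a i) = l * (b (Suc i) - b i)"
      using r(2)[of i] l(3) by (metis mult.commute mult.left_commute)
    then have "\<theta> s - s = (1 - l) * (b i - a i) + l * (b (Suc i) - a (Suc i))"
      using \<theta>[OF i] l(3) by (simp add: algebra_simps)
    also have "\<bar>\<dots>\<bar> \<le> (1 - l) * d + l * d"
      using l d[of i] d[of "Suc i"]
      by (intro abs_triangle_ineq[THEN order_trans] add_mono) (auto simp: abs_mult intro!: mult_left_mono)
    finally show ?thesis by (simp add: algebra_simps)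
  qed
  show "\<theta> \<in> time_changes"
    unfolding time_changes_def
  proof (intro CollectI conjI)
    show "strict_mono_on {0..} \<theta>"
    proof (rule strict_mono_onI)
      fix s t :: real assume st: "s \<in> {0..}" "t \<in> {0..}" "s < t"
      obtain i where i: "a i \<le> s" "s < a (Suc i)"
        using partition_index[OF a(2,3), of s] st by auto
      obtain j where j: "a j \<le> t" "t < a (Suc j)"
        using partition_index[OF a(2,3), of t] st by auto
      have "a i < a (Suc j)"
        using i j st by linarith
      then have "i \<le> j"
        using a(1) by (simp add: strict_mono_less)
      show "\<theta> s < \<theta> t"
      proof (cases "i = j")
        case True
        then show ?thesis
          using \<theta>[OF i] \<theta>[OF j] st r(1)[of i] by auto
      next
        case False
        then have "b (Suc i) \<le> b j"
          using \<open>i \<le> j\<close> b(1) by (simp add: strict_mono_less_eq)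
        then show ?thesis
          using range[OF i] range[OF j] by linarith
      qed
    qed
    show "\<theta> ` {0..} = {0..}"
    proof (intro equalityI subsetI)
      fix t assume "t \<in> \<theta> ` {0..}"
      then obtain s where s: "0 \<le> s" "t = \<theta> s" by auto
      obtain i where i: "a i \<le> s" "s < a (Suc i)"
        using partition_index[OF a(2,3) s(1)] .
      have "b 0 \<le> b i"
        using b(1) by (simp add: strict_mono_less_eq)
      then show "t \<in> {0..}"
        using range[OF i] s b(2) by auto
    next
      fix t :: real assume "t \<in> {0..}"
      then obtain i where i: "b i \<le> t" "t < b (Suc i)"
        using partition_index[OF b(2,3), of t] by auto
      define s where "s = a i + (t - b i) / r i"
      have "(t - b i) / r i < (b (Suc i) - b i) / r i"
        using i r(1)[of i] by (intro divide_strict_right_mono) auto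
      also have "\<dots> = a (Suc i) - a i"
        using r[of i] by (simp add: field_simps)
      finally have s: "a i \<le> s" "s < a (Suc i)"
        using i r(1)[of i] by (auto simp: s_def)
      have "a 0 \<le> a i"
        using a(1) by (simp add: strict_mono_less_eq)
      moreover have "\<theta> s = t"
        using \<theta>[OF s] r(1)[of i] by (simp add: s_def)
      ultimately show "t \<in> \<theta> ` {0..}"
        using s a(2) by (intro image_eqI[of _ _ s]) auto
    qed
  qed
qed

lemma time_change_nonneg: "\<theta> \<in> time_changes \<Longrightarrow> 0 \<le> s \<Longrightarrow> 0 \<le> \<theta> s"
  unfolding time_changes_def by auto

lemma time_change_inverse:
  assumes "\<theta> \<in> time_changes"
  obtains \<theta>' where "\<theta>' \<in> time_changes" "\<And>s. 0 \<le> s \<Longrightarrow> \<theta> (\<theta>' s) = s"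
proof
  define \<theta>' where "\<theta>' = the_inv_into {0..} \<theta>"
  have mono: "strict_mono_on {0..} \<theta>" and im: "\<theta> ` {0..} = {0..}"
    using assms by (auto simp: time_changes_def)
  have inj: "inj_on \<theta> {0..}"
    using mono by (rule strict_mono_on_imp_inj_on)
  show inv: "\<theta> (\<theta>' s) = s" if "0 \<le> s" for s
    unfolding \<theta>'_def using that im inj by (intro f_the_inv_into_f) auto
  have im': "\<theta>' ` {0..} = {0..}"
    using the_inv_into_onto[OF inj] im by (simp add: \<theta>'_def)
  have "strict_mono_on {0..} \<theta>'"
  proof (rule strict_mono_onI, rule ccontr)
    fix s t :: real assume st: "s \<in> {0..}" "t \<in> {0..}" "s < t" "\<not> \<theta>' s < \<theta>' t"
    have "\<theta>' s \<in> {0..}" "\<theta>' t \<in> {0..}"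
      using im' st by blast+
    then have "\<theta> (\<theta>' t) \<le> \<theta> (\<theta>' s)"
      using mono st by (metis not_less strict_mono_on_leD)
    then show False
      using inv[of s] inv[of t] st by auto
  qed
  then show "\<theta>' \<in> time_changes"
    using im' by (simp add: time_changes_def)
qed

lemma time_change_comp:
  assumes "\<theta> \<in> time_changes" "\<eta> \<in> time_changes"
  shows "(\<lambda>s. \<theta> (\<eta> s)) \<in> time_changes"
proof -
  have "strict_mono_on {0..} (\<lambda>s. \<theta> (\<eta> s))"
    using assms time_change_nonneg[OF assms(2)]
    by (intro strict_mono_onI) (auto simp: time_changes_def strict_mono_on_def)
  moreover have "(\<lambda>s. \<theta> (\<eta> s)) ` {0..} = \<theta> ` \<eta> ` {0..}"
    by auto
  ultimately show ?thesis
    using assms by (simp add: time_changes_def)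
qed

lemma skorohod_nbhd_cadlag: "\<beta> \<in> skorohod_nbhd \<alpha> \<delta> \<Longrightarrow> \<beta> \<in> cadlag"
  by (simp add: skorohod_nbhd_def)

lemma skorohod_nbhdI:
  assumes "\<beta> \<in> cadlag" "\<theta> \<in> time_changes" "\<And>s. 0 \<le> s \<Longrightarrow> \<bar>\<theta> s - s\<bar> < \<delta>"
    "\<And>s. s \<in> {0..1/\<delta>} \<Longrightarrow> \<bar>\<beta> (\<theta> s) - \<alpha> s\<bar> < \<delta>"
  shows "\<beta> \<in> skorohod_nbhd \<alpha> \<delta>"
  unfolding skorohod_nbhd_def using assms by blast

text \<open>The neighbourhoods behave like balls of a metric, up to a factor two in the radius that
  pays for the time horizon \<open>1/\<epsilon>\<close> being moved by a time change.\<close>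

lemma skorohod_nbhd_refl:
  assumes "\<alpha> \<in> cadlag" "0 < \<delta>"
  shows "\<alpha> \<in> skorohod_nbhd \<alpha> \<delta>"
proof -
  have "(\<lambda>s. s) \<in> time_changes"
    by (simp add: time_changes_def strict_mono_on_def)
  then show ?thesis
    unfolding skorohod_nbhd_def using assms by (intro CollectI conjI bexI[of _ "\<lambda>s. s"]) auto
qed

lemma skorohod_nbhd_sym:
  assumes \<beta>: "\<beta> \<in> skorohod_nbhd \<alpha> (\<delta> / 2)" and \<alpha>: "\<alpha> \<in> cadlag" and \<delta>: "0 < \<delta>" "\<delta> \<le> 1"
  shows "\<alpha> \<in> skorohod_nbhd \<beta> \<delta>"
proof -
  obtain \<theta> where \<theta>: "\<theta> \<in> time_changes" "\<And>s. 0 \<le> s \<Longrightarrow> \<bar>\<theta> s - s\<bar> < \<delta> / 2"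
    "\<And>s. 0 \<le> s \<Longrightarrow> s \<le> 1 / (\<delta> / 2) \<Longrightarrow> \<bar>\<beta> (\<theta> s) - \<alpha> s\<bar> < \<delta> / 2"
    using \<beta> by (auto simp: skorohod_nbhd_def)
  obtain \<theta>' where \<theta>': "\<theta>' \<in> time_changes" "\<And>s. 0 \<le> s \<Longrightarrow> \<theta> (\<theta>' s) = s"
    using time_change_inverse[OF \<theta>(1)] by blast
  have close: "\<bar>\<theta>' s - s\<bar> < \<delta> / 2" if "0 \<le> s" for s
    using \<theta>(2)[OF time_change_nonneg[OF \<theta>'(1) that]] \<theta>'(2)[OF that] by (simp add: abs_minus_commute)
  have "\<bar>\<alpha> (\<theta>' s) - \<beta> s\<bar> < \<delta>" if s: "s \<in> {0..1/\<delta>}" for s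
  proof -
    have "1 \<le> 1 / \<delta>"
      using \<delta> by simp
    moreover have "0 \<le> s" "s \<le> 1 / \<delta>"
      using s by auto
    moreover have "\<bar>\<theta>' s - s\<bar> < \<delta> / 2"
      using s by (intro close) auto
    ultimately have "\<theta>' s \<le> 1 / \<delta> + 1 / \<delta>"
      using \<delta>(2) by linarith
    also have "\<dots> = 1 / (\<delta> / 2)"
      by simp
    finally have "\<theta>' s \<le> 1 / (\<delta> / 2)" .
    then show ?thesis
      using \<theta>(3)[of "\<theta>' s"] time_change_nonneg[OF \<theta>'(1), of s] \<theta>'(2)[of s] s \<delta>
      by (simp add: abs_minus_commute)
  qed
  then show ?thesis
    unfolding skorohod_nbhd_def using \<alpha> \<theta>'(1) close \<delta> by (force intro!: bexI[of _ \<theta>'])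
qed

lemma skorohod_nbhd_trans:
  assumes \<beta>: "\<beta> \<in> skorohod_nbhd \<alpha> \<delta>" and \<gamma>: "\<gamma> \<in> skorohod_nbhd \<beta> \<delta>" and \<delta>: "0 < \<delta>" "\<delta> \<le> 1 / 2"
  shows "\<gamma> \<in> skorohod_nbhd \<alpha> (2 * \<delta>)"
proof -
  obtain \<theta> where \<theta>: "\<theta> \<in> time_changes" "\<And>s. 0 \<le> s \<Longrightarrow> \<bar>\<theta> s - s\<bar> < \<delta>"
    "\<And>s. 0 \<le> s \<Longrightarrow> s \<le> 1 / \<delta> \<Longrightarrow> \<bar>\<beta> (\<theta> s) - \<alpha> s\<bar> < \<delta>"
    using \<beta> by (auto simp: skorohod_nbhd_def)
  obtain \<eta> where \<eta>: "\<eta> \<in> time_changes" "\<And>s. 0 \<le> s \<Longrightarrow> \<bar>\<eta> s - s\<bar> < \<delta>"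
    "\<And>s. 0 \<le> s \<Longrightarrow> s \<le> 1 / \<delta> \<Longrightarrow> \<bar>\<gamma> (\<eta> s) - \<beta> s\<bar> < \<delta>"
    using \<gamma> by (auto simp: skorohod_nbhd_def)
  have "\<bar>\<eta> (\<theta> s) - s\<bar> < 2 * \<delta>" if "0 \<le> s" for s
    using \<theta>(2)[OF that] \<eta>(2)[OF time_change_nonneg[OF \<theta>(1) that]] by linarith
  moreover have "\<bar>\<gamma> (\<eta> (\<theta> s)) - \<alpha> s\<bar> < 2 * \<delta>" if s: "s \<in> {0..1/(2 * \<delta>)}" for s
  proof -
    have "\<delta> * (2 * \<delta>) \<le> 1 / 2 * 1"
      using \<delta> by (intro mult_mono) auto
    then have "1 / (2 * \<delta>) + \<delta> \<le> 1 / \<delta>"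
      using \<delta> by (simp add: field_simps)
    moreover have "0 \<le> \<theta> s" "\<theta> s \<le> 1 / (2 * \<delta>) + \<delta>"
      using \<theta>(2)[of s] s time_change_nonneg[OF \<theta>(1), of s] by auto
    moreover have "s \<le> 1 / \<delta>"
      using s calculation \<delta> by auto
    ultimately show ?thesis
      using \<theta>(3)[of s] \<eta>(3)[of "\<theta> s"] s by auto
  qed
  moreover have "\<gamma> \<in> cadlag"
    using \<gamma> by (rule skorohod_nbhd_cadlag)
  ultimately show ?thesis
    unfolding skorohod_nbhd_def using time_change_comp[OF \<eta>(1) \<theta>(1)]
    by (intro CollectI conjI bexI[of _ "\<lambda>s. \<eta> (\<theta> s)"]) auto
qed

section \<open>Step functions\<close>

definition step_path :: "nat \<Rightarrow> (nat \<Rightarrow> real) \<Rightarrow> real \<Rightarrow> real" where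
  "step_path n v = (\<lambda>t\<in>{0..}. v (nat \<lfloor>real n * t\<rfloor>))"

lemma step_path_cadlag:
  assumes n: "0 < n"
  shows "step_path n v \<in> cadlag"
  unfolding cadlag_def
proof (intro CollectI conjI allI impI)
  show "step_path n v \<in> extensional {0..}"
    by (simp add: step_path_def)
next
  fix t :: real assume t: "0 \<le> t"
  define k where "k = \<lfloor>real n * t\<rfloor>"
  have "real n * t < k + 1"
    unfolding k_def by linarith
  then have "t < (k + 1) / n"
    using n by (simp add: field_simps)
  then have "\<forall>\<^sub>F s in at_right t. s \<in> {t<..<(k + 1) / n}"
    by (intro eventually_at_right_real)
  then have "\<forall>\<^sub>F s in at_right t. step_path n v s = step_path n v t"
  proof eventually_elim
    case (elim s)
    then have "real n * s < k + 1" "real n * t \<le> real n * s"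
      using n by (auto simp: field_simps)
    then have "\<lfloor>real n * s\<rfloor> = k"
      unfolding k_def by linarith
    then show ?case
      using elim t by (auto simp: step_path_def k_def)
  qed
  then show "continuous (at_right t) (step_path n v)"
    unfolding continuous_within by (rule tendsto_eventually)
next
  fix t :: real assume t: "0 < t"
  define k where "k = \<lceil>real n * t\<rceil> - 1"
  have k: "k < real n * t" "real n * t \<le> k + 1" "0 \<le> k"
    using t n unfolding k_def by (simp_all add: ceiling_less_iff) linarith+
  then have "k / n < t"
    using n by (simp add: field_simps)
  then have "\<forall>\<^sub>F s in at_left t. s \<in> {k / n<..<t}"
    by (intro eventually_at_left_real)
  then have "\<forall>\<^sub>F s in at_left t. step_path n v s = v (nat k)"
  proof eventually_elim
    case (elim s)
    have "0 \<le> k / n"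
      using k n by simp
    moreover have "k < real n * s" "real n * s < real n * t"
      using n elim by (auto simp: field_simps)
    moreover have "\<lfloor>real n * s\<rfloor> = k"
      using k calculation by (intro floor_unique) auto
    ultimately show ?case
      using elim by (auto simp: step_path_def)
  qed
  then show "\<exists>l. (step_path n v \<longlongrightarrow> l) (at_left t)"
    by (intro exI tendsto_eventually)
qed

lemma step_path_close:
  assumes n: "0 < n" and \<delta>: "0 < \<delta>" and uv: "\<And>i. real i \<le> n / \<delta> \<Longrightarrow> \<bar>u i - v i\<bar> < \<delta>"
  shows "step_path n u \<in> skorohod_nbhd (step_path n v) \<delta>"
proof -
  have "(\<lambda>s. s) \<in> time_changes"
    by (simp add: time_changes_def strict_mono_on_def)
  moreover have "\<bar>step_path n u s - step_path n v s\<bar> < \<delta>" if s: "s \<in> {0..1/\<delta>}" for s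
  proof -
    have "real n * s \<le> real n * (1 / \<delta>)"
      using s by (intro mult_left_mono) auto
    moreover have "0 \<le> real n * s"
      using s by auto
    ultimately have "real (nat \<lfloor>real n * s\<rfloor>) \<le> n / \<delta>"
      by simp linarith
    from uv[OF this] show ?thesis
      using s by (simp add: step_path_def)
  qed
  ultimately show ?thesis
    unfolding skorohod_nbhd_def using step_path_cadlag[OF n] \<delta>
    by (intro CollectI conjI bexI[of _ "\<lambda>s. s"]) auto
qed

text \<open>One-sided limits give the claim on short intervals to the left and to the right of each point;
  bisection extends it to \<open>[0, K]\<close>, as partitions can be concatenated.\<close>

lemma cadlag_partition:
  assumes \<alpha>: "\<alpha> \<in> cadlag" and K: "0 \<le> K" and \<eta>: "0 < \<eta>"
  obtains N :: nat and t :: "nat \<Rightarrow> real" where "t 0 = 0" "t N = K" "\<And>i. i < N \<Longrightarrow> t i < t (Suc i)"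
    "\<And>i u w. i < N \<Longrightarrow> u \<in> {t i..<t (Suc i)} \<Longrightarrow> w \<in> {t i..<t (Suc i)} \<Longrightarrow> \<bar>\<alpha> u - \<alpha> w\<bar> < \<eta>"
proof -
  define osc where "osc a b \<longleftrightarrow> (\<forall>u\<in>{a..<b}. \<forall>w\<in>{a..<b}. \<bar>\<alpha> u - \<alpha> w\<bar> < \<eta>)" for a b
  define P where "P a b \<longleftrightarrow> (\<exists>(N::nat) t. t 0 = a \<and> t N = b \<and> (\<forall>i<N. t i < t (Suc i) \<and> osc (t i) (t (Suc i))))" for a b
  have P_refl: "P a a" for a
    unfolding P_def by (intro exI[of _ 0] exI[of _ "\<lambda>_. a"]) auto
  have P_osc: "P a b" if "a \<le> b" "osc a b" for a b
  proof (cases "a = b")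
    case False
    then show ?thesis
      unfolding P_def using that by (intro exI[of _ 1] exI[of _ "\<lambda>i. if i = 0 then a else b"]) auto
  qed (simp add: P_refl)
  have P_trans: "P a c" if "P a b" "P b c" for a b c
  proof -
    obtain N t where t: "t 0 = a" "t N = b" "\<forall>i<N. t i < t (Suc i) \<and> osc (t i) (t (Suc i))"
      using \<open>P a b\<close> unfolding P_def by auto
    obtain N' t' where t': "t' 0 = b" "t' N' = c" "\<forall>i<N'. t' i < t' (Suc i) \<and> osc (t' i) (t' (Suc i))"
      using \<open>P b c\<close> unfolding P_def by auto
    define u where "u i = (if i < N then t i else t' (i - N))" for i
    have "u i < u (Suc i) \<and> osc (u i) (u (Suc i))" if "i < N + N'" for i
    proof -
      consider "Suc i < N" | "Suc i = N" | "N \<le> i" by linarith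
      then show ?thesis
      proof cases
        case 3
        then have "i - N < N'" "Suc i - N = Suc (i - N)"
          using that by auto
        then show ?thesis
          using t'(3) 3 by (auto simp: u_def)
      qed (use t t' in \<open>auto simp: u_def\<close>)
    qed
    moreover have "u 0 = a" "u (N + N') = c"
      using t t' by (auto simp: u_def)
    ultimately show ?thesis
      unfolding P_def by blast
  qed
  have "P' 0 K" if "P' = (\<lambda>a b. 0 \<le> a \<longrightarrow> a \<le> b \<longrightarrow> P a b)" for P'
    using K
  proof (induction rule: Bolzano)
    case (trans a b c)
    then show ?case
      using P_trans that by auto
  next
    case (local x)
    have rc: "(\<alpha> \<longlongrightarrow> \<alpha> x) (at_right x)"
      using \<alpha> local by (auto simp: cadlag_def continuous_within)
    then have "\<forall>\<^sub>F s in at_right x. \<bar>\<alpha> s - \<alpha> x\<bar> < \<eta> / 2"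
      using tendstoD[OF rc, of "\<eta> / 2"] \<eta> by (simp add: dist_real_def)
    then obtain r where r: "x < r" "\<And>s. x < s \<Longrightarrow> s < r \<Longrightarrow> \<bar>\<alpha> s - \<alpha> x\<bar> < \<eta> / 2"
      unfolding eventually_at_right_field by blast
    have right: "osc x b" if "b < r" for b
    proof -
      have *: "\<bar>\<alpha> s - \<alpha> x\<bar> < \<eta> / 2" if "s \<in> {x..<b}" for s
        using r(2)[of s] that \<open>b < r\<close> \<eta> by (cases "s = x") auto
      have "\<bar>\<alpha> u - \<alpha> w\<bar> < \<eta>" if "u \<in> {x..<b}" "w \<in> {x..<b}" for u w
        using *[OF that(1)] *[OF that(2)] by linarith
      then show ?thesis
        unfolding osc_def by auto
    qed
    have "\<exists>l<x. \<forall>a. l < a \<and> 0 \<le> a \<longrightarrow> osc a x"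
    proof (cases "x = 0")
      case True
      then show ?thesis
        by (intro exI[of _ "-1"]) (auto simp: osc_def)
    next
      case False
      then have "0 < x"
        using local by simp
      then obtain L where L: "(\<alpha> \<longlongrightarrow> L) (at_left x)"
        using \<alpha> unfolding cadlag_def by blast
      have "\<forall>\<^sub>F s in at_left x. \<bar>\<alpha> s - L\<bar> < \<eta> / 2"
        using tendstoD[OF L, of "\<eta> / 2"] \<eta> by (simp add: dist_real_def)
      then obtain l where l: "l < x" "\<And>s. l < s \<Longrightarrow> s < x \<Longrightarrow> \<bar>\<alpha> s - L\<bar> < \<eta> / 2"
        unfolding eventually_at_left_field by blast
      have "osc a x" if "l < a" for a
      proof -
        have *: "\<bar>\<alpha> s - L\<bar> < \<eta> / 2" if "s \<in> {a..<x}" for s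
          using l(2)[of s] that \<open>l < a\<close> by auto
        have "\<bar>\<alpha> u - \<alpha> w\<bar> < \<eta>" if "u \<in> {a..<x}" "w \<in> {a..<x}" for u w
          using *[OF that(1)] *[OF that(2)] by linarith
        then show ?thesis
          unfolding osc_def by auto
      qed
      then show ?thesis
        using l(1) by auto
    qed
    then obtain l where l: "l < x" "\<And>a. l < a \<Longrightarrow> 0 \<le> a \<Longrightarrow> osc a x"
      by blast
    have "P' a b" if ab: "a \<le> x \<and> x \<le> b \<and> b - a < min (r - x) (x - l)" for a b
    proof -
      have "P a b" if "0 \<le> a"
        using ab that local by (intro P_trans[of a x b] P_osc right l) auto
      then show ?thesis
        using \<open>P' = _\<close> by simp
    qed
    then show ?case
      using r(1) l(1) by (intro exI[of _ "min (r - x) (x - l)"]) auto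
  qed
  then have "P 0 K"
    using K by simp
  then obtain N t where t: "t 0 = 0" "t N = K" "\<forall>i<N. t i < t (Suc i) \<and> osc (t i) (t (Suc i))"
    unfolding P_def by auto
  show ?thesis
    by (rule that[of t N]) (use t in \<open>auto simp: osc_def\<close>)
qed

text \<open>The time change moves each point of a partition with small oscillation up to the next grid
  point.  Then the sample points used by the step function on a cell come from the corresponding
  half-open cell of the partition.\<close>

lemma step_path_sample_tendsto:
  assumes \<alpha>: "\<alpha> \<in> cadlag" and \<delta>: "0 < \<delta>"
  shows "\<forall>\<^sub>F n in sequentially. step_path n (\<lambda>i. \<alpha> (i / n)) \<in> skorohod_nbhd \<alpha> \<delta>"
proof -
  define K where "K = 1 / \<delta> + 1"
  have K: "0 \<le> K"
    using \<delta> by (simp add: K_def)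
  obtain N t where t0: "t 0 = 0" "t N = K" "\<And>i. i < N \<Longrightarrow> t i < t (Suc i)"
    and osc: "\<And>i u w. i < N \<Longrightarrow> u \<in> {t i..<t (Suc i)} \<Longrightarrow> w \<in> {t i..<t (Suc i)} \<Longrightarrow> \<bar>\<alpha> u - \<alpha> w\<bar> < \<delta>"
    using cadlag_partition[OF \<alpha> K \<delta>] by blast
  \<comment> \<open>the partition of \<open>[0, K]\<close> continued by unit steps to one of \<open>[0, \<infinity>)\<close>\<close>
  define a where "a i = (if i \<le> N then t i else K + (real i - real N))" for i
  define \<mu> where "\<mu> = Min (insert 1 ((\<lambda>i. t (Suc i) - t i) ` {..<N}))"
  have \<mu>: "0 < \<mu>" "\<mu> \<le> 1" "\<And>i. i < N \<Longrightarrow> \<mu> \<le> t (Suc i) - t i"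
    using t0(3) by (auto simp: \<mu>_def)
  have gap: "\<mu> \<le> a (Suc i) - a i" for i
  proof -
    consider "Suc i \<le> N" | "i = N" | "N < i" by linarith
    then show ?thesis
      by cases (use \<mu> t0 in \<open>auto simp: a_def\<close>)
  qed
  have a: "strict_mono a"
    unfolding strict_mono_Suc_iff using gap \<mu>(1) by (smt (verit))
  have a0: "a 0 = 0"
    using t0 by (simp add: a_def)
  have a_inf: "\<exists>i. s < a i" for s
  proof -
    obtain k :: nat where "s < k"
      using reals_Archimedean2 by blast
    then show ?thesis
      using K by (intro exI[of _ "N + Suc k"]) (auto simp: a_def)
  qed
  have a_nn: "0 \<le> a i" for i
    using a a0 by (metis le0 strict_mono_less_eq)
  obtain n0 :: nat where n0: "1 / \<mu> + 1 / \<delta> < n0"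
    using reals_Archimedean2 by blast
  show ?thesis
    unfolding eventually_sequentially
  proof (intro exI allI impI)
    fix n assume "n0 \<le> n"
    then have n: "1 / \<mu> + 1 / \<delta> < real n"
      using n0 by linarith
    moreover have "0 < 1 / \<mu>" "0 < 1 / \<delta>"
      using \<mu> \<delta> by auto
    ultimately have n: "1 / \<mu> < real n" "1 / \<delta> < real n" "0 < real n"
      by linarith+
    then have n: "1 / \<mu> < real n" "1 / \<delta> < real n" "0 < n"
      by simp_all
    then have n1: "1 < n * \<mu>" "1 / n < \<delta>"
      using \<mu> \<delta> by (auto simp: field_simps)
    define b where "b i = \<lceil>n * a i\<rceil> / n" for i
    have ceil: "\<lceil>n * a i\<rceil> < \<lceil>n * a (Suc i)\<rceil>" for i
    proof -
      have "n * \<mu> \<le> n * (a (Suc i) - a i)"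
        using gap[of i] by (intro mult_left_mono) auto
      then have "n * a i + 1 < n * a (Suc i)"
        using n1 by (simp add: algebra_simps)
      then show ?thesis by linarith
    qed
    have b: "strict_mono b"
      unfolding strict_mono_Suc_iff b_def using ceil n(3) by (auto simp: divide_strict_right_mono)
    have b0: "b 0 = 0"
      by (simp add: b_def a0)
    have ab: "a i \<le> b i" "b i - a i \<le> 1 / n" for i
    proof -
      have "n * a i \<le> n * b i" "n * b i \<le> n * a i + 1"
        using n(3) by (auto simp: b_def)
      then show "a i \<le> b i" "b i - a i \<le> 1 / n"
        using n(3) by (auto simp: field_simps)
    qed
    have b_inf: "\<exists>i. s < b i" for s
      using a_inf[of s] ab(1) by (meson less_le_trans)
    have "\<bar>b i - a i\<bar> \<le> 1 / n" for i
      using ab[of i] by simp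
    then obtain \<theta> where \<theta>: "\<theta> \<in> time_changes" "\<And>s. 0 \<le> s \<Longrightarrow> \<bar>\<theta> s - s\<bar> \<le> 1 / n"
      "\<And>i s. a i \<le> s \<Longrightarrow> s < a (Suc i) \<Longrightarrow> b i \<le> \<theta> s \<and> \<theta> s < b (Suc i)"
      using piecewise_linear_time_change[OF a a0 a_inf b b0 b_inf] by metis
    have "\<bar>step_path n (\<lambda>i. \<alpha> (i / n)) (\<theta> s) - \<alpha> s\<bar> < \<delta>" if s: "s \<in> {0..1/\<delta>}" for s
    proof -
      obtain i where i: "a i \<le> s" "s < a (Suc i)"
        using partition_index[OF a0 a_inf] s by auto
      have "a i < a N"
        using i s t0 by (auto simp: a_def K_def)
      then have iN: "i < N"
        using a by (simp add: strict_mono_less)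
      define k where "k = \<lfloor>n * \<theta> s\<rfloor>"
      have "n * b i \<le> n * \<theta> s" "n * \<theta> s < n * b (Suc i)"
        using \<theta>(3)[OF i] n(3) by auto
      then have "\<lceil>n * a i\<rceil> \<le> n * \<theta> s" "n * \<theta> s < \<lceil>n * a (Suc i)\<rceil>"
        using n(3) by (auto simp: b_def)
      then have "\<lceil>n * a i\<rceil> \<le> k" "k < \<lceil>n * a (Suc i)\<rceil>"
        unfolding k_def by linarith+
      then have "n * a i \<le> k" "k < n * a (Suc i)"
        by linarith+
      then have k: "a i \<le> k / n" "k / n < a (Suc i)"
        using n(3) by (auto simp: field_simps)
      have "0 \<le> real_of_int k"
        using \<open>n * a i \<le> k\<close> a_nn[of i] by (meson mult_nonneg_nonneg of_nat_0_le_iff order_trans)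
      then have "real (nat k) = k"
        by simp
      moreover have "0 \<le> \<theta> s"
        using time_change_nonneg[OF \<theta>(1)] s by auto
      ultimately have "step_path n (\<lambda>i. \<alpha> (i / n)) (\<theta> s) = \<alpha> (k / n)"
        by (simp add: step_path_def k_def)
      moreover have "\<bar>\<alpha> (k / n) - \<alpha> s\<bar> < \<delta>"
        using k i iN by (intro osc[of i]) (auto simp: a_def)
      ultimately show ?thesis by simp
    qed
    moreover have "\<bar>\<theta> s - s\<bar> < \<delta>" if "0 \<le> s" for s
      using \<theta>(2)[OF that] n1 by linarith
    ultimately show "step_path n (\<lambda>i. \<alpha> (i / n)) \<in> skorohod_nbhd \<alpha> \<delta>"
      using \<theta>(1) step_path_cadlag[OF n(3)] by (intro skorohod_nbhdI)
  qed
qed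

text \<open>The deterministic core of the tightness estimate, for a fine grid grouped into blocks of \<open>l\<close>
  points.  The hypothesis says that after the first move larger than \<open>4 \<rho>\<close> within a block the path
  stays within \<open>2 \<rho>\<close> of its new position for two more block lengths.  The coarse step function
  sees this move only at the end of the block; the time change moves that end point back to the
  time \<open>\<tau>\<close> of the move.\<close>

lemma step_path_coarsen:
  fixes v :: "nat \<Rightarrow> real"
  assumes n: "0 < n" and l: "0 < l" and \<rho>: "4 * \<rho> < \<delta>" "0 < \<rho>" and n\<delta>: "1 / n < \<delta>" and B: "n / \<delta> < B"
    and calm: "\<And>k j s. k < B \<Longrightarrow> k * l < j \<Longrightarrow> j \<le> (k + 1) * l \<Longrightarrow> 4 * \<rho> < \<bar>v j - v (k * l)\<bar> \<Longrightarrow>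
      (\<And>i. k * l < i \<Longrightarrow> i < j \<Longrightarrow> \<bar>v i - v (k * l)\<bar> \<le> 4 * \<rho>) \<Longrightarrow> j \<le> s \<Longrightarrow> s \<le> j + 2 * l \<Longrightarrow>
      \<bar>v s - v j\<bar> \<le> 2 * \<rho>"
  shows "step_path (n * l) v \<in> skorohod_nbhd (step_path n (\<lambda>i. v (i * l))) \<delta>"
proof -
  define big where "big k j \<longleftrightarrow> k * l < j \<and> j \<le> (k + 1) * l \<and> 4 * \<rho> < \<bar>v j - v (k * l)\<bar>" for k j
  define \<tau> where "\<tau> k = (if \<exists>j. big k j then LEAST j. big k j else (k + 1) * l)" for k
  have \<tau>_big: "big k (\<tau> k)" if "\<exists>j. big k j" for k
    using LeastI_ex[OF that] that by (simp add: \<tau>_def)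
  have \<tau>_min: "\<not> big k j" if "j < \<tau> k" for k j
    using that not_less_Least[of j "big k"] by (auto simp: \<tau>_def split: if_splits)
  have \<tau>: "k * l < \<tau> k" "\<tau> k \<le> (k + 1) * l" for k
    using \<tau>_big[of k] l by (cases "\<exists>j. big k j"; simp add: big_def \<tau>_def)+
  define a where "a i = real i / n" for i
  define b where "b i = (if i = 0 then 0 else real (\<tau> (i - 1)) / (n * l))" for i
  have nl: "0 < real (n * l)"
    using n l by simp
  have a: "strict_mono a" "a 0 = 0" "\<exists>i. s < a i" for s
  proof -
    show "strict_mono a" "a 0 = 0"
      using n by (auto simp: a_def strict_mono_def divide_strict_right_mono)
    obtain i :: nat where "s * n < i"
      using reals_Archimedean2 by blast
    then show "\<exists>i. s < a i"
      using n by (auto simp: a_def field_simps)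
  qed
  have bl: "b i \<le> a i" "a i - b i \<le> 1 / n" for i
  proof -
    have "b i \<le> a i \<and> a i - b i \<le> 1 / n"
    proof (cases i)
      case (Suc k)
      have "real (k * l) \<le> \<tau> k" "real (\<tau> k) \<le> ((k + 1) * l)"
        using \<tau>[of k] unfolding of_nat_le_iff by auto
      then have "real (k * l) / real (n * l) \<le> \<tau> k / real (n * l)"
        "real (\<tau> k) / real (n * l) \<le> real ((k + 1) * l) / real (n * l)"
        by (auto intro!: divide_right_mono simp del: of_nat_mult)
      moreover have "real (k * l) / real (n * l) = k / n" "real ((k + 1) * l) / real (n * l) = k / n + 1 / n"
      proof -
        have "real ((k + 1) * l) / real (n * l) = real (k + 1) / n"
          using l by (simp only: of_nat_mult) simp
        then show "real (k * l) / real (n * l) = k / n" "real ((k + 1) * l) / real (n * l) = k / n + 1 / n"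
          using l by (auto simp: add_divide_distrib)
      qed
      moreover have "a i = k / n + 1 / n" "b i = \<tau> k / real (n * l)"
        using Suc by (auto simp: a_def b_def add_divide_distrib)
      ultimately show ?thesis
        by linarith
    qed (auto simp: a_def b_def)
    then show "b i \<le> a i" "a i - b i \<le> 1 / n" by auto
  qed
  have \<tau>_Suc: "\<tau> k < \<tau> (Suc k)" for k
    using \<tau>[of k] \<tau>[of "Suc k"] by simp
  have b: "strict_mono b" "b 0 = 0" "\<exists>i. s < b i" for s
  proof -
    show "strict_mono b"
      unfolding strict_mono_Suc_iff
    proof
      fix i show "b i < b (Suc i)"
        using \<tau>(1)[of 0] \<tau>_Suc[of "i - 1"] nl unfolding b_def
        by (cases i) (auto intro!: divide_strict_right_mono divide_pos_pos)
    qed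
    show "b 0 = 0"
      by (simp add: b_def)
    obtain i where "s + 1 / n < a i"
      using a(3) by blast
    then show "\<exists>i. s < b i"
      using bl[of i] by (intro exI[of _ i]) linarith
  qed
  have "\<bar>b i - a i\<bar> \<le> 1 / n" for i
    using bl[of i] by simp
  then obtain \<theta> where \<theta>: "\<theta> \<in> time_changes" "\<And>s. 0 \<le> s \<Longrightarrow> \<bar>\<theta> s - s\<bar> \<le> 1 / n"
    "\<And>i s. a i \<le> s \<Longrightarrow> s < a (Suc i) \<Longrightarrow> b i \<le> \<theta> s \<and> \<theta> s < b (Suc i)"
    using piecewise_linear_time_change[OF a b] by metis
  have "\<bar>step_path (n * l) v (\<theta> s) - step_path n (\<lambda>i. v (i * l)) s\<bar> < \<delta>" if s: "s \<in> {0..1/\<delta>}" for s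
  proof -
    obtain i where i: "a i \<le> s" "s < a (Suc i)"
      using partition_index[OF a(2,3)] s by auto
    have "real i \<le> n * s" "n * s < i + 1"
      using i n by (auto simp: a_def field_simps)
    then have fl: "nat \<lfloor>n * s\<rfloor> = i"
      by linarith
    have "n * s \<le> n * (1 / \<delta>)"
      using s by (intro mult_left_mono) auto
    then have iB: "i < B"
      using B \<open>real i \<le> n * s\<close> by simp
    define j where "j = nat \<lfloor>real (n * l) * \<theta> s\<rfloor>"
    have th0: "0 \<le> \<theta> s"
      using time_change_nonneg[OF \<theta>(1)] s by auto
    have "real (n * l) * b i \<le> real (n * l) * \<theta> s" "real (n * l) * \<theta> s < real (n * l) * b (Suc i)"
      using \<theta>(3)[OF i] nl by (auto intro!: mult_left_mono mult_strict_left_mono)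
    moreover have "real (n * l) * b (Suc i) = real (\<tau> i)" "i \<noteq> 0 \<Longrightarrow> real (n * l) * b i = real (\<tau> (i - 1))"
      using nl by (auto simp: b_def)
    ultimately have jr: "j < \<tau> i" "i \<noteq> 0 \<Longrightarrow> \<tau> (i - 1) \<le> j"
      unfolding j_def using th0 by (simp_all add: nat_less_iff le_nat_iff le_floor_iff floor_less_iff)
    have "\<bar>v j - v (i * l)\<bar> \<le> 4 * \<rho>"
    \<comment> \<open>After a large move in the previous block, both values are within \<open>2 \<rho>\<close> of the value at \<open>\<tau>\<close>;
      otherwise \<open>j\<close> lies in block \<open>i\<close> before its first large move.\<close>
    proof (cases "i \<noteq> 0 \<and> (\<exists>j. big (i - 1) j)")
      case True
      define k where "k = i - 1"
      have ik: "i = k + 1"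
        using True by (simp add: k_def)
      have "big k (\<tau> k)"
        using \<tau>_big True by (simp add: k_def)
      moreover have "\<bar>v i' - v (k * l)\<bar> \<le> 4 * \<rho>" if "k * l < i'" "i' < \<tau> k" for i'
        using \<tau>_min[of i' k] that \<tau>(2)[of k] by (auto simp: big_def)
      ultimately have close: "\<bar>v s - v (\<tau> k)\<bar> \<le> 2 * \<rho>" if "\<tau> k \<le> s" "s \<le> \<tau> k + 2 * l" for s
        using calm[of k "\<tau> k" s] iB that by (auto simp: big_def ik)
      have "\<bar>v j - v (\<tau> k)\<bar> \<le> 2 * \<rho>"
        using jr \<tau>[of k] \<tau>[of i] by (intro close) (auto simp: ik)
      moreover have "\<bar>v (i * l) - v (\<tau> k)\<bar> \<le> 2 * \<rho>"
        using \<tau>[of k] by (intro close) (auto simp: ik)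
      ultimately show ?thesis by linarith
    next
      case False
      then have "i * l \<le> j"
        using jr(2) by (cases i) (auto simp: \<tau>_def)
      moreover have "\<not> big i j"
        using \<tau>_min jr(1) by blast
      ultimately show ?thesis
        using jr(1) \<tau>(2)[of i] \<rho>(2) by (cases "j = i * l") (auto simp: big_def)
    qed
    then show ?thesis
      using \<rho> s th0 fl by (simp add: step_path_def j_def)
  qed
  moreover have "\<bar>\<theta> s - s\<bar> < \<delta>" if "0 \<le> s" for s
    using \<theta>(2)[OF that] n\<delta> by linarith
  ultimately show ?thesis
    using \<theta>(1) step_path_cadlag[of "n * l"] n l by (intro skorohod_nbhdI) auto
qed

section \<open>Borel measurability on the Skorohod space\<close>

lemma open_cylinder_nbhd:
  fixes A :: "(nat \<Rightarrow> real) set" and r \<delta> :: real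
  shows "open {v. \<exists>u\<in>A. \<forall>i. real i \<le> r \<longrightarrow> \<bar>u i - v i\<bar> < \<delta>}"
proof -
  have fin: "finite {i. real i \<le> r}"
  proof (rule finite_subset)
    show "{i. real i \<le> r} \<subseteq> {..nat \<lfloor>r\<rfloor>}"
      by (auto simp: le_nat_floor)
  qed simp
  have "open {v :: nat \<Rightarrow> real. \<bar>u i - v i\<bar> < \<delta>}" for u i
    by (intro open_Collect_less continuous_intros continuous_on_product_coordinates)
  then have "open (\<Union>u\<in>A. \<Inter>i\<in>{i. real i \<le> r}. {v. \<bar>u i - v i\<bar> < \<delta>})"
    using fin by (intro open_UN open_INT) auto
  also have "(\<Union>u\<in>A. \<Inter>i\<in>{i. real i \<le> r}. {v. \<bar>u i - v i\<bar> < \<delta>})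
      = {v. \<exists>u\<in>A. \<forall>i. real i \<le> r \<longrightarrow> \<bar>u i - v i\<bar> < \<delta>}"
    by auto
  finally show ?thesis .
qed

lemma step_path_close_nbhd_subset:
  assumes "0 < n" "0 < \<delta>" "\<delta> \<le> 1 / 2" "\<And>i. real i \<le> n / \<delta> \<Longrightarrow> \<bar>u i - v i\<bar> < \<delta>"
  shows "skorohod_nbhd (step_path n u) \<delta> \<subseteq> skorohod_nbhd (step_path n v) (2 * \<delta>)"
  using skorohod_nbhd_trans[OF step_path_close[of n \<delta> u v]] assms by blast

text \<open>Samples that are close to a step function around which a ball is contained in \<open>U\<close>.  Requiring
  the ball around a nearby step function, not around the sample itself, makes the set open.\<close>

definition inner_samples :: "(real \<Rightarrow> real) set \<Rightarrow> nat \<Rightarrow> nat \<Rightarrow> (nat \<Rightarrow> real) set" where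
  "inner_samples U n j = {v. \<exists>u\<in>{u. skorohod_nbhd (step_path n u) (2 * (1 / (real j + 4))) \<subseteq> U}.
      \<forall>i. real i \<le> n / (1 / (real j + 4)) \<longrightarrow> \<bar>u i - v i\<bar> < 1 / (real j + 4)}"

text \<open>The Borel sets of the Skorohod space are generated by the coordinates.  If \<open>\<alpha> \<in> U\<close>, a ball around
  \<open>\<alpha>\<close> lies in \<open>U\<close>, and a ball of half the radius around its samples does so eventually;
  conversely, \<open>\<alpha>\<close> is itself in a small ball around its fine samples.\<close>

lemma open_iff_samples:
  assumes U: "openin skorohod U" and \<alpha>: "\<alpha> \<in> cadlag"
  shows "\<alpha> \<in> U \<longleftrightarrow> (\<exists>j::nat. \<forall>\<^sub>F n in sequentially. (\<lambda>i. \<alpha> (real i / n)) \<in> inner_samples U n j)"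
    (is "_ \<longleftrightarrow> (\<exists>j. \<forall>\<^sub>F n in sequentially. ?v n \<in> ?O n j)")
proof
  assume "\<alpha> \<in> U"
  then obtain e where e: "0 < e" "skorohod_nbhd \<alpha> e \<subseteq> U"
    using U by (auto simp: openin_skorohod)
  obtain j :: nat where j: "4 / e < j"
    using reals_Archimedean2 by blast
  define r where "r = 1 / (real j + 4)"
  have r: "0 < r" "4 * r \<le> e" "2 * r \<le> 1 / 2"
    using j e(1) by (auto simp: r_def field_simps)
  have "\<forall>\<^sub>F n in sequentially. step_path n (?v n) \<in> skorohod_nbhd \<alpha> (2 * r)"
    using r by (intro step_path_sample_tendsto[OF \<alpha>]) auto
  then have "\<forall>\<^sub>F n in sequentially. ?v n \<in> ?O n j"
  proof eventually_elim
    case (elim n)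
    have "skorohod_nbhd (step_path n (?v n)) (2 * r) \<subseteq> skorohod_nbhd \<alpha> (2 * (2 * r))"
      using skorohod_nbhd_trans[OF elim _ _ r(3)] r by auto
    also have "\<dots> \<subseteq> U"
      using skorohod_nbhd_mono[of "4 * r" e \<alpha>] r e by auto
    finally have "skorohod_nbhd (step_path n (?v n)) (2 * r) \<subseteq> U" .
    then show ?case
      unfolding inner_samples_def mem_Collect_eq r_def[symmetric] using r(1) by (intro bexI[of _ "?v n"]) simp_all
  qed
  then show "\<exists>j. \<forall>\<^sub>F n in sequentially. ?v n \<in> ?O n j"
    by (rule exI[of _ j])
next
  assume "\<exists>j. \<forall>\<^sub>F n in sequentially. ?v n \<in> ?O n j"
  then obtain j where j: "\<forall>\<^sub>F n in sequentially. ?v n \<in> ?O n j" ..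
  define r where "r = 1 / (real j + 4)"
  have r: "0 < r" "r \<le> 1 / 2"
    by (auto simp: r_def field_simps)
  have "\<forall>\<^sub>F n in sequentially. step_path n (?v n) \<in> skorohod_nbhd \<alpha> (r / 2)"
    using r by (intro step_path_sample_tendsto[OF \<alpha>]) auto
  from eventually_conj[OF eventually_conj[OF this j] eventually_gt_at_top[of 0]]
  obtain n where n: "0 < n" "step_path n (?v n) \<in> skorohod_nbhd \<alpha> (r / 2)" "?v n \<in> ?O n j"
    by (auto dest!: eventually_happens)
  from n(3) have "\<exists>u. skorohod_nbhd (step_path n u) (2 * r) \<subseteq> U \<and> (\<forall>i. real i \<le> n / r \<longrightarrow> \<bar>u i - ?v n i\<bar> < r)"
    unfolding inner_samples_def r_def[symmetric] mem_Collect_eq bex_simps by blast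
  then obtain u where u: "skorohod_nbhd (step_path n u) (2 * r) \<subseteq> U \<and> (\<forall>i. real i \<le> n / r \<longrightarrow> \<bar>u i - ?v n i\<bar> < r)"
    by (rule exE)
  have "\<alpha> \<in> skorohod_nbhd (step_path n (?v n)) r"
    by (rule skorohod_nbhd_sym[OF n(2) \<alpha>]) (use r in auto)
  moreover have "\<bar>?v n i - u i\<bar> < r" if "real i \<le> n / r" for i
    using conjunct2[OF u] that by (simp add: abs_minus_commute)
  ultimately have "\<alpha> \<in> skorohod_nbhd (step_path n u) (2 * r)"
    using step_path_close_nbhd_subset[OF n(1) r, of "?v n" u] by blast
  then show "\<alpha> \<in> U"
    using conjunct1[OF u] by blast
qed

lemma trajectory_measurable:
  assumes X: "\<And>t. 0 \<le> t \<Longrightarrow> X t \<in> borel_measurable M"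
    and cadlag: "\<And>\<omega>. \<omega> \<in> space M \<Longrightarrow> trajectory X \<omega> \<in> cadlag"
  shows "trajectory X \<in> M \<rightarrow>\<^sub>M borel_sets_of skorohod"
  unfolding borel_sets_of_def
proof (rule measurable_measure_of)
  show "{U. openin skorohod U} \<subseteq> Pow (topspace skorohod)"
    using openin_subset by auto
  show "trajectory X \<in> space M \<rightarrow> topspace skorohod"
    using cadlag by (auto simp: topspace_skorohod)
  fix U assume "U \<in> {U. openin skorohod U}"
  then have U: "openin skorohod U" by simp
  have [measurable]: "inner_samples U n j \<in> sets borel" for n j
    unfolding inner_samples_def by (intro borel_open open_cylinder_nbhd)
  have v[measurable]: "(\<lambda>\<omega> i. X (real i / real n) \<omega>) \<in> M \<rightarrow>\<^sub>M borel" for n :: nat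
    by (intro measurable_coordinatewise_then_product X) auto
  have "trajectory X \<omega> \<in> U \<longleftrightarrow>
     (\<exists>j n0. \<forall>n\<ge>n0. (\<lambda>i. X (real i / real n) \<omega>) \<in> inner_samples U n j)" if "\<omega> \<in> space M" for \<omega>
    using open_iff_samples[OF U cadlag[OF that]]
    unfolding eventually_sequentially by (simp add: trajectory_def)
  then have "trajectory X -` U \<inter> space M =
     {\<omega> \<in> space M. \<exists>j n0. \<forall>n\<ge>n0. (\<lambda>i. X (real i / real n) \<omega>) \<in> inner_samples U n j}"
    by auto
  also have "\<dots> \<in> sets M"
    by measurable
  finally show "trajectory X -` U \<inter> space M \<in> sets M" .
qed

lemma step_path_measurable:
  assumes n: "0 < n" and V: "\<And>i. V i \<in> borel_measurable M"
  shows "(\<lambda>\<omega>. step_path n (\<lambda>i. V i \<omega>)) \<in> M \<rightarrow>\<^sub>M borel_sets_of skorohod"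
proof -
  have eq: "trajectory (\<lambda>t. V (nat \<lfloor>real n * t\<rfloor>)) = (\<lambda>\<omega>. step_path n (\<lambda>i. V i \<omega>))"
    by (auto simp: trajectory_def step_path_def)
  show ?thesis
    unfolding eq[symmetric] by (rule trajectory_measurable) (use V n in \<open>auto simp: eq step_path_cadlag\<close>)
qed

lemma continuous_map_borel_measurable:
  fixes f :: "'c \<Rightarrow> real"
  assumes "continuous_map T euclideanreal f"
  shows "f \<in> borel_measurable (borel_sets_of T)"
proof -
  have sub: "{U. openin T U} \<subseteq> Pow (topspace T)"
    using openin_subset by auto
  show ?thesis
  proof (rule borel_measurableI)
    fix S :: "real set" assume "open S"
    then have "openin T {x \<in> topspace T. f x \<in> S}"
      using assms by (auto simp: continuous_map_def)
    moreover have "f -` S \<inter> space (borel_sets_of T) = {x \<in> topspace T. f x \<in> S}"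
      using sub by (auto simp: borel_sets_of_def space_measure_of)
    ultimately show "f -` S \<inter> space (borel_sets_of T) \<in> sets (borel_sets_of T)"
      using sub by (auto simp: borel_sets_of_def)
  qed
qed

section \<open>Lower approximation by functions of finitely many coordinates\<close>

text \<open>A lower approximation of \<open>F\<close> that is a Borel function of finitely many sampled values.  The
  infimum is taken over a neighbourhood of the sample as well as over a Skorohod neighbourhood of
  the step function: this makes the sublevel sets open.\<close>

definition sample_inf :: "((real \<Rightarrow> real) \<Rightarrow> ennreal) \<Rightarrow> nat \<Rightarrow> real \<Rightarrow> (nat \<Rightarrow> real) \<Rightarrow> ennreal" where
  "sample_inf F n \<delta> v =
    (INF \<beta>\<in>{\<beta>. \<exists>u. (\<forall>i. real i \<le> n / \<delta> \<longrightarrow> \<bar>u i - v i\<bar> < \<delta>) \<and> \<beta> \<in> skorohod_nbhd (step_path n u) \<delta>}. F \<beta>)"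

lemma sample_inf_measurable [measurable]: "sample_inf F n \<delta> \<in> borel_measurable borel"
proof (rule borel_measurableI_less)
  fix c
  have "{v \<in> space borel. sample_inf F n \<delta> v < c} =
    {v. \<exists>u\<in>{u. \<exists>\<beta>\<in>skorohod_nbhd (step_path n u) \<delta>. F \<beta> < c}. \<forall>i. real i \<le> n / \<delta> \<longrightarrow> \<bar>u i - v i\<bar> < \<delta>}"
    unfolding sample_inf_def INF_less_iff by auto
  then show "{v \<in> space borel. sample_inf F n \<delta> v < c} \<in> sets borel"
    by (simp only: borel_open open_cylinder_nbhd)
qed

lemma sample_inf_cong:
  assumes "\<And>i. real i \<le> n / \<delta> \<Longrightarrow> v i = w i"
  shows "sample_inf F n \<delta> v = sample_inf F n \<delta> w"
proof -
  have "(\<forall>i. real i \<le> n / \<delta> \<longrightarrow> \<bar>u i - v i\<bar> < \<delta>) \<longleftrightarrow> (\<forall>i. real i \<le> n / \<delta> \<longrightarrow> \<bar>u i - w i\<bar> < \<delta>)" for u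
    using assms by auto
  then show ?thesis
    by (simp only: sample_inf_def)
qed

lemma sample_inf_le:
  assumes "0 < \<delta>" "\<beta> \<in> skorohod_nbhd (step_path n v) \<delta>"
  shows "sample_inf F n \<delta> v \<le> F \<beta>"
  unfolding sample_inf_def by (rule INF_lower) (use assms in \<open>auto intro!: exI[of _ v]\<close>)

lemma sample_inf_ge:
  assumes "0 < n" "0 < \<delta>" "\<delta> \<le> 1 / 2" "\<And>\<beta>. \<beta> \<in> skorohod_nbhd (step_path n v) (2 * \<delta>) \<Longrightarrow> c \<le> F \<beta>"
  shows "c \<le> sample_inf F n \<delta> v"
  unfolding sample_inf_def
  by (rule INF_greatest) (use assms step_path_close_nbhd_subset[of n \<delta> _ v] in blast)

text \<open>For \<open>y < f \<alpha>\<close>, the set where \<open>f > y\<close> contains a ball around \<open>\<alpha>\<close>; for a small radius and a fine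
  grid it contains all paths over which the infimum is taken.\<close>

lemma le_liminf_sample_inf:
  fixes f :: "(real \<Rightarrow> real) \<Rightarrow> real"
  assumes f: "continuous_map skorohod euclideanreal f" and \<alpha>: "\<alpha> \<in> cadlag"
  shows "ennreal (f \<alpha>) \<le> liminf (\<lambda>k. liminf (\<lambda>n.
    sample_inf (\<lambda>\<beta>. ennreal (f \<beta>)) n (1 / (real k + 4)) (\<lambda>i. \<alpha> (i / n))))"
proof (rule le_Liminf_iff[THEN iffD2], intro allI impI)
  fix c assume "c < ennreal (f \<alpha>)"
  then obtain c' where c': "c < c'" "c' < ennreal (f \<alpha>)"
    using dense by blast
  define U where "U = {\<beta> \<in> topspace skorohod. f \<beta> \<in> {enn2real c'<..}}"
  have fin: "c' = ennreal (enn2real c')"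
    using c'(2) by (metis ennreal_enn2real infinity_ennreal_def less_top_ennreal order_less_trans ennreal_less_top)
  have "enn2real c' < f \<alpha>"
    using c'(2) fin by (metis enn2real_nonneg ennreal_less_iff)
  then have "\<alpha> \<in> U"
    using \<alpha> by (simp add: U_def topspace_skorohod)
  moreover have "openin skorohod U"
    unfolding U_def using f by (auto simp: continuous_map_def simp del: greaterThan_iff)
  ultimately obtain e where e: "0 < e" "skorohod_nbhd \<alpha> e \<subseteq> U"
    by (auto simp: openin_skorohod)
  have U: "c' \<le> ennreal (f \<beta>)" if "\<beta> \<in> U" for \<beta>
  proof -
    have "ennreal (enn2real c') \<le> ennreal (f \<beta>)"
      using that by (intro ennreal_leI) (auto simp: U_def)
    then show ?thesis
      by (subst fin)
  qed
  obtain k0 :: nat where k0: "4 / e < k0"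
    using reals_Archimedean2 by blast
  have "c < liminf (\<lambda>n. sample_inf (\<lambda>\<beta>. ennreal (f \<beta>)) n (1 / (real k + 4)) (\<lambda>i. \<alpha> (i / n)))" if "k0 \<le> k" for k
  proof -
    define r where "r = 1 / (real k + 4)"
    have "4 / e < real k"
      using k0 that by linarith
    then have r: "0 < r" "4 * r \<le> e" "2 * r \<le> 1 / 2"
      using e(1) by (auto simp: r_def field_simps)
    have "\<forall>\<^sub>F n in sequentially. step_path n (\<lambda>i. \<alpha> (i / n)) \<in> skorohod_nbhd \<alpha> (2 * r)"
      using r by (intro step_path_sample_tendsto[OF \<alpha>]) auto
    then have "\<forall>\<^sub>F n in sequentially. c' \<le> sample_inf (\<lambda>\<beta>. ennreal (f \<beta>)) n r (\<lambda>i. \<alpha> (i / n))"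
      using eventually_gt_at_top[of 0]
    proof eventually_elim
      case (elim n)
      have "skorohod_nbhd (step_path n (\<lambda>i. \<alpha> (i / n))) (2 * r) \<subseteq> skorohod_nbhd \<alpha> (2 * (2 * r))"
        using skorohod_nbhd_trans[OF elim(1) _ _ r(3)] r by auto
      also have "\<dots> \<subseteq> U"
        using skorohod_nbhd_mono[of "4 * r" e \<alpha>] r e by auto
      finally show ?case
        using r U elim by (intro sample_inf_ge) auto
    qed
    then have "c' \<le> liminf (\<lambda>n. sample_inf (\<lambda>\<beta>. ennreal (f \<beta>)) n r (\<lambda>i. \<alpha> (i / n)))"
      by (rule Liminf_bounded)
    then show ?thesis
      using c'(1) by (simp add: r_def)
  qed
  then show "\<forall>\<^sub>F k in sequentially. c < liminf (\<lambda>n. sample_inf (\<lambda>\<beta>. ennreal (f \<beta>)) n (1 / (real k + 4)) (\<lambda>i. \<alpha> (i / n)))"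
    unfolding eventually_sequentially by (intro exI[of _ k0] allI impI)
qed

section \<open>Markov processes with transition densities\<close>

lemma past_properties:
  assumes X: "\<And>t. 0 \<le> t \<Longrightarrow> X t \<in> borel_measurable M"
  shows subalgebra_past: "subalgebra M (past M X s)"
    and measurable_past: "0 \<le> u \<Longrightarrow> u \<le> s \<Longrightarrow> X u \<in> borel_measurable (past M X s)"
    and past_mono: "s \<le> t \<Longrightarrow> sets (past M X s) \<subseteq> sets (past M X t)"
proof -
  define E where "E s = {X u -` B \<inter> space M | u B. 0 \<le> u \<and> u \<le> s \<and> B \<in> sets borel}" for s
  have E: "E s \<subseteq> sets M" for s
    using X by (auto simp: E_def)
  then have E': "E s \<subseteq> Pow (space M)" for s
    using sets.sets_into_space by blast
  have sets: "sets (past M X s) = sigma_sets (space M) (E s)" and space: "space (past M X s) = space M" for s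
    using E' by (auto simp: past_def E_def[symmetric] space_measure_of)
  show "subalgebra M (past M X s)"
    unfolding subalgebra_def using sets space sets.sigma_sets_subset[OF E] by auto
  show "X u \<in> borel_measurable (past M X s)" if "0 \<le> u" "u \<le> s"
    using that by (intro measurableI) (auto simp: sets space E_def intro!: sigma_sets.Basic)
  show "sets (past M X s) \<subseteq> sets (past M X t)" if "s \<le> t"
    unfolding sets using that by (intro sigma_sets_mono') (auto simp: E_def intro: order_trans)
qed

text \<open>The definition of conditional expectation covers products of an event of the past and an event
  for \<open>X t\<close>.  Such rectangles determine the joint law of the past and \<open>X t\<close>.\<close>

lemma markov_nn_integral:
  fixes X :: "real \<Rightarrow> 'a \<Rightarrow> real"
  assumes M: "prob_space M" and X: "\<And>t. 0 \<le> t \<Longrightarrow> X t \<in> borel_measurable M"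
    and markov: "markov_process M X S p" and st: "0 \<le> s" "s < t" and S[measurable]: "S \<in> sets borel"
    and nonneg: "\<And>x y. x \<in> S \<Longrightarrow> y \<in> S \<Longrightarrow> 0 \<le> p s t x y"
    and p: "(\<lambda>(x, y). p s t x y * indicator S x * indicator S y) \<in> borel_measurable (borel \<Otimes>\<^sub>M borel)"
    and g[measurable]: "g \<in> borel_measurable (past M X s \<Otimes>\<^sub>M borel)"
  shows "(\<integral>\<^sup>+\<omega>. g (\<omega>, X t \<omega>) \<partial>M) =
    (\<integral>\<^sup>+\<omega>. \<integral>\<^sup>+y. ennreal (p s t (X s \<omega>) y) * indicator S y * g (\<omega>, y) \<partial>lborel \<partial>M)"
proof -
  interpret prob_space M by (rule M)
  define F where "F = past M X s"
  have sub: "subalgebra M F"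
    unfolding F_def by (rule subalgebra_past[OF X])
  interpret finite_measure_subalgebra M F
    by unfold_locales (rule sub)
  have spF: "space F = space M" and setsF: "sets F \<subseteq> sets M"
    using sub by (auto simp: subalgebra_def)
  define k where "k x y = ennreal (p s t x y * indicator S x * indicator S y)" for x y
  have k[measurable]: "(\<lambda>(x, y). k x y) \<in> borel_measurable (borel \<Otimes>\<^sub>M borel)"
    unfolding k_def using measurable_compose[OF p measurable_ennreal] by (simp add: case_prod_beta')
  have XsF[measurable]: "X s \<in> borel_measurable F"
    unfolding F_def using st by (intro measurable_past[OF X]) auto
  have Xs[measurable]: "X s \<in> borel_measurable M" and Xt[measurable]: "X t \<in> borel_measurable M"
    using X st by auto
  have XS: "X t \<omega> \<in> S" if "\<omega> \<in> space M" "0 \<le> t" for \<omega> t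
    using markov that by (auto simp: markov_process_def)
  have k_eq: "k (X s \<omega>) y = ennreal (p s t (X s \<omega>) y) * indicator S y" if "\<omega> \<in> space M" for \<omega> y
    using XS[OF that st(1)] by (simp add: k_def indicator_def)

  let ?k = "\<lambda>(\<omega>, y). k (X s \<omega>) y"
  let ?J = "\<lambda>B \<omega>. \<integral>\<^sup>+y. k (X s \<omega>) y * indicator B y \<partial>lborel"
  have ce: "AE \<omega> in M. real_cond_exp M F (\<lambda>\<omega>'. indicator B (X t \<omega>')) \<omega> =
          (LINT y:B \<inter> S|lborel. p s t (X s \<omega>) y)" if "B \<in> sets borel" for B
    using markov st that unfolding markov_process_def F_def by blast
  \<comment> \<open>almost surely the density integrates to one, hence is integrable; a non-integrable one would have integral zero\<close>
  have one: "AE \<omega> in M. (LINT y:UNIV \<inter> S|lborel. p s t (X s \<omega>) y) = 1"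
  proof -
    have "AE \<omega> in M. real_cond_exp M F (\<lambda>\<omega>'. indicator UNIV (X t \<omega>')) \<omega> = (1::real)"
      using real_cond_exp_F_meas[of "\<lambda>\<omega>. 1"] by simp
    from this ce[of UNIV, simplified] show ?thesis
      by eventually_elim simp
  qed
  have dens: "AE \<omega> in M. ennreal (real_cond_exp M F (\<lambda>\<omega>'. indicator B (X t \<omega>')) \<omega>) =
      ?J B \<omega> \<and>
      0 \<le> real_cond_exp M F (\<lambda>\<omega>'. indicator B (X t \<omega>')) \<omega>"
    if [measurable]: "B \<in> sets borel" for B
    using ce[OF that] one AE_space
  proof eventually_elim
    case (elim \<omega>)
    have xS: "X s \<omega> \<in> S"
      using XS elim st by auto
    have "integrable lborel (\<lambda>y. indicator (UNIV \<inter> S) y *\<^sub>R p s t (X s \<omega>) y)"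
      using elim(2) not_integrable_integral_eq[of lborel "\<lambda>y. indicator (UNIV \<inter> S) y *\<^sub>R p s t (X s \<omega>) y"]
      unfolding set_lebesgue_integral_def by force
    from integrable_mult_indicator[OF _ this, of B]
    have int: "integrable lborel (\<lambda>y. indicator (B \<inter> S) y *\<^sub>R p s t (X s \<omega>) y)"
      by (simp add: indicator_inter_arith mult.assoc)
    have nn: "0 \<le> indicator (B \<inter> S) y *\<^sub>R p s t (X s \<omega>) y" for y
      using nonneg[OF xS, of y] by (auto simp: indicator_def)
    have "?J B \<omega> =
        (\<integral>\<^sup>+y. ennreal (indicator (B \<inter> S) y *\<^sub>R p s t (X s \<omega>) y) \<partial>lborel)"
      using xS by (intro nn_integral_cong) (auto simp: k_def indicator_def)
    also have "\<dots> = ennreal (LINT y:B \<inter> S|lborel. p s t (X s \<omega>) y)"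
      unfolding set_lebesgue_integral_def using int nn by (intro nn_integral_eq_integral) auto
    finally show ?case
      using elim(1) nn by (auto simp: set_lebesgue_integral_def intro!: integral_nonneg_AE)
  qed
  have rect: "emeasure M (A \<inter> (X t -` B \<inter> space M)) =
      (\<integral>\<^sup>+\<omega>. ?J B \<omega> * indicator A \<omega> \<partial>M)"
    if A: "A \<in> sets F" and B[measurable]: "B \<in> sets borel" for A B
  proof -
    have A'[measurable]: "A \<in> sets M"
      using A setsF by auto
    let ?I = "\<lambda>\<omega>'. indicator B (X t \<omega>') :: real"
    have int: "integrable M ?I"
      by (rule integrable_const_bound[of _ 1]) auto
    have "(\<integral>\<^sup>+\<omega>. ?J B \<omega> * indicator A \<omega> \<partial>M) =
       (\<integral>\<^sup>+\<omega>. ennreal (indicator A \<omega> *\<^sub>R real_cond_exp M F ?I \<omega>) \<partial>M)"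
      by (rule nn_integral_cong_AE) (use dens[OF B] in \<open>eventually_elim, auto simp: indicator_def\<close>)
    also have "\<dots> = ennreal (\<integral>\<omega>\<in>A. real_cond_exp M F ?I \<omega> \<partial>M)"
      unfolding set_lebesgue_integral_def
    proof (rule nn_integral_eq_integral)
      show "integrable M (\<lambda>\<omega>. indicator A \<omega> *\<^sub>R real_cond_exp M F ?I \<omega>)"
        by (rule integrable_mult_indicator[OF A' real_cond_exp_int(1)[OF int]])
      show "AE \<omega> in M. 0 \<le> indicator A \<omega> *\<^sub>R real_cond_exp M F ?I \<omega>"
        using dens[OF B] by eventually_elim simp
    qed
    also have "(\<integral>\<omega>\<in>A. real_cond_exp M F ?I \<omega> \<partial>M) = (\<integral>\<omega>\<in>A. ?I \<omega> \<partial>M)"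
      using real_cond_exp_intA[OF int A] by simp
    also have "(\<integral>\<omega>\<in>A. ?I \<omega> \<partial>M) = (\<integral>\<omega>. indicator (A \<inter> (X t -` B \<inter> space M)) \<omega> \<partial>M)"
      unfolding set_lebesgue_integral_def by (intro Bochner_Integration.integral_cong) (auto simp: indicator_def)
    also have "ennreal \<dots> = emeasure M (A \<inter> (X t -` B \<inter> space M))"
      by (simp add: emeasure_eq_measure)
    finally show ?thesis ..
  qed

  define \<mu> where "\<mu> = distr M (F \<Otimes>\<^sub>M borel) (\<lambda>\<omega>. (\<omega>, X t \<omega>))"
  define R where "R = restr_to_subalg M F"
  define \<nu> where "\<nu> = density (R \<Otimes>\<^sub>M lborel) ?k"
  have setsR[measurable_cong]: "sets R = sets F"
    unfolding R_def by (rule sets_restr_to_subalg[OF sub])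
  have idF[measurable]: "(\<lambda>\<omega>. \<omega>) \<in> M \<rightarrow>\<^sub>M F"
    using sub by (simp add: measurable_def subalgebra_def) (metis sets.Int_space_eq2 spF subsetD sub subalgebra_def)
  have pairM[measurable]: "(\<lambda>\<omega>. (\<omega>, X t \<omega>)) \<in> M \<rightarrow>\<^sub>M (F \<Otimes>\<^sub>M borel)"
    by measurable
  have kF: "?k \<in> borel_measurable (R \<Otimes>\<^sub>M lborel)"
    by measurable
  define E where "E = {A \<times> B | A B. A \<in> sets F \<and> B \<in> sets (borel :: real measure)}"
  have "\<mu> = \<nu>"
  proof (rule measure_eqI_generator_eq[where E = E and \<Omega> = "space M \<times> UNIV" and A = "\<lambda>i. space M \<times> UNIV"])
    show "Int_stable E"
      unfolding E_def by (rule Int_stable_pair_measure_generator)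
    show "E \<subseteq> Pow (space M \<times> UNIV)"
      using sets.sets_into_space spF by (auto simp: E_def)
    show "sets \<mu> = sigma_sets (space M \<times> UNIV) E"
      unfolding \<mu>_def E_def using spF by (simp add: sets_pair_measure)
    show "sets \<nu> = sigma_sets (space M \<times> UNIV) E"
      unfolding \<nu>_def E_def using spF setsR sets_eq_imp_space_eq[OF setsR] by (simp add: sets_pair_measure)
    show "range (\<lambda>i::nat. space M \<times> (UNIV::real set)) \<subseteq> E"
    proof -
      have "space M \<in> sets F"
        using sets.top[of F] spF by simp
      then have "space M \<times> UNIV \<in> E"
        unfolding E_def mem_Collect_eq by (intro exI[of _ "space M"] exI[of _ UNIV]) simp
      then show ?thesis by simp
    qed
    show "(\<Union>i::nat. space M \<times> (UNIV::real set)) = space M \<times> UNIV" by simp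
    show "emeasure \<mu> (space M \<times> UNIV) \<noteq> \<infinity>"
    proof -
      interpret P: prob_space \<mu> unfolding \<mu>_def by (rule prob_space_distr) measurable
      show ?thesis by simp
    qed
    fix C assume "C \<in> E"
    then obtain A B where C: "C = A \<times> B" and A[measurable]: "A \<in> sets F" and B[measurable]: "B \<in> sets borel"
      by (auto simp: E_def)
    have "A \<subseteq> space M"
      using sets.sets_into_space[OF A] spF by simp
    then have "emeasure \<mu> C = emeasure M (A \<inter> (X t -` B \<inter> space M))"
      unfolding \<mu>_def C by (subst emeasure_distr) (auto intro!: arg_cong[where f = "emeasure M"])
    also have "\<dots> = (\<integral>\<^sup>+\<omega>. ?J B \<omega> * indicator A \<omega> \<partial>M)"
      by (rule rect[OF A B])
    also have "\<dots> = (\<integral>\<^sup>+\<omega>. ?J B \<omega> * indicator A \<omega> \<partial>R)"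
      unfolding R_def by (rule nn_integral_subalgebra2[OF sub, symmetric]) measurable
    also have "\<dots> = (\<integral>\<^sup>+\<omega>. \<integral>\<^sup>+y. ?k (\<omega>, y) * indicator C (\<omega>, y) \<partial>lborel \<partial>R)"
    proof (rule nn_integral_cong)
      fix \<omega> assume "\<omega> \<in> space R"
      then have [measurable]: "(\<lambda>y. k (X s \<omega>) y) \<in> borel_measurable borel"
        by measurable
      have "?J B \<omega> * indicator A \<omega> =
        (\<integral>\<^sup>+y. k (X s \<omega>) y * indicator B y * indicator A \<omega> \<partial>lborel)"
        by (rule nn_integral_multc[symmetric]) measurable
      then show "?J B \<omega> * indicator A \<omega> =
        (\<integral>\<^sup>+y. ?k (\<omega>, y) * indicator C (\<omega>, y) \<partial>lborel)"
        by (simp add: C indicator_times mult.commute mult.left_commute)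
    qed
    also have "\<dots> = (\<integral>\<^sup>+z. ?k z * indicator C z \<partial>(R \<Otimes>\<^sub>M lborel))"
      using kF by (intro lborel.nn_integral_fst) (simp add: C)
    also have "\<dots> = emeasure \<nu> C"
      unfolding \<nu>_def using kF by (intro emeasure_density[symmetric]) (simp_all add: C)
    finally show "emeasure \<mu> C = emeasure \<nu> C" .
  qed
  have gF[measurable]: "g \<in> borel_measurable (F \<Otimes>\<^sub>M borel)"
    using g by (simp add: F_def)
  have "(\<integral>\<^sup>+\<omega>. g (\<omega>, X t \<omega>) \<partial>M) = (\<integral>\<^sup>+z. g z \<partial>\<mu>)"
    unfolding \<mu>_def by (rule nn_integral_distr[symmetric]) measurable
  also have "\<dots> = (\<integral>\<^sup>+z. g z \<partial>\<nu>)"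
    by (simp only: \<open>\<mu> = \<nu>\<close>)
  also have "\<dots> = (\<integral>\<^sup>+z. ?k z * g z \<partial>(R \<Otimes>\<^sub>M lborel))"
    unfolding \<nu>_def using kF by (intro nn_integral_density) measurable
  also have "\<dots> = (\<integral>\<^sup>+\<omega>. \<integral>\<^sup>+y. ?k (\<omega>, y) * g (\<omega>, y) \<partial>lborel \<partial>R)"
    using kF by (intro lborel.nn_integral_fst[symmetric]) measurable
  also have "\<dots> = (\<integral>\<^sup>+\<omega>. \<integral>\<^sup>+y. ?k (\<omega>, y) * g (\<omega>, y) \<partial>lborel \<partial>M)"
    unfolding R_def by (rule nn_integral_subalgebra2[OF sub]) measurable
  also have "\<dots> = (\<integral>\<^sup>+\<omega>. \<integral>\<^sup>+y. ennreal (p s t (X s \<omega>) y) * indicator S y * g (\<omega>, y) \<partial>lborel \<partial>M)"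
    by (intro nn_integral_cong) (simp add: k_eq)
  finally show ?thesis .
qed

section \<open>A maximal inequality and repeated large increments\<close>

text \<open>The only probabilistic input to the tightness estimate is a bound on the conditional tails of
  increments over at most \<open>W\<close> steps.  It is stated with events \<open>A\<close> of the past, to be used with
  the events that a first exit occurs at a given time.\<close>

locale small_increments = prob_space M for M :: "'a measure" +
  fixes \<xi> :: "nat \<Rightarrow> 'a \<Rightarrow> real" and G :: "nat \<Rightarrow> 'a measure" and W :: nat and \<rho> p :: real
  assumes sub: "\<And>i. subalgebra M (G i)"
    and adapted: "\<And>i j. i \<le> j \<Longrightarrow> \<xi> i \<in> borel_measurable (G j)"
    and mono: "\<And>i j. i \<le> j \<Longrightarrow> sets (G i) \<subseteq> sets (G j)"
    and incr: "\<And>i j A. i < j \<Longrightarrow> j \<le> i + W \<Longrightarrow> A \<in> sets (G i) \<Longrightarrow>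
      measure M (A \<inter> {\<omega> \<in> space M. \<rho> < \<bar>\<xi> j \<omega> - \<xi> i \<omega>\<bar>}) \<le> p * measure M A"
    and p: "0 \<le> p" "p \<le> 1 / 2" and \<rho>: "0 < \<rho>"
begin

lemma space_G: "space (G i) = space M" and sets_G: "A \<in> sets (G i) \<Longrightarrow> A \<in> sets M"
  using sub[of i] by (auto simp: subalgebra_def)

lemma \<xi>_measurable [measurable]: "\<xi> i \<in> borel_measurable M"
  using adapted[of i i] measurable_from_subalg[OF sub] by blast

definition first_exit :: "nat \<Rightarrow> real \<Rightarrow> nat \<Rightarrow> 'a set" where
  "first_exit i r j = {\<omega> \<in> space M. r < \<bar>\<xi> j \<omega> - \<xi> i \<omega>\<bar> \<and> (\<forall>m. i < m \<and> m < j \<longrightarrow> \<bar>\<xi> m \<omega> - \<xi> i \<omega>\<bar> \<le> r)}"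

lemma first_exit_sets: "i < j \<Longrightarrow> first_exit i r j \<in> sets (G j)"
proof -
  assume "i < j"
  have [measurable]: "\<xi> m \<in> borel_measurable (G j)" if "m \<in> {i..j}" for m
    using adapted that by auto
  have [measurable]: "\<xi> i \<in> borel_measurable (G j)" "\<xi> j \<in> borel_measurable (G j)"
    using adapted \<open>i < j\<close> by auto
  have "first_exit i r j = {\<omega> \<in> space (G j). r < \<bar>\<xi> j \<omega> - \<xi> i \<omega>\<bar> \<and> (\<forall>m\<in>{i<..<j}. \<bar>\<xi> m \<omega> - \<xi> i \<omega>\<bar> \<le> r)}"
    by (auto simp: first_exit_def space_G)
  also have "\<dots> \<in> sets (G j)"
    by (intro sets.sets_Collect_conj sets.sets_Collect_finite_All) (use \<open>i < j\<close> in \<open>measurable, auto\<close>)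
  finally show ?thesis .
qed

lemma first_exit_disjoint: "disjoint_family_on (first_exit i r) {i<..}"
  by (auto simp: disjoint_family_on_def first_exit_def) (metis linorder_neqE_nat not_less)

lemma first_exit_exists:
  assumes "\<omega> \<in> space M" "i < j" "r < \<bar>\<xi> j \<omega> - \<xi> i \<omega>\<bar>"
  obtains m where "i < m" "m \<le> j" "\<omega> \<in> first_exit i r m"
proof -
  define P where "P m \<longleftrightarrow> i < m \<and> r < \<bar>\<xi> m \<omega> - \<xi> i \<omega>\<bar>" for m
  have "P j" using assms by (simp add: P_def)
  then have "P (Least P)" "Least P \<le> j"
    by (auto intro: LeastI Least_le)
  moreover have "\<bar>\<xi> m \<omega> - \<xi> i \<omega>\<bar> \<le> r" if "i < m" "m < Least P" for m
    using not_less_Least[OF that(2)] that(1) by (simp add: P_def)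
  ultimately show ?thesis
    using assms(1) by (intro that[of "Least P"]) (auto simp: P_def first_exit_def)
qed

text \<open>Ottaviani's inequality: after the first exit at distance \<open>2 \<rho>\<close> the process is unlikely to come
  back by more than \<open>\<rho>\<close>, so the final increment is large, too.\<close>

lemma maximal_inequality:
  assumes A: "A \<in> sets (G i)" and w: "w \<le> W" and r: "2 * \<rho> \<le> r"
  shows "measure M (A \<inter> (\<Union>j\<in>{i<..i + w}. first_exit i r j)) \<le> 2 * p * measure M A"
proof (cases "w = 0")
  case False
  define B where "B j = A \<inter> first_exit i r j" for j
  have BG: "B j \<in> sets (G j)" if "j \<in> {i<..i + w}" for j
    using that A mono[of i j] first_exit_sets[of i j r] by (auto simp: B_def)
  then have BM[measurable]: "B j \<in> sets M" if "j \<in> {i<..i + w}" for j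
    using that sets_G by blast
  have AM[measurable]: "A \<in> sets M"
    using A sets_G by auto
  have disj: "disjoint_family_on B {i<..i + w}"
    unfolding disjoint_family_on_def
  proof (intro ballI impI)
    fix m n assume "m \<in> {i<..i + w}" "n \<in> {i<..i + w}" "m \<noteq> n"
    then have "first_exit i r m \<inter> first_exit i r n = {}"
      using first_exit_disjoint[of i r] by (auto simp: disjoint_family_on_def)
    then show "B m \<inter> B n = {}"
      by (auto simp: B_def)
  qed
  let ?U = "\<Union>j\<in>{i<..i + w}. B j"
  let ?D = "\<lambda>j. {\<omega> \<in> space M. \<rho> < \<bar>\<xi> (i + w) \<omega> - \<xi> j \<omega>\<bar>}"
  have sumB: "measure M ?U = (\<Sum>j\<in>{i<..i + w}. measure M (B j))"
    using BM disj by (intro finite_measure_finite_Union) auto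
  have ret: "measure M (B j \<inter> ?D j) \<le> p * measure M (B j)" if "j \<in> {i<..i + w}" for j
  proof (cases "j = i + w")
    case True
    then have "B j \<inter> ?D j = {}"
      using \<rho> by auto
    then show ?thesis
      using p by simp
  next
    case False
    then show ?thesis
      using that w BG[OF that] by (intro incr) auto
  qed
  have "?U \<subseteq> (A \<inter> ?D i) \<union> (\<Union>j\<in>{i<..i + w}. B j \<inter> ?D j)"
  proof
    fix \<omega> assume "\<omega> \<in> ?U"
    then obtain j where j: "j \<in> {i<..i + w}" "\<omega> \<in> B j" by blast
    then have "2 * \<rho> < \<bar>\<xi> j \<omega> - \<xi> i \<omega>\<bar>" "\<omega> \<in> space M" "\<omega> \<in> A"
      using r by (auto simp: B_def first_exit_def)
    then have "\<rho> < \<bar>\<xi> (i + w) \<omega> - \<xi> i \<omega>\<bar> \<or> \<rho> < \<bar>\<xi> (i + w) \<omega> - \<xi> j \<omega>\<bar>"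
      by linarith
    then show "\<omega> \<in> (A \<inter> ?D i) \<union> (\<Union>j\<in>{i<..i + w}. B j \<inter> ?D j)"
      using j \<open>\<omega> \<in> space M\<close> \<open>\<omega> \<in> A\<close> by auto
  qed
  then have "measure M ?U \<le> measure M ((A \<inter> ?D i) \<union> (\<Union>j\<in>{i<..i + w}. B j \<inter> ?D j))"
    by (intro finite_measure_mono) measurable
  also have "\<dots> \<le> measure M (A \<inter> ?D i) + measure M (\<Union>j\<in>{i<..i + w}. B j \<inter> ?D j)"
    by (intro measure_Un_le) measurable
  also have "measure M (\<Union>j\<in>{i<..i + w}. B j \<inter> ?D j) \<le> (\<Sum>j\<in>{i<..i + w}. measure M (B j \<inter> ?D j))"
    by (intro finite_measure_subadditive_finite) (auto intro!: sets.Int)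
  also have "\<dots> \<le> (\<Sum>j\<in>{i<..i + w}. p * measure M (B j))"
    by (intro sum_mono ret)
  also have "\<dots> = p * measure M ?U"
    by (simp add: sumB sum_distrib_left)
  also have "\<dots> \<le> 1 / 2 * measure M ?U"
    using p by (intro mult_right_mono) auto
  also have "measure M (A \<inter> ?D i) \<le> p * measure M A"
    using A w False by (intro incr) auto
  finally have "measure M ?U \<le> 2 * p * measure M A" by simp
  then show ?thesis
    by (simp add: B_def)
qed (use p in simp)

text \<open>Decompose according to the time \<open>j\<close> of the first large move, which is an event of the past at
  \<open>j\<close>, and apply the maximal inequality twice: to the moves after \<open>j\<close> and to the first move.\<close>

lemma two_large_moves:
  assumes w: "w \<le> W" "w' \<le> W"
  shows "measure M {\<omega> \<in> space M. \<exists>j\<in>{i<..i + w}. \<omega> \<in> first_exit i (4 * \<rho>) j \<and>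
    (\<exists>s\<in>{j..j + w'}. 2 * \<rho> < \<bar>\<xi> s \<omega> - \<xi> j \<omega>\<bar>)} \<le> 4 * p\<^sup>2"
    (is "measure M ?D \<le> _")
proof -
  define B where "B j = first_exit i (4 * \<rho>) j" for j
  define H where "H j = (\<Union>s\<in>{j<..j + w'}. first_exit j (2 * \<rho>) s)" for j
  have BG: "B j \<in> sets (G j)" if "j \<in> {i<..i + w}" for j
    using that first_exit_sets by (simp add: B_def)
  then have BM: "B j \<in> sets M" if "j \<in> {i<..i + w}" for j
    using that sets_G by blast
  have HM: "H j \<in> sets M" for j
    unfolding H_def using first_exit_sets sets_G by (intro sets.finite_UN) auto
  have "?D \<subseteq> (\<Union>j\<in>{i<..i + w}. B j \<inter> H j)"
  proof
    fix \<omega> assume "\<omega> \<in> ?D"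
    then obtain j s where j: "\<omega> \<in> space M" "j \<in> {i<..i + w}" "\<omega> \<in> B j" "s \<in> {j..j + w'}"
      "2 * \<rho> < \<bar>\<xi> s \<omega> - \<xi> j \<omega>\<bar>"
      by (auto simp: B_def)
    then have "j < s"
      using \<rho> by (cases "j = s") auto
    then obtain m where "j < m" "m \<le> s" "\<omega> \<in> first_exit j (2 * \<rho>) m"
      using first_exit_exists[of \<omega> j s "2 * \<rho>"] j by auto
    then have "\<omega> \<in> H j"
      unfolding H_def using j by auto
    then show "\<omega> \<in> (\<Union>j\<in>{i<..i + w}. B j \<inter> H j)"
      using j by blast
  qed
  then have "measure M ?D \<le> measure M (\<Union>j\<in>{i<..i + w}. B j \<inter> H j)"
    using BM HM by (intro finite_measure_mono) auto
  also have "\<dots> \<le> (\<Sum>j\<in>{i<..i + w}. measure M (B j \<inter> H j))"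
    using BM HM by (intro finite_measure_subadditive_finite) auto
  also have "\<dots> \<le> (\<Sum>j\<in>{i<..i + w}. 2 * p * measure M (B j))"
    unfolding H_def using w by (intro sum_mono maximal_inequality BG) auto
  also have "\<dots> = 2 * p * (\<Sum>j\<in>{i<..i + w}. measure M (B j))"
    by (simp add: sum_distrib_left)
  also have "(\<Sum>j\<in>{i<..i + w}. measure M (B j)) = measure M (\<Union>j\<in>{i<..i + w}. B j)"
    using BM first_exit_disjoint[of i "4 * \<rho>"]
    by (intro finite_measure_finite_Union[symmetric]) (auto simp: disjoint_family_on_def B_def)
  also have "\<dots> = measure M (space M \<inter> (\<Union>j\<in>{i<..i + w}. first_exit i (4 * \<rho>) j))"
    by (intro arg_cong[where f = "measure M"]) (auto simp: B_def first_exit_def)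
  also have "\<dots> \<le> 2 * p * measure M (space M)"
    using \<rho> w sets.top[of "G i"] by (intro maximal_inequality) (auto simp: space_G)
  finally show ?thesis
    using p by (simp add: prob_space power2_eq_square mult_left_mono)
qed

end

section \<open>Convergence of finite-dimensional distributions\<close>

definition restrict_upto :: "nat \<Rightarrow> (nat \<Rightarrow> real) \<Rightarrow> nat \<Rightarrow> real" where
  "restrict_upto L v = (\<lambda>i. if i \<le> L then v i else 0)"

text \<open>The one-step transition density is tested against functionals of the whole sampled past, so that
  a joint law can be integrated out one coordinate at a time.\<close>

definition has_step_density :: "'a measure \<Rightarrow> (nat \<Rightarrow> 'a \<Rightarrow> real) \<Rightarrow> (real \<Rightarrow> real \<Rightarrow> real) \<Rightarrow> bool" where
  "has_step_density M \<xi> k \<longleftrightarrow> (\<forall>i. \<xi> i \<in> borel_measurable M) \<and>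
    (\<lambda>(y, z). ennreal (k y z)) \<in> borel_measurable (borel \<Otimes>\<^sub>M borel) \<and>
    (\<forall>i. \<forall>g \<in> borel_measurable (borel \<Otimes>\<^sub>M borel).
      (\<integral>\<^sup>+\<omega>. g (restrict_upto i (\<lambda>m. \<xi> m \<omega>), \<xi> (Suc i) \<omega>) \<partial>M) =
      (\<integral>\<^sup>+\<omega>. \<integral>\<^sup>+z. ennreal (k (\<xi> i \<omega>) z) * g (restrict_upto i (\<lambda>m. \<xi> m \<omega>), z) \<partial>lborel \<partial>M))"

lemma step_density_nn_integral:
  assumes "has_step_density M \<xi> k" "g \<in> borel_measurable (borel \<Otimes>\<^sub>M borel)"
  shows "(\<integral>\<^sup>+\<omega>. g (restrict_upto i (\<lambda>m. \<xi> m \<omega>), \<xi> (Suc i) \<omega>) \<partial>M) =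
      (\<integral>\<^sup>+\<omega>. \<integral>\<^sup>+z. ennreal (k (\<xi> i \<omega>) z) * g (restrict_upto i (\<lambda>m. \<xi> m \<omega>), z) \<partial>lborel \<partial>M)"
  using assms unfolding has_step_density_def by blast

lemma coordinate_measurable [measurable]: "(\<lambda>v :: nat \<Rightarrow> real. v i) \<in> borel_measurable borel"
  by (intro borel_measurable_continuous_onI continuous_on_product_coordinates)

lemma fun_upd_measurable [measurable]:
  "(\<lambda>(w, z). w(j := z)) \<in> borel \<Otimes>\<^sub>M borel \<rightarrow>\<^sub>M (borel :: (nat \<Rightarrow> real) measure)"
proof (rule measurable_coordinatewise_then_product)
  fix i
  have "(\<lambda>x :: (nat \<Rightarrow> real) \<times> real. fst x i) \<in> borel_measurable (borel \<Otimes>\<^sub>M borel)" for i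
    by (rule measurable_compose[OF measurable_fst coordinate_measurable])
  then show "(\<lambda>x. (case x of (w, z) \<Rightarrow> w(j := z)) i) \<in> borel_measurable (borel \<Otimes>\<^sub>M (borel :: real measure))"
    by (cases "i = j") (simp_all add: case_prod_beta')
qed

lemma restrict_upto_measurable:
  assumes "\<And>m. m \<le> i \<Longrightarrow> \<xi> m \<in> borel_measurable M"
  shows "(\<lambda>\<omega>. restrict_upto i (\<lambda>m. \<xi> m \<omega>)) \<in> M \<rightarrow>\<^sub>M borel"
proof (rule measurable_coordinatewise_then_product)
  show "(\<lambda>\<omega>. restrict_upto i (\<lambda>m. \<xi> m \<omega>) j) \<in> borel_measurable M" for j
    using assms by (cases "j \<le> i") (simp_all add: restrict_upto_def)
qed

text \<open>Only an inequality can be expected, since \<open>l = 0\<close> and \<open>liminf h = \<infinity>\<close> may occur together.\<close>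

lemma mult_liminf_le:
  fixes a :: "nat \<Rightarrow> real" and h :: "nat \<Rightarrow> ennreal"
  assumes "a \<longlonglongrightarrow> l"
  shows "ennreal l * liminf h \<le> liminf (\<lambda>j. ennreal (a j) * h j)"
proof (cases "0 < l")
  case True
  define m where "m n = (INF j\<in>{n..}. h j)" for n
  have "incseq m"
    unfolding m_def by (intro monoI INF_superset_mono) auto
  then have "m \<longlonglongrightarrow> liminf h"
    unfolding liminf_SUP_INF m_def[symmetric] by (rule LIMSEQ_SUP)
  then have "(\<lambda>j. ennreal (a j) * m j) \<longlonglongrightarrow> ennreal l * liminf h"
    using assms True by (intro tendsto_mult_ennreal tendsto_ennrealI) auto
  then have "ennreal l * liminf h = liminf (\<lambda>j. ennreal (a j) * m j)"
    by (simp add: lim_imp_Liminf)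
  also have "\<dots> \<le> liminf (\<lambda>j. ennreal (a j) * h j)"
    by (intro Liminf_mono always_eventually allI mult_left_mono) (auto simp: m_def intro: INF_lower)
  finally show ?thesis .
qed (simp add: ennreal_neg)

text \<open>Induction on the number of coordinates: the last one is integrated out, and Fatou's lemma with
  respect to the Lebesgue measure moves the lower limit out of this inner integral.  The functionals
  have to depend on \<open>j\<close>, because the inner integral does.\<close>

lemma step_density_liminf:
  fixes \<zeta> :: "nat \<Rightarrow> 'b \<Rightarrow> real" and \<xi> :: "nat \<Rightarrow> nat \<Rightarrow> 'a \<Rightarrow> real"
  assumes N: "prob_space N" and M: "prob_space M"
    and \<zeta>: "has_step_density N \<zeta> k" and \<xi>: "\<And>j. has_step_density M (\<xi> j) (kk j)"
    and k: "\<And>y z. (\<lambda>j. kk j y z) \<longlonglongrightarrow> k y z"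
    and init: "AE \<omega> in N. \<zeta> 0 \<omega> = 0" "\<And>j. AE \<omega> in M. \<xi> j 0 \<omega> = 0"
    and h: "\<And>j. h j \<in> borel_measurable borel"
  shows "(\<integral>\<^sup>+\<omega>. liminf (\<lambda>j. h j (restrict_upto L (\<lambda>m. \<zeta> m \<omega>))) \<partial>N) \<le>
    liminf (\<lambda>j. \<integral>\<^sup>+\<omega>. h j (restrict_upto L (\<lambda>m. \<xi> j m \<omega>)) \<partial>M)"
  using h
proof (induction L arbitrary: h)
  case 0
  interpret N: prob_space N by (rule N)
  interpret M: prob_space M by (rule M)
  have zero: "restrict_upto 0 v = (\<lambda>_. 0)" if "v 0 = 0" for v
    using that by (auto simp: restrict_upto_def)
  have "(\<integral>\<^sup>+\<omega>. liminf (\<lambda>j. h j (restrict_upto 0 (\<lambda>m. \<zeta> m \<omega>))) \<partial>N) = (\<integral>\<^sup>+\<omega>. liminf (\<lambda>j. h j (\<lambda>_. 0)) \<partial>N)"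
    by (rule nn_integral_cong_AE) (use init(1) in \<open>eventually_elim, simp add: zero\<close>)
  moreover have "(\<integral>\<^sup>+\<omega>. h j (restrict_upto 0 (\<lambda>m. \<xi> j m \<omega>)) \<partial>M) = (\<integral>\<^sup>+\<omega>. h j (\<lambda>_. 0) \<partial>M)" for j
    by (rule nn_integral_cong_AE) (use init(2)[of j] in \<open>eventually_elim, simp add: zero\<close>)
  ultimately show ?case
    by (simp add: N.emeasure_space_1 M.emeasure_space_1)
next
  case (Suc L)
  have upd: "restrict_upto (Suc L) v = (restrict_upto L v)(Suc L := v (Suc L))" for v
    by (auto simp: restrict_upto_def)
  have [measurable]: "h j \<in> borel_measurable borel" for j
    using Suc.prems by simp
  have [measurable]: "(\<lambda>(y, z). ennreal (k y z)) \<in> borel_measurable (borel \<Otimes>\<^sub>M borel)"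
    "(\<lambda>(y, z). ennreal (kk j y z)) \<in> borel_measurable (borel \<Otimes>\<^sub>M borel)" for j
    using \<zeta> \<xi> by (auto simp: has_step_density_def)
  have hm[measurable]: "(\<lambda>(w, z). h j (w(Suc L := z))) \<in> borel_measurable (borel \<Otimes>\<^sub>M borel)" for j
    using measurable_compose[OF fun_upd_measurable Suc.prems, of "Suc L" j] by (simp add: case_prod_beta')
  have hm'[measurable]: "(\<lambda>z. h j (w(Suc L := z))) \<in> borel_measurable borel" for j w
    using measurable_Pair2[OF hm[of j], of w] by simp
  have km[measurable]: "(\<lambda>z. ennreal (kk j y z)) \<in> borel_measurable borel" for j y
    using measurable_Pair2[of "\<lambda>(y, z). ennreal (kk j y z)" borel borel borel y] by simp
  define G where "G w z = liminf (\<lambda>j. h j (w(Suc L := z)))" for w z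
  have G: "(\<lambda>(w, z). G w z) \<in> borel_measurable (borel \<Otimes>\<^sub>M borel)"
    unfolding G_def case_prod_beta' using hm by (intro borel_measurable_liminf) (simp add: case_prod_beta')
  define H where "H j w = (\<integral>\<^sup>+z. ennreal (kk j (w L) z) * h j (w(Suc L := z)) \<partial>lborel)" for j w
  have H: "H j \<in> borel_measurable borel" for j
  proof -
    have kL: "(\<lambda>(w, z). ennreal (kk j (w L) z)) \<in> borel_measurable (borel \<Otimes>\<^sub>M borel)"
    proof -
      have "(\<lambda>x :: (nat \<Rightarrow> real) \<times> real. (fst x L, snd x)) \<in> borel \<Otimes>\<^sub>M borel \<rightarrow>\<^sub>M borel \<Otimes>\<^sub>M borel"
        by (intro measurable_Pair measurable_compose[OF measurable_fst coordinate_measurable] measurable_snd)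
      from measurable_compose[OF this, of "\<lambda>(y, z). ennreal (kk j y z)" borel]
      show ?thesis by (simp add: case_prod_beta')
    qed
    have "(\<lambda>(w, z). ennreal (kk j (w L) z) * h j (w(Suc L := z))) \<in> borel_measurable (borel \<Otimes>\<^sub>M lborel)"
      using borel_measurable_times_ennreal[OF kL hm[of j]] by (simp add: case_prod_beta')
    then show ?thesis
      unfolding H_def by (rule lborel.borel_measurable_nn_integral)
  qed
  have "(\<integral>\<^sup>+\<omega>. liminf (\<lambda>j. h j (restrict_upto (Suc L) (\<lambda>m. \<zeta> m \<omega>))) \<partial>N) =
      (\<integral>\<^sup>+\<omega>. (\<lambda>(w, z). G w z) (restrict_upto L (\<lambda>m. \<zeta> m \<omega>), \<zeta> (Suc L) \<omega>) \<partial>N)"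
    by (simp add: upd G_def)
  also have "\<dots> = (\<integral>\<^sup>+\<omega>. \<integral>\<^sup>+z. ennreal (k (\<zeta> L \<omega>) z) * (\<lambda>(w, z). G w z) (restrict_upto L (\<lambda>m. \<zeta> m \<omega>), z) \<partial>lborel \<partial>N)"
    by (rule step_density_nn_integral[OF \<zeta> G])
  also have "\<dots> \<le> (\<integral>\<^sup>+\<omega>. liminf (\<lambda>j. H j (restrict_upto L (\<lambda>m. \<zeta> m \<omega>))) \<partial>N)"
  proof (rule nn_integral_mono)
    fix \<omega>
    let ?w = "restrict_upto L (\<lambda>m. \<zeta> m \<omega>)"
    have "(\<integral>\<^sup>+z. ennreal (k (\<zeta> L \<omega>) z) * (\<lambda>(w, z). G w z) (?w, z) \<partial>lborel) \<le>
        (\<integral>\<^sup>+z. liminf (\<lambda>j. ennreal (kk j (\<zeta> L \<omega>) z) * h j (?w(Suc L := z))) \<partial>lborel)"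
      unfolding G_def by (intro nn_integral_mono) (simp add: mult_liminf_le k)
    also have "\<dots> \<le> liminf (\<lambda>j. \<integral>\<^sup>+z. ennreal (kk j (\<zeta> L \<omega>) z) * h j (?w(Suc L := z)) \<partial>lborel)"
      by (intro nn_integral_liminf borel_measurable_times_ennreal) (simp_all add: km hm')
    also have "\<dots> = liminf (\<lambda>j. H j ?w)"
      by (simp add: H_def restrict_upto_def)
    finally show "(\<integral>\<^sup>+z. ennreal (k (\<zeta> L \<omega>) z) * (\<lambda>(w, z). G w z) (?w, z) \<partial>lborel) \<le> liminf (\<lambda>j. H j ?w)" .
  qed
  also have "\<dots> \<le> liminf (\<lambda>j. \<integral>\<^sup>+\<omega>. H j (restrict_upto L (\<lambda>m. \<xi> j m \<omega>)) \<partial>M)"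
    using H by (rule Suc.IH)
  also have "liminf (\<lambda>j. \<integral>\<^sup>+\<omega>. H j (restrict_upto L (\<lambda>m. \<xi> j m \<omega>)) \<partial>M) =
      liminf (\<lambda>j. \<integral>\<^sup>+\<omega>. h j (restrict_upto (Suc L) (\<lambda>m. \<xi> j m \<omega>)) \<partial>M)"
  proof (rule arg_cong[where f = liminf], rule ext)
    fix j
    have "(\<integral>\<^sup>+\<omega>. H j (restrict_upto L (\<lambda>m. \<xi> j m \<omega>)) \<partial>M) =
      (\<integral>\<^sup>+\<omega>. \<integral>\<^sup>+z. ennreal (kk j (\<xi> j L \<omega>) z) * (\<lambda>(w, z). h j (w(Suc L := z))) (restrict_upto L (\<lambda>m. \<xi> j m \<omega>), z) \<partial>lborel \<partial>M)"
      by (simp add: H_def restrict_upto_def)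
    also have "\<dots> = (\<integral>\<^sup>+\<omega>. (\<lambda>(w, z). h j (w(Suc L := z))) (restrict_upto L (\<lambda>m. \<xi> j m \<omega>), \<xi> j (Suc L) \<omega>) \<partial>M)"
      by (rule step_density_nn_integral[OF \<xi> hm, symmetric])
    also have "\<dots> = (\<integral>\<^sup>+\<omega>. h j (restrict_upto (Suc L) (\<lambda>m. \<xi> j m \<omega>)) \<partial>M)"
      by (simp add: upd)
    finally show "(\<integral>\<^sup>+\<omega>. H j (restrict_upto L (\<lambda>m. \<xi> j m \<omega>)) \<partial>M) =
      (\<integral>\<^sup>+\<omega>. h j (restrict_upto (Suc L) (\<lambda>m. \<xi> j m \<omega>)) \<partial>M)" .
  qed
  finally show ?case .
qed

text \<open>The factor \<open>b\<close> in the new density is the Jacobian of \<open>z \<mapsto> a + b z\<close>.\<close>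

lemma markov_has_step_density:
  fixes X :: "real \<Rightarrow> 'a \<Rightarrow> real"
  assumes M: "prob_space M" and X: "\<And>t. 0 \<le> t \<Longrightarrow> X t \<in> borel_measurable M"
    and markov: "markov_process M X S p" and S[measurable]: "S \<in> sets borel"
    and t: "\<And>i. 0 \<le> t i" "\<And>i. t i < t (Suc i)" and P: "\<And>i. p (t i) (t (Suc i)) = P"
    and nonneg: "\<And>x y. x \<in> S \<Longrightarrow> y \<in> S \<Longrightarrow> 0 \<le> P x y"
    and Pm: "(\<lambda>(x, y). P x y * indicator S x * indicator S y) \<in> borel_measurable (borel \<Otimes>\<^sub>M borel)"
    and \<xi>: "\<And>i. \<xi> i \<in> borel_measurable (past M X (t i))"
    and b: "0 < b" and \<xi>X: "\<And>i. AE \<omega> in M. X (t i) \<omega> = a + b * \<xi> i \<omega>"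
  shows "has_step_density M \<xi> (\<lambda>y z. b * P (a + b * y) (a + b * z) * indicator S (a + b * y) * indicator S (a + b * z))"
  unfolding has_step_density_def
proof (intro conjI allI ballI)
  show "\<xi> i \<in> borel_measurable M" for i
    using measurable_from_subalg[OF subalgebra_past[OF X] \<xi>] by blast
  define K where "K x y = ennreal (P x y * indicator S x * indicator S y)" for x y
  have K[measurable]: "(\<lambda>(x, y). K x y) \<in> borel_measurable (borel \<Otimes>\<^sub>M borel)"
    unfolding K_def using measurable_compose[OF Pm measurable_ennreal] by (simp add: case_prod_beta')
  have K2[measurable]: "(\<lambda>y. K x y) \<in> borel_measurable borel" for x
    using measurable_Pair2[OF K, of x] by simp
  have bK: "ennreal (b * P (a + b * y) (a + b * z) * indicator S (a + b * y) * indicator S (a + b * z)) =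
      ennreal b * K (a + b * y) (a + b * z)" for y z
    unfolding K_def mult.assoc by (rule ennreal_mult') (use b in simp)
  have aff: "(\<lambda>(y, z). (a + b * y, a + b * z)) \<in> borel \<Otimes>\<^sub>M borel \<rightarrow>\<^sub>M borel \<Otimes>\<^sub>M (borel :: real measure)"
    by measurable
  show "(\<lambda>(y, z). ennreal (b * P (a + b * y) (a + b * z) * indicator S (a + b * y) * indicator S (a + b * z)))
      \<in> borel_measurable (borel \<Otimes>\<^sub>M borel)"
    unfolding bK using borel_measurable_times_ennreal[OF measurable_const measurable_compose[OF aff K], of "ennreal b"]
    by (simp add: case_prod_beta')
  fix i and g :: "(nat \<Rightarrow> real) \<times> real \<Rightarrow> ennreal"
  assume g[measurable]: "g \<in> borel_measurable (borel \<Otimes>\<^sub>M borel)"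
  have "t m \<le> t n" if "m \<le> n" for m n
    using that t(2) by (metis lift_Suc_mono_le less_imp_le)
  then have "subalgebra (past M X (t i)) (past M X (t m))" if "m \<le> i" for m
    using that past_mono[OF X] subalgebra_past[OF X] by (simp add: subalgebra_def)
  then have "\<xi> m \<in> borel_measurable (past M X (t i))" if "m \<le> i" for m
    using measurable_from_subalg[OF _ \<xi>] that by blast
  then have R[measurable]: "(\<lambda>\<omega>. restrict_upto i (\<lambda>m. \<xi> m \<omega>)) \<in> past M X (t i) \<rightarrow>\<^sub>M borel"
    by (rule restrict_upto_measurable)
  define g' where "g' = (\<lambda>(\<omega>, y). g (restrict_upto i (\<lambda>m. \<xi> m \<omega>), (y - a) / b))"
  have g'[measurable]: "g' \<in> borel_measurable (past M X (t i) \<Otimes>\<^sub>M borel)"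
    unfolding g'_def by measurable
  have "(\<integral>\<^sup>+\<omega>. g (restrict_upto i (\<lambda>m. \<xi> m \<omega>), \<xi> (Suc i) \<omega>) \<partial>M) = (\<integral>\<^sup>+\<omega>. g' (\<omega>, X (t (Suc i)) \<omega>) \<partial>M)"
    by (rule nn_integral_cong_AE) (use \<xi>X[of "Suc i"] in \<open>eventually_elim, use b in \<open>simp add: g'_def\<close>\<close>)
  also have "\<dots> = (\<integral>\<^sup>+\<omega>. \<integral>\<^sup>+y. ennreal (p (t i) (t (Suc i)) (X (t i) \<omega>) y) * indicator S y * g' (\<omega>, y) \<partial>lborel \<partial>M)"
    by (rule markov_nn_integral[OF M X markov]) (use t nonneg Pm in \<open>auto simp: P\<close>)
  also have "\<dots> = (\<integral>\<^sup>+\<omega>. \<integral>\<^sup>+z. ennreal (b * P (a + b * \<xi> i \<omega>) (a + b * z) * indicator S (a + b * \<xi> i \<omega>) * indicator S (a + b * z)) *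
      g (restrict_upto i (\<lambda>m. \<xi> m \<omega>), z) \<partial>lborel \<partial>M)"
  proof (rule nn_integral_cong_AE)
    from \<xi>X[of i] AE_space
    show "AE \<omega> in M. (\<integral>\<^sup>+y. ennreal (p (t i) (t (Suc i)) (X (t i) \<omega>) y) * indicator S y * g' (\<omega>, y) \<partial>lborel) =
      (\<integral>\<^sup>+z. ennreal (b * P (a + b * \<xi> i \<omega>) (a + b * z) * indicator S (a + b * \<xi> i \<omega>) * indicator S (a + b * z)) *
        g (restrict_upto i (\<lambda>m. \<xi> m \<omega>), z) \<partial>lborel)"
    proof eventually_elim
      case (elim \<omega>)
      let ?w = "restrict_upto i (\<lambda>m. \<xi> m \<omega>)"
      have "X (t i) \<omega> \<in> S"
        using markov elim(2) t(1)[of i] by (auto simp: markov_process_def)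
      then have xS: "a + b * \<xi> i \<omega> \<in> S"
        by (simp only: elim(1))
      have gw[measurable]: "(\<lambda>z. g (?w, z)) \<in> borel_measurable borel"
        using measurable_Pair2[OF g, of ?w] by simp
      have m1: "(\<lambda>y. K (a + b * \<xi> i \<omega>) y * g (?w, (y - a) / b)) \<in> borel_measurable borel"
        by (rule borel_measurable_times_ennreal[OF K2 measurable_compose[OF _ gw]]) measurable
      have m2: "(\<lambda>z. K (a + b * \<xi> i \<omega>) (a + b * z) * g (?w, ((a + b * z) - a) / b)) \<in> borel_measurable borel"
        by (rule measurable_compose[OF _ m1]) measurable
      have "(\<integral>\<^sup>+y. ennreal (p (t i) (t (Suc i)) (X (t i) \<omega>) y) * indicator S y * g' (\<omega>, y) \<partial>lborel) =
        (\<integral>\<^sup>+y. K (a + b * \<xi> i \<omega>) y * g (?w, (y - a) / b) \<partial>lborel)"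
        using xS elim by (intro nn_integral_cong) (simp add: K_def P g'_def indicator_def)
      also have "\<dots> = ennreal \<bar>b\<bar> * (\<integral>\<^sup>+z. K (a + b * \<xi> i \<omega>) (a + b * z) * g (?w, ((a + b * z) - a) / b) \<partial>lborel)"
        using b m1 by (intro nn_integral_real_affine) auto
      also have "\<dots> = (\<integral>\<^sup>+z. ennreal \<bar>b\<bar> * (K (a + b * \<xi> i \<omega>) (a + b * z) * g (?w, ((a + b * z) - a) / b)) \<partial>lborel)"
        using m2 by (intro nn_integral_cmult[symmetric]) simp
      also have "\<dots> = (\<integral>\<^sup>+z. ennreal (b * P (a + b * \<xi> i \<omega>) (a + b * z) * indicator S (a + b * \<xi> i \<omega>) * indicator S (a + b * z)) *
        g (?w, z) \<partial>lborel)"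
        unfolding bK using b by (intro nn_integral_cong) (simp add: mult.assoc)
      finally show ?case .
    qed
  qed
  finally show "(\<integral>\<^sup>+\<omega>. g (restrict_upto i (\<lambda>m. \<xi> m \<omega>), \<xi> (Suc i) \<omega>) \<partial>M) = \<dots>" .
qed

section \<open>Tail bounds for the increments of the q-Ornstein--Uhlenbeck process\<close>

lemma inverse_square_tail_measurable:
  "(\<lambda>y. ennreal (c / (y - x)\<^sup>2) * indicator {y. r < \<bar>y - x\<bar>} y) \<in> borel_measurable borel" for c r x :: real
  by measurable

lemma nn_integral_inverse_square_tail:
  fixes c r x :: real
  assumes "0 \<le> c" "0 < r"
  shows "(\<integral>\<^sup>+y. ennreal (c / (y - x)\<^sup>2) * indicator {y. r < \<bar>y - x\<bar>} y \<partial>lborel) \<le> ennreal (2 * c / r)"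
proof -
  have right: "(\<integral>\<^sup>+y. ennreal (c / (y - x)\<^sup>2) * indicator {x + r..} y \<partial>lborel) = ennreal (c / r)"
  proof -
    have "(\<integral>\<^sup>+y. ennreal (c / (y - x)\<^sup>2) * indicator {x + r..} y \<partial>lborel) = ennreal (0 - (- c / ((x + r) - x)))"
    proof (rule nn_integral_FTC_atLeast)
      show "(\<lambda>y. c / (y - x)\<^sup>2) \<in> borel_measurable borel" by measurable
      fix y assume "x + r \<le> y"
      then show "((\<lambda>y. - c / (y - x)) has_real_derivative c / (y - x)\<^sup>2) (at y)"
        using assms by (auto intro!: derivative_eq_intros simp: power2_eq_square)
      show "0 \<le> c / (y - x)\<^sup>2"
        using assms by simp
    next
      have "filterlim (\<lambda>y. y - x) at_top at_top"
        using filterlim_tendsto_add_at_top[OF tendsto_const[of "- x"] filterlim_ident] by simp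
      then have "((\<lambda>y. - c / (y - x)) \<longlongrightarrow> 0) at_top"
        by (intro tendsto_divide_0[OF tendsto_const] filterlim_at_top_imp_at_infinity)
      then show "((\<lambda>y. - c / (y - x)) \<longlongrightarrow> 0) at_top" .
    qed
    then show ?thesis by simp
  qed
  have "(\<integral>\<^sup>+y. ennreal (c / (y - x)\<^sup>2) * indicator {..x - r} y \<partial>lborel) =
      ennreal \<bar>- 1\<bar> * (\<integral>\<^sup>+y. ennreal (c / ((2 * x + (- 1) * y) - x)\<^sup>2) * indicator {..x - r} (2 * x + (- 1) * y) \<partial>lborel)"
  proof (rule nn_integral_real_affine)
    show "(\<lambda>y. ennreal (c / (y - x)\<^sup>2) * indicator {..x - r} y) \<in> borel_measurable borel"
      by (intro borel_measurable_times_ennreal borel_measurable_indicator) auto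
  qed simp
  also have "\<dots> = (\<integral>\<^sup>+y. ennreal (c / (y - x)\<^sup>2) * indicator {x + r..} y \<partial>lborel)"
  proof -
    have "(2 * x + (- 1) * y - x)\<^sup>2 = (y - x)\<^sup>2" for y
      by (simp add: power2_eq_square algebra_simps)
    moreover have "indicator {..x - r} (2 * x + (- 1) * y) = (indicator {x + r..} y :: ennreal)" for y
      by (auto simp: indicator_def)
    ultimately show ?thesis by (simp only: abs_minus_cancel abs_one ennreal_1 mult_1)
  qed
  also note right
  finally have left: "(\<integral>\<^sup>+y. ennreal (c / (y - x)\<^sup>2) * indicator {..x - r} y \<partial>lborel) = ennreal (c / r)" .
  have "(\<integral>\<^sup>+y. ennreal (c / (y - x)\<^sup>2) * indicator {y. r < \<bar>y - x\<bar>} y \<partial>lborel) \<le>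
    (\<integral>\<^sup>+y. ennreal (c / (y - x)\<^sup>2) * indicator {x + r..} y + ennreal (c / (y - x)\<^sup>2) * indicator {..x - r} y \<partial>lborel)"
    by (intro nn_integral_mono) (auto simp: indicator_def)
  also have "\<dots> = ennreal (c / r) + ennreal (c / r)"
  proof -
    have "(\<lambda>y. ennreal (c / (y - x)\<^sup>2) * indicator {x + r..} y) \<in> borel_measurable lborel"
      "(\<lambda>y. ennreal (c / (y - x)\<^sup>2) * indicator {..x - r} y) \<in> borel_measurable lborel"
      by (intro borel_measurable_times_ennreal borel_measurable_indicator; simp)+
    then show ?thesis
      by (simp add: nn_integral_add left right)
  qed
  also have "\<dots> = ennreal (2 * c / r)"
    using assms by (simp flip: ennreal_plus)
  finally show ?thesis .
qed

text \<open>Integration of the bound \<open>C (t - s) / (x - y)\<^sup>2\<close> over \<open>|x - y| > r\<close>.\<close>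

lemma qou_increment_tail:
  fixes X :: "real \<Rightarrow> 'a \<Rightarrow> real"
  assumes q: "\<bar>q\<bar> < 1" and M: "prob_space M" and X: "\<And>t. 0 \<le> t \<Longrightarrow> X t \<in> borel_measurable M"
    and markov: "markov_process M X (qou_states q) (qou_transition q)"
  obtains C where "0 < C" "\<And>s t r A. 0 \<le> s \<Longrightarrow> s < t \<Longrightarrow> t \<le> s + 1 \<Longrightarrow> 0 < r \<Longrightarrow> A \<in> sets (past M X s) \<Longrightarrow>
    measure M (A \<inter> {\<omega> \<in> space M. r < \<bar>X t \<omega> - X s \<omega>\<bar>}) \<le> C * (t - s) / r * measure M A"
proof -
  interpret prob_space M by (rule M)
  obtain C where C: "0 < C" "\<And>s t x y. s < t \<Longrightarrow> t \<le> s + 1 \<Longrightarrow> x \<in> qou_states q \<Longrightarrow> y \<in> qou_states q \<Longrightarrow>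
    qou_transition q s t x y * (x - y)\<^sup>2 \<le> C * (t - s)"
    using qou_transition_le[OF q] by blast
  show ?thesis
  proof (rule that[of "2 * C"])
    fix s t r :: real and A
    assume st: "0 \<le> s" "s < t" "t \<le> s + 1" and r: "0 < r" and A[measurable]: "A \<in> sets (past M X s)"
    have sub: "subalgebra M (past M X s)"
      by (rule subalgebra_past[OF X])
    then have AM[measurable]: "A \<in> sets M"
      using A by (auto simp: subalgebra_def)
    have [measurable]: "X s \<in> borel_measurable (past M X s)"
      using st by (intro measurable_past[OF X]) auto
    have [measurable]: "X s \<in> borel_measurable M" "X t \<in> borel_measurable M"
      using X st by auto
    define g where "g = (\<lambda>(\<omega>, y). indicator A \<omega> * (if r < \<bar>y - X s \<omega>\<bar> then 1 else 0) :: ennreal)"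
    have g: "g \<in> borel_measurable (past M X s \<Otimes>\<^sub>M borel)"
      unfolding g_def by measurable
    have c: "0 \<le> C * (t - s)"
      using C st by simp
    have "emeasure M (A \<inter> {\<omega> \<in> space M. r < \<bar>X t \<omega> - X s \<omega>\<bar>}) =
        (\<integral>\<^sup>+\<omega>. indicator (A \<inter> {\<omega> \<in> space M. r < \<bar>X t \<omega> - X s \<omega>\<bar>}) \<omega> \<partial>M)"
      by (rule nn_integral_indicator[symmetric]) measurable
    also have "\<dots> = (\<integral>\<^sup>+\<omega>. g (\<omega>, X t \<omega>) \<partial>M)"
      by (intro nn_integral_cong) (auto simp: g_def indicator_def)
    also have "\<dots> = (\<integral>\<^sup>+\<omega>. \<integral>\<^sup>+y. ennreal (qou_transition q s t (X s \<omega>) y) * indicator (qou_states q) y * g (\<omega>, y) \<partial>lborel \<partial>M)"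
      by (rule markov_nn_integral[OF M X markov st(1,2) _ _ _ g])
        (use qou_transition_nonneg[OF q st(2)] qou_transition_measurable[OF q st(2)] in auto)
    also have "\<dots> \<le> (\<integral>\<^sup>+\<omega>. indicator A \<omega> * ennreal (2 * (C * (t - s)) / r) \<partial>M)"
    proof (rule nn_integral_mono)
      fix \<omega> assume \<omega>: "\<omega> \<in> space M"
      have xS: "X s \<omega> \<in> qou_states q"
        using markov \<omega> st by (auto simp: markov_process_def)
      have "(\<integral>\<^sup>+y. ennreal (qou_transition q s t (X s \<omega>) y) * indicator (qou_states q) y * g (\<omega>, y) \<partial>lborel) \<le>
        (\<integral>\<^sup>+y. indicator A \<omega> * (ennreal (C * (t - s) / (y - X s \<omega>)\<^sup>2) * indicator {y. r < \<bar>y - X s \<omega>\<bar>} y) \<partial>lborel)"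
      proof (rule nn_integral_mono)
        fix y
        show "ennreal (qou_transition q s t (X s \<omega>) y) * indicator (qou_states q) y * g (\<omega>, y) \<le>
          indicator A \<omega> * (ennreal (C * (t - s) / (y - X s \<omega>)\<^sup>2) * indicator {y. r < \<bar>y - X s \<omega>\<bar>} y)"
        proof (cases "y \<in> qou_states q \<and> r < \<bar>y - X s \<omega>\<bar>")
          case True
          then have "0 < (y - X s \<omega>)\<^sup>2"
            using r by auto
          then have "qou_transition q s t (X s \<omega>) y \<le> C * (t - s) / (y - X s \<omega>)\<^sup>2"
            using C(2)[OF st(2,3) xS, of y] True by (simp add: pos_le_divide_eq power2_commute)
          then show ?thesis
            using True by (auto simp: g_def indicator_def intro: ennreal_leI)
        qed (auto simp: g_def indicator_def)
      qed
      also have "\<dots> = indicator A \<omega> * (\<integral>\<^sup>+y. ennreal (C * (t - s) / (y - X s \<omega>)\<^sup>2) * indicator {y. r < \<bar>y - X s \<omega>\<bar>} y \<partial>lborel)"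
        by (rule nn_integral_cmult) (simp add: inverse_square_tail_measurable)
      also have "\<dots> \<le> indicator A \<omega> * ennreal (2 * (C * (t - s)) / r)"
        by (intro mult_left_mono nn_integral_inverse_square_tail c r) simp
      finally show "(\<integral>\<^sup>+y. ennreal (qou_transition q s t (X s \<omega>) y) * indicator (qou_states q) y * g (\<omega>, y) \<partial>lborel) \<le> \<dots>" .
    qed
    also have "\<dots> = ennreal (2 * (C * (t - s)) / r) * emeasure M A"
      by (simp add: nn_integral_multc mult.commute)
    also have "\<dots> = ennreal (2 * C * (t - s) / r * measure M A)"
      by (subst ennreal_mult') (use c r in \<open>auto simp: emeasure_eq_measure mult.assoc\<close>)
    finally show "measure M (A \<inter> {\<omega> \<in> space M. r < \<bar>X t \<omega> - X s \<omega>\<bar>}) \<le> 2 * C * (t - s) / r * measure M A"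
      unfolding emeasure_eq_measure using C(1) st r by (subst (asm) ennreal_le_iff) auto
  qed (use C in simp)
qed

section \<open>Control of the discretization error, uniformly in the scale\<close>

text \<open>The bad event is contained in a measurable set, namely that two large moves occur close to each
  other in one of the \<open>B\<close> blocks that matter for the time horizon \<open>1/\<delta>\<close>.\<close>

lemma (in small_increments) sample_coarsen_event:
  fixes B :: nat and \<delta> :: real
  assumes n: "0 < n" and l: "0 < l" "W = 2 * l" and \<delta>: "4 * \<rho> < \<delta>" "1 / n < \<delta>" "n / \<delta> < B"
  obtains E where "E \<in> sets M" "measure M E \<le> B * (4 * p\<^sup>2)"
    "\<And>\<omega>. \<omega> \<in> space M - E \<Longrightarrow> step_path (n * l) (\<lambda>i. \<xi> i \<omega>) \<in> skorohod_nbhd (step_path n (\<lambda>i. \<xi> (i * l) \<omega>)) \<delta>"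
proof -
  define D where "D k = {\<omega> \<in> space M. \<exists>j\<in>{k * l<..k * l + l}. \<omega> \<in> first_exit (k * l) (4 * \<rho>) j \<and>
    (\<exists>s\<in>{j..j + 2 * l}. 2 * \<rho> < \<bar>\<xi> s \<omega> - \<xi> j \<omega>\<bar>)}" for k
  have [measurable]: "D k \<in> sets M" for k
  proof -
    have "D k = (\<Union>j\<in>{k * l<..k * l + l}. first_exit (k * l) (4 * \<rho>) j \<inter>
        (\<Union>s\<in>{j..j + 2 * l}. {\<omega> \<in> space M. 2 * \<rho> < \<bar>\<xi> s \<omega> - \<xi> j \<omega>\<bar>}))"
      by (auto simp: D_def first_exit_def)
    also have "\<dots> \<in> sets M"
    proof (intro sets.finite_UN sets.Int)
      fix j assume "j \<in> {k * l<..k * l + l}"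
      then show "first_exit (k * l) (4 * \<rho>) j \<in> sets M"
        using first_exit_sets sets_G by auto
    qed auto
    finally show ?thesis .
  qed
  define E where "E = (\<Union>k<B. D k)"
  show ?thesis
  proof (rule that[of E])
    show "E \<in> sets M"
      unfolding E_def by auto
    have "measure M E \<le> (\<Sum>k<B. measure M (D k))"
      unfolding E_def by (intro finite_measure_subadditive_finite) auto
    also have "\<dots> \<le> (\<Sum>k<B. 4 * p\<^sup>2)"
      unfolding D_def using l by (intro sum_mono two_large_moves) auto
    finally show "measure M E \<le> B * (4 * p\<^sup>2)"
      by simp
    fix \<omega> assume \<omega>: "\<omega> \<in> space M - E"
    show "step_path (n * l) (\<lambda>i. \<xi> i \<omega>) \<in> skorohod_nbhd (step_path n (\<lambda>i. \<xi> (i * l) \<omega>)) \<delta>"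
    proof (rule step_path_coarsen[OF n l(1) \<delta>(1) \<rho> \<delta>(2,3)])
      fix k j s assume k: "k < B" and j: "k * l < j" "j \<le> (k + 1) * l" "4 * \<rho> < \<bar>\<xi> j \<omega> - \<xi> (k * l) \<omega>\<bar>"
        "\<And>i. k * l < i \<Longrightarrow> i < j \<Longrightarrow> \<bar>\<xi> i \<omega> - \<xi> (k * l) \<omega>\<bar> \<le> 4 * \<rho>" and s: "j \<le> s" "s \<le> j + 2 * l"
      have "\<omega> \<in> first_exit (k * l) (4 * \<rho>) j"
        using \<omega> j by (auto simp: first_exit_def)
      moreover have "j \<in> {k * l<..k * l + l}" "\<omega> \<notin> D k"
        using j \<omega> k by (auto simp: E_def)
      ultimately show "\<bar>\<xi> s \<omega> - \<xi> j \<omega>\<bar> \<le> 2 * \<rho>"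
        using \<omega> s unfolding D_def by (metis (mono_tags, lifting) DiffD1 atLeastAtMost_iff mem_Collect_eq not_less)
    qed
  qed
qed

lemma continuous_map_sample_LIMSEQ:
  fixes f :: "(real \<Rightarrow> real) \<Rightarrow> real"
  assumes f: "continuous_map skorohod euclideanreal f" and \<alpha>: "\<alpha> \<in> cadlag"
  shows "(\<lambda>n. f (step_path n (\<lambda>i. \<alpha> (i / n)))) \<longlonglongrightarrow> f \<alpha>"
proof (rule topological_tendstoI)
  fix U assume U: "open U" "f \<alpha> \<in> U"
  have "openin skorohod {\<beta> \<in> topspace skorohod. f \<beta> \<in> U}"
    using f U by (auto simp: continuous_map_def)
  moreover have "\<alpha> \<in> {\<beta> \<in> topspace skorohod. f \<beta> \<in> U}"
    using \<alpha> U by (simp add: topspace_skorohod)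
  ultimately obtain e where e: "0 < e" "skorohod_nbhd \<alpha> e \<subseteq> {\<beta> \<in> topspace skorohod. f \<beta> \<in> U}"
    unfolding openin_skorohod by blast
  show "\<forall>\<^sub>F n in sequentially. f (step_path n (\<lambda>i. \<alpha> (i / n))) \<in> U"
    using step_path_sample_tendsto[OF \<alpha> e(1)] by eventually_elim (use e in blast)
qed

lemma cadlag_rescale:
  assumes \<alpha>: "\<alpha> \<in> cadlag" and e: "0 < e"
  shows "(\<lambda>t\<in>{0..}. (\<alpha> (e * t) - a) / b) \<in> cadlag"
proof -
  let ?\<beta> = "\<lambda>t\<in>{0..}. (\<alpha> (e * t) - a) / b"
  have right: "filterlim (\<lambda>s. e * s) (at_right (e * t)) (at_right t)" for t
    unfolding filterlim_at using e
    by (auto intro!: tendsto_eq_intros simp: eventually_at_filter)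
  have left: "filterlim (\<lambda>s. e * s) (at_left (e * t)) (at_left t)" for t
    unfolding filterlim_at using e
    by (auto intro!: tendsto_eq_intros simp: eventually_at_filter)
  have "(?\<beta> \<longlongrightarrow> ?\<beta> t) (at_right t)" if t: "0 \<le> t" for t
  proof -
    have "(\<alpha> \<longlongrightarrow> \<alpha> (e * t)) (at_right (e * t))"
      using \<alpha> t e by (auto simp: cadlag_def continuous_within)
    from filterlim_compose[OF this right]
    have "((\<lambda>s. (\<alpha> (e * s) - a) / b) \<longlongrightarrow> (\<alpha> (e * t) - a) / b) (at_right t)"
      by (cases "b = 0") (auto intro!: tendsto_intros)
    also have "?this \<longleftrightarrow> (?\<beta> \<longlongrightarrow> (\<alpha> (e * t) - a) / b) (at_right t)"
      using t by (intro filterlim_cong) (auto simp: eventually_at_filter)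
    finally show ?thesis
      using t by simp
  qed
  moreover have "\<exists>L. (?\<beta> \<longlongrightarrow> L) (at_left t)" if t: "0 < t" for t
  proof -
    have "0 < e * t"
      using t e by simp
    then obtain L where "(\<alpha> \<longlongrightarrow> L) (at_left (e * t))"
      using \<alpha> unfolding cadlag_def by blast
    from filterlim_compose[OF this left]
    have "((\<lambda>s. (\<alpha> (e * s) - a) / b) \<longlongrightarrow> (L - a) / b) (at_left t)"
      by (cases "b = 0") (auto intro!: tendsto_intros)
    moreover have "\<forall>\<^sub>F s in at_left t. s \<in> {0<..<t}"
      using t by (rule eventually_at_left_real)
    then have "\<forall>\<^sub>F s in at_left t. (\<alpha> (e * s) - a) / b = ?\<beta> s"
      by eventually_elim auto
    ultimately have "(?\<beta> \<longlongrightarrow> (L - a) / b) (at_left t)"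
      by (rule Lim_transform_eventually)
    then show ?thesis ..
  qed
  ultimately show ?thesis
    unfolding cadlag_def continuous_within by auto
qed

abbreviation (input) zoom :: "(real \<Rightarrow> 'a \<Rightarrow> real) \<Rightarrow> real \<Rightarrow> real \<Rightarrow> 'a \<Rightarrow> real" where
  "zoom X e \<equiv> \<lambda>t \<omega>. (X (e * t) \<omega> - X 0 \<omega>) / e"

lemma rescaled_trajectory:
  assumes "cadlag_process M X" "0 < e"
  shows "\<omega> \<in> space M \<Longrightarrow> trajectory (zoom X e) \<omega> \<in> cadlag"
    and "trajectory (zoom X e) \<in> M \<rightarrow>\<^sub>M borel_sets_of skorohod"
proof -
  show cad: "trajectory (zoom X e) \<omega> \<in> cadlag" if "\<omega> \<in> space M" for \<omega>
  proof -
    have "trajectory X \<omega> \<in> cadlag"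
      using assms that by (simp add: cadlag_process_def)
    from cadlag_rescale[OF this assms(2), of "X 0 \<omega>" e]
    have "(\<lambda>t\<in>{0..}. (trajectory X \<omega> (e * t) - X 0 \<omega>) / e) \<in> cadlag" .
    also have "(\<lambda>t\<in>{0..}. (trajectory X \<omega> (e * t) - X 0 \<omega>) / e) = trajectory (zoom X e) \<omega>"
      using assms(2) by (auto simp: trajectory_def)
    finally show ?thesis .
  qed
  have "X t \<in> borel_measurable M" if "0 \<le> t" for t
    using assms that by (simp add: cadlag_process_def)
  then have "(zoom X e t) \<in> borel_measurable M" if "0 \<le> t" for t
    using that assms(2) by (intro borel_measurable_divide borel_measurable_diff) auto
  then show "trajectory (zoom X e) \<in> M \<rightarrow>\<^sub>M borel_sets_of skorohod"
    by (rule trajectory_measurable) (use cad in auto)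
qed

lemma scaled_trajectory:
  assumes "cadlag_process N Z" "c \<noteq> 0"
  shows "\<omega> \<in> space N \<Longrightarrow> trajectory (\<lambda>t \<omega>. c * Z t \<omega>) \<omega> \<in> cadlag"
    and "trajectory (\<lambda>t \<omega>. c * Z t \<omega>) \<in> N \<rightarrow>\<^sub>M borel_sets_of skorohod"
proof -
  show cad: "trajectory (\<lambda>t \<omega>. c * Z t \<omega>) \<omega> \<in> cadlag" if "\<omega> \<in> space N" for \<omega>
  proof -
    have "trajectory Z \<omega> \<in> cadlag"
      using assms that by (simp add: cadlag_process_def)
    from cadlag_rescale[OF this, of 1 0 "1 / c"]
    have "(\<lambda>t\<in>{0..}. (trajectory Z \<omega> (1 * t) - 0) / (1 / c)) \<in> cadlag" by simp
    also have "(\<lambda>t\<in>{0..}. (trajectory Z \<omega> (1 * t) - 0) / (1 / c)) = trajectory (\<lambda>t \<omega>. c * Z t \<omega>) \<omega>"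
      by (auto simp: trajectory_def)
    finally show ?thesis .
  qed
  have "Z t \<in> borel_measurable N" if "0 \<le> t" for t
    using assms that by (simp add: cadlag_process_def)
  then show "trajectory (\<lambda>t \<omega>. c * Z t \<omega>) \<in> N \<rightarrow>\<^sub>M borel_sets_of skorohod"
    by (intro trajectory_measurable borel_measurable_times measurable_const) (use cad in auto)
qed

text \<open>In each of the \<open>O(n)\<close> blocks two large moves have probability \<open>O(n\<^sup>-\<^sup>2)\<close>, for all scales \<open>\<epsilon>\<close> at
  once, since the tail bound for increments is invariant under scaling time and space by \<open>\<epsilon>\<close>.  The
  argument compares with samples on a finer grid, whose first exits are events at finitely many
  times; the finer grid is then removed by a limit.\<close>

lemma qou_sample_error:
  fixes X :: "real \<Rightarrow> 'a \<Rightarrow> real" and f :: "(real \<Rightarrow> real) \<Rightarrow> real"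
  assumes q: "\<bar>q\<bar> < 1" and cad: "cadlag_process M X"
    and markov: "markov_process M X (qou_states q) (qou_transition q)"
    and f: "continuous_map skorohod euclideanreal f" and K: "\<And>\<alpha>. \<alpha> \<in> cadlag \<Longrightarrow> f \<alpha> \<in> {0..K}"
  obtains C where "0 < C"
    "\<And>\<epsilon> n \<delta>. 0 < \<epsilon> \<Longrightarrow> \<epsilon> \<le> 1 / 2 \<Longrightarrow> 0 < n \<Longrightarrow> 0 < \<delta> \<Longrightarrow> 1 / real n < \<delta> \<Longrightarrow> C / \<delta> / n \<le> 1 / 2 \<Longrightarrow>
      (\<integral>\<^sup>+\<omega>. sample_inf (\<lambda>\<beta>. ennreal (f \<beta>)) n \<delta> (\<lambda>i. zoom X \<epsilon> (i / n) \<omega>) \<partial>M) \<le>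
      (\<integral>\<^sup>+\<omega>. ennreal (f (trajectory (zoom X \<epsilon>) \<omega>)) \<partial>M) +
        ennreal (K * ((n / \<delta> + 2) * (4 * (C / \<delta> / n)\<^sup>2)))"
proof -
  have M: "prob_space M" and X: "\<And>t. 0 \<le> t \<Longrightarrow> X t \<in> borel_measurable M"
    using cad by (auto simp: cadlag_process_def)
  interpret prob_space M by (rule M)
  obtain C where C: "0 < C" "\<And>s t r A. 0 \<le> s \<Longrightarrow> s < t \<Longrightarrow> t \<le> s + 1 \<Longrightarrow> 0 < r \<Longrightarrow> A \<in> sets (past M X s) \<Longrightarrow>
    measure M (A \<inter> {\<omega> \<in> space M. r < \<bar>X t \<omega> - X s \<omega>\<bar>}) \<le> C * (t - s) / r * measure M A"
    using qou_increment_tail[OF q M X markov] by blast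
  have K0: "0 \<le> K"
    using K[OF step_path_cadlag[of 1 "\<lambda>_. 0"]] by auto
  show ?thesis
  proof (rule that[of "16 * C"])
    fix \<epsilon> \<delta> :: real and n :: nat
    assume \<epsilon>: "0 < \<epsilon>" "\<epsilon> \<le> 1 / 2" and n: "0 < n" and \<delta>: "0 < \<delta>" "1 / n < \<delta>" and p2: "16 * C / \<delta> / n \<le> 1 / 2"
    \<comment> \<open>\<open>4 \<rho> < \<delta>\<close> is what the time change needs; \<open>p = C (2/n) / \<rho>\<close> bounds the tail of an
      increment over two blocks\<close>
    define \<rho> where "\<rho> = \<delta> / 8"
    define p where "p = 16 * C / \<delta> / n"
    define B where "B = nat \<lceil>n / \<delta>\<rceil> + 1"
    define Y where "Y t \<omega> = (X (\<epsilon> * t) \<omega> - X 0 \<omega>) / \<epsilon>" for t \<omega>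
    let ?F = "\<lambda>\<beta>. ennreal (f \<beta>)"
    let ?s = "\<lambda>\<omega>. sample_inf ?F n \<delta> (\<lambda>i. Y (i / n) \<omega>)"
    have B: "n / \<delta> < B" "real B \<le> n / \<delta> + 2"
      using \<delta>(1) unfolding B_def by (simp_all add: le_of_int_ceiling) linarith+
    have YM: "Y t \<in> borel_measurable M" if "0 \<le> t" for t
      unfolding Y_def using that \<epsilon> X[of "\<epsilon> * t"] X[of 0] by simp
    have fm: "f \<in> borel_measurable (borel_sets_of skorohod)"
      by (rule continuous_map_borel_measurable[OF f])
    have stepM: "(\<lambda>\<omega>. ?F (step_path m (\<lambda>i. Y (i / m) \<omega>))) \<in> borel_measurable M" if "0 < m" for m :: nat
      using that YM by (intro measurable_compose[OF step_path_measurable[OF that] measurable_compose[OF fm measurable_ennreal]]) auto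
    have main: "(\<integral>\<^sup>+\<omega>. ?s \<omega> \<partial>M) \<le> (\<integral>\<^sup>+\<omega>. ?F (step_path (n * l) (\<lambda>i. Y (i / (n * l)) \<omega>)) \<partial>M) + ennreal (K * (B * (4 * p\<^sup>2)))"
      if l: "0 < l" for l
    proof -
      define h where "h i = \<epsilon> * (real i / real (n * l))" for i :: nat
      have nl: "0 < real (n * l)"
        using n l by simp
      have h: "0 \<le> h i" "i \<le> j \<Longrightarrow> h i \<le> h j" "i < j \<Longrightarrow> h i < h j" for i j
        using \<epsilon> nl unfolding h_def by (auto intro!: mult_left_mono divide_right_mono mult_strict_left_mono divide_strict_right_mono)
      interpret small_increments M "\<lambda>i. Y (i / (n * l))" "\<lambda>i. past M X (h i)" "2 * l" \<rho> p
      proof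
        show "subalgebra M (past M X (h i))" for i
          by (rule subalgebra_past[OF X])
        show "Y (real i / real (n * l)) \<in> borel_measurable (past M X (h j))" if "i \<le> j" for i j
        proof -
          have "X (h i) \<in> borel_measurable (past M X (h j))" "X 0 \<in> borel_measurable (past M X (h j))"
            using h that by (auto intro: measurable_past[OF X])
          then show ?thesis
            unfolding Y_def h_def[symmetric] by measurable
        qed
        show "sets (past M X (h i)) \<subseteq> sets (past M X (h j))" if "i \<le> j" for i j
          using h that by (intro past_mono[OF X])
        show "0 \<le> p" "p \<le> 1 / 2" "0 < \<rho>"
          using C \<delta> p2 by (auto simp: p_def \<rho>_def)
        fix i j A assume ij: "i < j" "j \<le> i + 2 * l" and A: "A \<in> sets (past M X (h i))"
        have "h j - h i = \<epsilon> * ((real j - real i) / real (n * l))"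
          by (simp add: h_def right_diff_distrib diff_divide_distrib)
        also have "(real j - real i) / real (n * l) \<le> (2 * l) / real (n * l)"
          using ij by (intro divide_right_mono) linarith+
        also have "(2 * l) / real (n * l) = 2 / n"
          using l by simp
        finally have hd: "h j - h i \<le> \<epsilon> * (2 / n)"
          using \<epsilon> by (simp add: mult_left_mono)
        have "2 / real n \<le> 2"
          using n by (simp add: field_simps)
        then have "\<epsilon> * (2 / n) \<le> 1 / 2 * 2"
          using \<epsilon> by (intro mult_mono) auto
        then have h1: "h j \<le> h i + 1"
          using hd by linarith
        have "A \<inter> {\<omega> \<in> space M. \<rho> < \<bar>Y (real j / real (n * l)) \<omega> - Y (real i / real (n * l)) \<omega>\<bar>} =
            A \<inter> {\<omega> \<in> space M. \<epsilon> * \<rho> < \<bar>X (h j) \<omega> - X (h i) \<omega>\<bar>}"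
        proof -
          have "\<rho> < \<bar>Y (real j / real (n * l)) \<omega> - Y (real i / real (n * l)) \<omega>\<bar> \<longleftrightarrow> \<epsilon> * \<rho> < \<bar>X (h j) \<omega> - X (h i) \<omega>\<bar>" for \<omega>
          proof -
            have *: "Y (real j / real (n * l)) \<omega> - Y (real i / real (n * l)) \<omega> = (X (h j) \<omega> - X (h i) \<omega>) / \<epsilon>"
              unfolding Y_def h_def[symmetric] by (simp add: diff_divide_distrib)
            show ?thesis
              unfolding * abs_divide using \<epsilon> by (simp add: pos_less_divide_eq mult.commute)
          qed
          then show ?thesis by simp
        qed
        also have "measure M \<dots> \<le> C * (h j - h i) / (\<epsilon> * \<rho>) * measure M A"
          using ij h h1 A \<epsilon> \<delta> by (intro C(2)) (auto simp: \<rho>_def)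
        also have "\<dots> \<le> p * measure M A"
        proof (rule mult_right_mono)
          have "C * (h j - h i) / (\<epsilon> * \<rho>) \<le> C * (\<epsilon> * (2 / n)) / (\<epsilon> * \<rho>)"
            using C hd \<epsilon> \<delta> by (intro divide_right_mono mult_left_mono) (auto simp: \<rho>_def)
          also have "\<dots> = p"
            using \<epsilon> \<delta> n by (simp add: p_def \<rho>_def field_simps)
          finally show "C * (h j - h i) / (\<epsilon> * \<rho>) \<le> p" .
        qed simp
        finally show "measure M (A \<inter> {\<omega> \<in> space M. \<rho> < \<bar>Y (real j / real (n * l)) \<omega> - Y (real i / real (n * l)) \<omega>\<bar>}) \<le> p * measure M A" .
      qed
      obtain E where E: "E \<in> sets M" "measure M E \<le> B * (4 * p\<^sup>2)"
        "\<And>\<omega>. \<omega> \<in> space M - E \<Longrightarrow> step_path (n * l) (\<lambda>i. Y (i / (n * l)) \<omega>) \<in>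
          skorohod_nbhd (step_path n (\<lambda>i. Y (real (i * l) / (n * l)) \<omega>)) \<delta>"
        using sample_coarsen_event[OF n l refl _ \<delta>(2) B(1)] \<delta> by (auto simp: \<rho>_def)
      have "?s \<omega> \<le> ?F (step_path (n * l) (\<lambda>i. Y (i / (n * l)) \<omega>)) + ennreal K * indicator E \<omega>" if \<omega>: "\<omega> \<in> space M" for \<omega>
      proof (cases "\<omega> \<in> E")
        case True
        have "?s \<omega> \<le> ?F (step_path n (\<lambda>i. Y (i / n) \<omega>))"
          using \<delta> n by (intro sample_inf_le skorohod_nbhd_refl step_path_cadlag) auto
        also have "\<dots> \<le> ennreal K"
          using K[OF step_path_cadlag[OF n]] by (intro ennreal_leI) auto
        finally show ?thesis
          using True by (simp add: add_increasing)
      next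
        case False
        have "real (i * l) / real (n * l) = i / n" for i
          using l by simp
        then have "?s \<omega> \<le> ?F (step_path (n * l) (\<lambda>i. Y (i / (n * l)) \<omega>))"
          using E(3)[of \<omega>] False \<omega> \<delta> by (intro sample_inf_le) auto
        then show ?thesis
          by (simp add: add_increasing2)
      qed
      then have "(\<integral>\<^sup>+\<omega>. ?s \<omega> \<partial>M) \<le> (\<integral>\<^sup>+\<omega>. ?F (step_path (n * l) (\<lambda>i. Y (i / (n * l)) \<omega>)) + ennreal K * indicator E \<omega> \<partial>M)"
        by (rule nn_integral_mono)
      also have "\<dots> = (\<integral>\<^sup>+\<omega>. ?F (step_path (n * l) (\<lambda>i. Y (i / (n * l)) \<omega>)) \<partial>M) + ennreal K * emeasure M E"
        using stepM[of "n * l"] n l E(1) by (simp add: nn_integral_add nn_integral_cmult_indicator)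
      also have "ennreal K * emeasure M E = ennreal (K * measure M E)"
        using K0 by (simp add: emeasure_eq_measure ennreal_mult')
      also have "ennreal (K * measure M E) \<le> ennreal (K * (B * (4 * p\<^sup>2)))"
        using E(2) K0 by (intro ennreal_leI mult_left_mono)
      finally show ?thesis
        by (simp add: add_left_mono)
    qed
    have traj: "trajectory Y \<omega> \<in> cadlag" if "\<omega> \<in> space M" for \<omega>
      unfolding Y_def[abs_def] using rescaled_trajectory(1)[OF cad \<epsilon>(1) that] .
    have lim: "(\<lambda>l. \<integral>\<^sup>+\<omega>. ?F (step_path (n * Suc l) (\<lambda>i. Y (i / (n * Suc l)) \<omega>)) \<partial>M) \<longlonglongrightarrow> (\<integral>\<^sup>+\<omega>. ?F (trajectory Y \<omega>) \<partial>M)"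
    proof (rule nn_integral_dominated_convergence[where w = "\<lambda>_. ennreal K"])
      show "(\<lambda>\<omega>. ?F (step_path (n * Suc l) (\<lambda>i. Y (i / (n * Suc l)) \<omega>))) \<in> borel_measurable M" for l
        using n by (intro stepM) simp
      show "(\<lambda>\<omega>. ?F (trajectory Y \<omega>)) \<in> borel_measurable M"
        using YM traj by (intro measurable_compose[OF trajectory_measurable measurable_compose[OF fm measurable_ennreal]]) auto
      show "AE \<omega> in M. ?F (step_path (n * Suc l) (\<lambda>i. Y (i / (n * Suc l)) \<omega>)) \<le> ennreal K" for l
        using K[OF step_path_cadlag] n by (intro AE_I2 ennreal_leI) auto
      show "AE \<omega> in M. (\<lambda>l. ?F (step_path (n * Suc l) (\<lambda>i. Y (i / (n * Suc l)) \<omega>))) \<longlonglongrightarrow> ?F (trajectory Y \<omega>)"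
      proof (rule AE_I2)
        fix \<omega> assume "\<omega> \<in> space M"
        from continuous_map_sample_LIMSEQ[OF f traj[OF this]]
        have "(\<lambda>m. f (step_path m (\<lambda>i. Y (i / m) \<omega>))) \<longlonglongrightarrow> f (trajectory Y \<omega>)"
          by (simp add: trajectory_def)
        moreover have "strict_mono (\<lambda>l. n * Suc l)"
          using n by (auto simp: strict_mono_def)
        ultimately have "((\<lambda>m. f (step_path m (\<lambda>i. Y (i / m) \<omega>))) \<circ> (\<lambda>l. n * Suc l)) \<longlonglongrightarrow> f (trajectory Y \<omega>)"
          by (rule LIMSEQ_subseq_LIMSEQ)
        then show "(\<lambda>l. ?F (step_path (n * Suc l) (\<lambda>i. Y (i / (n * Suc l)) \<omega>))) \<longlonglongrightarrow> ?F (trajectory Y \<omega>)"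
          unfolding o_def by (rule tendsto_ennrealI)
      qed
    qed (simp_all add: emeasure_space_1)
    have "(\<integral>\<^sup>+\<omega>. ?s \<omega> \<partial>M) \<le> (\<integral>\<^sup>+\<omega>. ?F (trajectory Y \<omega>) \<partial>M) + ennreal (K * (B * (4 * p\<^sup>2)))"
      by (rule LIMSEQ_le_const[OF tendsto_add[OF lim tendsto_const]]) (use main in blast)
    also have "ennreal (K * (B * (4 * p\<^sup>2))) \<le> ennreal (K * ((n / \<delta> + 2) * (4 * p\<^sup>2)))"
      using B(2) K0 by (intro ennreal_leI mult_left_mono mult_right_mono) auto
    finally show "(\<integral>\<^sup>+\<omega>. sample_inf ?F n \<delta> (\<lambda>i. zoom X \<epsilon> (i / n) \<omega>) \<partial>M) \<le>
      (\<integral>\<^sup>+\<omega>. ?F (trajectory (zoom X \<epsilon>) \<omega>) \<partial>M) +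
        ennreal (K * ((n / \<delta> + 2) * (4 * (16 * C / \<delta> / n)\<^sup>2)))"
      unfolding Y_def[abs_def] p_def by (simp add: add_left_mono)
  qed (use C in simp)
qed

section \<open>Convergence to the Cauchy process\<close>

text \<open>This is the density that \<open>qou_transition_scaling_limit\<close> produces: \<open>c Z\<close> is the standard Cauchy
  process run at speed \<open>c\<close>.\<close>

lemma cauchy_step_density:
  assumes Z: "cauchy_process N Z" and c: "0 < c" and d: "0 < d"
  shows "has_step_density N (\<lambda>i \<omega>. c * Z (i * d) \<omega>) (\<lambda>y z. 1 / pi * (c * d / ((z - y)\<^sup>2 + (c * d)\<^sup>2)))"
proof -
  have cad: "cadlag_process N Z" and markov: "markov_process N Z UNIV cauchy_transition"
    using Z by (auto simp: cauchy_process_def levy_process_def)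
  then have N: "prob_space N" and ZM: "\<And>t. 0 \<le> t \<Longrightarrow> Z t \<in> borel_measurable N"
    by (auto simp: cadlag_process_def)
  have "has_step_density N (\<lambda>i \<omega>. c * Z (i * d) \<omega>) (\<lambda>y z. (1 / c) * cauchy_transition 0 d (0 + (1 / c) * y) (0 + (1 / c) * z) *
      indicator UNIV (0 + (1 / c) * y) * indicator UNIV (0 + (1 / c) * z))"
  proof (rule markov_has_step_density[OF N ZM markov])
    show "cauchy_transition (real i * d) (real (Suc i) * d) = cauchy_transition 0 d" for i
      by (intro ext) (simp add: cauchy_transition_def algebra_simps)
    show "(\<lambda>(x, y). cauchy_transition 0 d x y * indicator UNIV x * indicator UNIV y) \<in> borel_measurable (borel \<Otimes>\<^sub>M borel)"
      unfolding cauchy_transition_def by measurable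
    show "(\<lambda>\<omega>. c * Z (real i * d) \<omega>) \<in> borel_measurable (past N Z (real i * d))" for i
      using d by (intro borel_measurable_times measurable_const measurable_past[OF ZM]) auto
  qed (use c d in \<open>auto simp: cauchy_transition_def intro!: mult_nonneg_nonneg divide_nonneg_nonneg\<close>)
  moreover have "(1 / c) * cauchy_transition 0 d (0 + (1 / c) * y) (0 + (1 / c) * z) *
      indicator UNIV (0 + (1 / c) * y) * indicator UNIV (0 + (1 / c) * z) = 1 / pi * (c * d / ((z - y)\<^sup>2 + (c * d)\<^sup>2))" for y z
  proof -
    have "(1 / c * z - 1 / c * y)\<^sup>2 + d\<^sup>2 = ((z - y)\<^sup>2 + (c * d)\<^sup>2) / c\<^sup>2"
      using c by (simp add: field_simps power2_eq_square)
    then show ?thesis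
      using c by (simp add: cauchy_transition_def power2_eq_square)
  qed
  ultimately show ?thesis by simp
qed

lemma qou_step_density:
  assumes q: "\<bar>q\<bar> < 1" and X: "qou_process_from q x M X" and e: "0 < e" and d: "0 < d"
  shows "has_step_density M (\<lambda>i. zoom X e (i * d))
    (\<lambda>y z. e * qou_transition q 0 (e * d) (x + e * y) (x + e * z) * indicator (qou_states q) (x + e * y) * indicator (qou_states q) (x + e * z))"
proof -
  have cad: "cadlag_process M X" and markov: "markov_process M X (qou_states q) (qou_transition q)"
    and init: "AE \<omega> in M. X 0 \<omega> = x"
    using X by (auto simp: qou_process_from_def)
  then have M: "prob_space M" and XM: "\<And>t. 0 \<le> t \<Longrightarrow> X t \<in> borel_measurable M"
    by (auto simp: cadlag_process_def)
  have ed: "0 < e * d"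
    using e d by simp
  show ?thesis
  proof (rule markov_has_step_density[OF M XM markov, where t = "\<lambda>i. e * (real i * d)"])
    show "qou_transition q (e * (real i * d)) (e * (real (Suc i) * d)) = qou_transition q 0 (e * d)" for i
      by (intro ext) (simp add: qou_transition_def algebra_simps)
    show "0 \<le> qou_transition q 0 (e * d) x y" if "x \<in> qou_states q" "y \<in> qou_states q" for x y
      using qou_transition_nonneg[OF q ed] that by simp
    show "(\<lambda>(x, y). qou_transition q 0 (e * d) x y * indicator (qou_states q) x * indicator (qou_states q) y)
        \<in> borel_measurable (borel \<Otimes>\<^sub>M borel)"
      using qou_transition_measurable[OF q ed] by simp
    show "(\<lambda>\<omega>. (X (e * (real i * d)) \<omega> - X 0 \<omega>) / e) \<in> borel_measurable (past M X (e * (real i * d)))" for i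
      using e d by (intro borel_measurable_divide borel_measurable_diff measurable_const measurable_past[OF XM]) auto
    show "AE \<omega> in M. X (e * (real i * d)) \<omega> = x + e * ((X (e * (real i * d)) \<omega> - X 0 \<omega>) / e)" for i
      using init by eventually_elim (use e in simp)
    show "e * (real i * d) < e * (real (Suc i) * d)" for i
      using e d by simp
  qed (use e d in auto)
qed

lemma sample_error_tendsto_0:
  fixes K C \<delta> :: real
  shows "(\<lambda>n. ennreal (K * ((real n / \<delta> + 2) * (4 * (C / \<delta> / n)\<^sup>2)))) \<longlonglongrightarrow> 0"
proof -
  have "(\<lambda>n. K * 4 * (C / \<delta>)\<^sup>2 * (1 / \<delta> * (1 / real n) + 2 * (1 / real n)\<^sup>2)) \<longlonglongrightarrow> K * 4 * (C / \<delta>)\<^sup>2 * (1 / \<delta> * 0 + 2 * 0\<^sup>2)"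
    by (intro tendsto_intros lim_1_over_n)
  also have "(\<lambda>n. K * 4 * (C / \<delta>)\<^sup>2 * (1 / \<delta> * (1 / real n) + 2 * (1 / real n)\<^sup>2)) =
      (\<lambda>n. K * ((real n / \<delta> + 2) * (4 * (C / \<delta> / n)\<^sup>2)))"
  proof
    show "K * 4 * (C / \<delta>)\<^sup>2 * (1 / \<delta> * (1 / real n) + 2 * (1 / real n)\<^sup>2) =
      K * ((real n / \<delta> + 2) * (4 * (C / \<delta> / n)\<^sup>2))" for n
      by (cases "n = 0") (simp_all add: power_divide power2_eq_square field_simps)
  qed
  finally have "(\<lambda>n. K * ((real n / \<delta> + 2) * (4 * (C / \<delta> / n)\<^sup>2))) \<longlonglongrightarrow> 0"
    by simp
  from tendsto_ennrealI[OF this] show ?thesis by simp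
qed

text \<open>For fixed \<open>\<delta>\<close> and \<open>n\<close>, the convergence of finite-dimensional distributions compares the lower
  approximations \<open>sample_inf\<close> of the two processes, and the one for \<open>Y\<^sup>\<epsilon>\<close> is below \<open>f\<close> up to the
  sampling error.  Fatou's lemma for the limit process takes care of \<open>n \<rightarrow> \<infinity>\<close> and then \<open>\<delta> \<rightarrow> 0\<close>.\<close>

lemma qou_liminf:
  fixes X :: "real \<Rightarrow> 'a \<Rightarrow> real" and Z :: "real \<Rightarrow> 'b \<Rightarrow> real" and f :: "(real \<Rightarrow> real) \<Rightarrow> real"
  assumes q: "\<bar>q\<bar> < 1" and x: "x \<in> {- 2 / sqrt (1 - q) <..< 2 / sqrt (1 - q)}"
    and X: "qou_process_from q x M X" and Z: "cauchy_process N Z"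
    and e: "\<And>j. 0 < e j" "e \<longlonglongrightarrow> 0"
    and f: "continuous_map skorohod euclideanreal f" and K: "\<And>\<alpha>. \<alpha> \<in> cadlag \<Longrightarrow> f \<alpha> \<in> {0..K}"
  shows "(\<integral>\<^sup>+\<omega>. ennreal (f (trajectory (\<lambda>t \<omega>. sqrt (4 / (1 - q) - x\<^sup>2) * Z t \<omega>) \<omega>)) \<partial>N) \<le>
    liminf (\<lambda>j. \<integral>\<^sup>+\<omega>. ennreal (f (trajectory (zoom X (e j)) \<omega>)) \<partial>M)"
    (is "_ \<le> ?A")
proof -
  define c where "c = sqrt (4 / (1 - q) - x\<^sup>2)"
  have c: "0 < c"
    unfolding c_def using q x by (intro qou_speed_pos) auto
  have cadX: "cadlag_process M X" and markov: "markov_process M X (qou_states q) (qou_transition q)"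
    using X by (auto simp: qou_process_from_def)
  have cadZ: "cadlag_process N Z" and Z0: "AE \<omega> in N. Z 0 \<omega> = 0"
    using Z by (auto simp: cauchy_process_def levy_process_def)
  have M: "prob_space M" and N: "prob_space N" and ZM: "\<And>t. 0 \<le> t \<Longrightarrow> Z t \<in> borel_measurable N"
    using cadX cadZ by (auto simp: cadlag_process_def)
  let ?F = "\<lambda>\<beta>. ennreal (f \<beta>)"
  let ?\<delta> = "\<lambda>k::nat. 1 / (real k + 4)"
  let ?S = "\<lambda>k n \<omega>. sample_inf ?F n (?\<delta> k) (\<lambda>i. c * Z (i / n) \<omega>)"
  have SM[measurable]: "?S k n \<in> borel_measurable N" for k n
    by (intro measurable_compose[OF measurable_coordinatewise_then_product sample_inf_measurable]
        borel_measurable_times measurable_const ZM) auto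
  obtain C where C: "0 < C"
    "\<And>\<epsilon> n \<delta>. 0 < \<epsilon> \<Longrightarrow> \<epsilon> \<le> 1 / 2 \<Longrightarrow> 0 < n \<Longrightarrow> 0 < \<delta> \<Longrightarrow> 1 / real n < \<delta> \<Longrightarrow> C / \<delta> / n \<le> 1 / 2 \<Longrightarrow>
      (\<integral>\<^sup>+\<omega>. sample_inf ?F n \<delta> (\<lambda>i. zoom X \<epsilon> (i / n) \<omega>) \<partial>M) \<le>
      (\<integral>\<^sup>+\<omega>. ?F (trajectory (zoom X \<epsilon>) \<omega>) \<partial>M) +
        ennreal (K * ((n / \<delta> + 2) * (4 * (C / \<delta> / n)\<^sup>2)))"
    using qou_sample_error[OF q cadX markov f K] by blast
  have e_small: "\<forall>\<^sub>F j in sequentially. e j \<le> 1 / 2"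
    using order_tendstoD(2)[OF e(2), of "1 / 2"] by (auto elim: eventually_mono)

  have fdd: "(\<integral>\<^sup>+\<omega>. ?S k n \<omega> \<partial>N) \<le>
      liminf (\<lambda>j. \<integral>\<^sup>+\<omega>. sample_inf ?F n (?\<delta> k) (\<lambda>i. zoom X (e j) (i / n) \<omega>) \<partial>M)" if n: "0 < n" for k n
  proof -
    define d where "d = 1 / real n"
    have d: "0 < d"
      using n by (simp add: d_def)
    \<comment> \<open>the index of the last sample on which the lower approximation can depend\<close>
    define L where "L = nat \<lceil>n / ?\<delta> k\<rceil>"
    have L: "sample_inf ?F n (?\<delta> k) v = sample_inf ?F n (?\<delta> k) (restrict_upto L v)" for v
    proof (rule sample_inf_cong)
      fix i assume "real i \<le> real n / ?\<delta> k"
      then have "i \<le> L"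
        unfolding L_def by linarith
      then show "v i = restrict_upto L v i"
        by (simp add: restrict_upto_def)
    qed
    have "(\<integral>\<^sup>+\<omega>. liminf (\<lambda>j. sample_inf ?F n (?\<delta> k) (restrict_upto L (\<lambda>i. c * Z (i * d) \<omega>))) \<partial>N) \<le>
      liminf (\<lambda>j. \<integral>\<^sup>+\<omega>. sample_inf ?F n (?\<delta> k) (restrict_upto L (\<lambda>i. zoom X (e j) (i * d) \<omega>)) \<partial>M)"
    proof (rule step_density_liminf[OF N M cauchy_step_density[OF Z c d] qou_step_density[OF q X e(1) d]])
      show "(\<lambda>j. e j * qou_transition q 0 (e j * d) (x + e j * y) (x + e j * z) *
          indicator (qou_states q) (x + e j * y) * indicator (qou_states q) (x + e j * z))
          \<longlonglongrightarrow> 1 / pi * (c * d / ((z - y)\<^sup>2 + (c * d)\<^sup>2))" for y z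
        using qou_transition_scaling_limit[OF q x d e, of "\<lambda>j. e j * d" "\<lambda>_. 0" y z] by (simp add: c_def)
      show "AE \<omega> in N. c * Z (real 0 * d) \<omega> = 0"
        using Z0 by eventually_elim simp
    qed auto
    moreover have "i * d = i / n" for i :: nat
      by (simp add: d_def)
    ultimately show ?thesis
      by (simp add: L[symmetric] Liminf_const)
  qed
  have level: "(\<integral>\<^sup>+\<omega>. liminf (\<lambda>n. ?S k n \<omega>) \<partial>N) \<le> ?A" for k
  proof -
    let ?r = "\<lambda>n::nat. ennreal (K * ((n / ?\<delta> k + 2) * (4 * (C / ?\<delta> k / n)\<^sup>2)))"
    have "(\<lambda>n. C / ?\<delta> k * (1 / real n)) \<longlonglongrightarrow> C / ?\<delta> k * 0"
      by (intro tendsto_intros lim_1_over_n)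
    then have "(\<lambda>n. C / ?\<delta> k / real n) \<longlonglongrightarrow> 0"
      by simp
    from order_tendstoD(2)[OF this, of "1 / 2"]
    have "\<forall>\<^sub>F n in sequentially. C / ?\<delta> k / real n < 1 / 2"
      by simp
    moreover have "\<forall>\<^sub>F n in sequentially. 1 / real n < ?\<delta> k"
      by (rule order_tendstoD(2)[OF lim_1_over_n]) simp
    ultimately have bound: "\<forall>\<^sub>F n in sequentially. (\<integral>\<^sup>+\<omega>. ?S k n \<omega> \<partial>N) \<le> ?A + ?r n"
      using eventually_gt_at_top[of 0]
    proof eventually_elim
      case (elim n)
      have "(\<integral>\<^sup>+\<omega>. ?S k n \<omega> \<partial>N) \<le>
        liminf (\<lambda>j. \<integral>\<^sup>+\<omega>. sample_inf ?F n (?\<delta> k) (\<lambda>i. zoom X (e j) (i / n) \<omega>) \<partial>M)"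
        by (rule fdd[OF elim(3)])
      also have "\<dots> \<le> liminf (\<lambda>j. (\<integral>\<^sup>+\<omega>. ?F (trajectory (zoom X (e j)) \<omega>) \<partial>M) + ?r n)"
      proof (rule Liminf_mono)
        from e_small
        show "\<forall>\<^sub>F j in sequentially.
          (\<integral>\<^sup>+\<omega>. sample_inf ?F n (?\<delta> k) (\<lambda>i. zoom X (e j) (i / n) \<omega>) \<partial>M) \<le>
          (\<integral>\<^sup>+\<omega>. ?F (trajectory (zoom X (e j)) \<omega>) \<partial>M) + ?r n"
        proof eventually_elim
          case (elim j)
          show ?case
            by (rule C(2)[OF e(1) elim \<open>0 < n\<close> _ \<open>1 / real n < ?\<delta> k\<close> less_imp_le[OF \<open>C / ?\<delta> k / real n < 1 / 2\<close>]]) simp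
        qed
      qed
      also have "\<dots> = ?A + ?r n"
        by (rule Liminf_add_const) simp
      finally show ?case .
    qed
    have "(\<integral>\<^sup>+\<omega>. liminf (\<lambda>n. ?S k n \<omega>) \<partial>N) \<le> liminf (\<lambda>n. \<integral>\<^sup>+\<omega>. ?S k n \<omega> \<partial>N)"
      by (rule nn_integral_liminf) (rule SM)
    also have "\<dots> \<le> liminf (\<lambda>n. ?A + ?r n)"
      by (rule Liminf_mono[OF bound])
    also have "\<dots> = ?A + liminf ?r"
      by (rule Liminf_const_add) simp
    also have "liminf ?r = 0"
      by (rule lim_imp_Liminf[OF _ sample_error_tendsto_0]) simp
    finally show ?thesis by simp
  qed
  have "(\<integral>\<^sup>+\<omega>. ?F (trajectory (\<lambda>t \<omega>. c * Z t \<omega>) \<omega>) \<partial>N) \<le> (\<integral>\<^sup>+\<omega>. liminf (\<lambda>k. liminf (\<lambda>n. ?S k n \<omega>)) \<partial>N)"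
  proof (rule nn_integral_mono)
    fix \<omega> assume "\<omega> \<in> space N"
    then have "trajectory (\<lambda>t \<omega>. c * Z t \<omega>) \<omega> \<in> cadlag"
      using scaled_trajectory(1)[OF cadZ] c by auto
    from le_liminf_sample_inf[OF f this]
    show "?F (trajectory (\<lambda>t \<omega>. c * Z t \<omega>) \<omega>) \<le> liminf (\<lambda>k. liminf (\<lambda>n. ?S k n \<omega>))"
      by (simp add: trajectory_def)
  qed
  also have "\<dots> \<le> liminf (\<lambda>k. \<integral>\<^sup>+\<omega>. liminf (\<lambda>n. ?S k n \<omega>) \<partial>N)"
    by (intro nn_integral_liminf borel_measurable_liminf SM)
  also have "\<dots> \<le> liminf (\<lambda>k::nat. ?A)"
    by (intro Liminf_mono always_eventually allI level)
  also have "\<dots> = ?A"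
    by (simp add: Liminf_const)
  finally show ?thesis
    by (simp only: c_def)
qed

lemma eventually_gt_of_ennreal_liminf:
  fixes a :: real and b :: "nat \<Rightarrow> real"
  assumes "ennreal a \<le> liminf (\<lambda>j. ennreal (b j))" "\<And>j. 0 \<le> b j" "0 < r"
  shows "\<forall>\<^sub>F j in sequentially. a - r < b j"
proof (cases "a - r < 0")
  case True
  then show ?thesis
    using assms(2) by (intro always_eventually allI) (meson less_le_trans)
next
  case False
  then have "ennreal (a - r) < ennreal a"
    using assms(3) by (intro ennreal_lessI) auto
  also note assms(1)
  finally have "\<forall>\<^sub>F j in sequentially. ennreal (a - r) < ennreal (b j)"
    by (rule less_LiminfD)
  then show ?thesis
    by eventually_elim (use False in \<open>simp add: ennreal_less_iff\<close>)
qed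

theorem theorem2p1:
  fixes q x :: real
    and M :: "'a measure" and X :: "real \<Rightarrow> 'a \<Rightarrow> real"
    and N :: "'b measure" and Z :: "real \<Rightarrow> 'b \<Rightarrow> real"
  assumes "q \<in> {-1<..<1}"
    and "x \<in> {- 2 / sqrt (1 - q) <..< 2 / sqrt (1 - q)}"
    and "qou_process_from q x M X"
    and "cauchy_process N Z"
  shows "converges_in_law skorohod
           (\<lambda>\<epsilon>. M) (\<lambda>\<epsilon>. trajectory (\<lambda>t \<omega>. (X (\<epsilon> * t) \<omega> - X 0 \<omega>) / \<epsilon>))
           N (trajectory (\<lambda>t \<omega>. sqrt (4 / (1 - q) - x\<^sup>2) * Z t \<omega>))
           (at_right 0)"
  unfolding converges_in_law_def
proof (intro conjI allI impI)
  define Y where "Y \<epsilon> = trajectory (\<lambda>t \<omega>. (X (\<epsilon> * t) \<omega> - X 0 \<omega>) / \<epsilon>)" for \<epsilon>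
  define W where "W = trajectory (\<lambda>t \<omega>. sqrt (4 / (1 - q) - x\<^sup>2) * Z t \<omega>)"
  have q: "\<bar>q\<bar> < 1"
    using assms(1) by auto
  have cadX: "cadlag_process M X" and cadZ: "cadlag_process N Z"
    using assms(3,4) by (auto simp: qou_process_from_def cauchy_process_def levy_process_def)
  interpret M: prob_space M using cadX by (simp add: cadlag_process_def)
  interpret N: prob_space N using cadZ by (simp add: cadlag_process_def)
  have c: "sqrt (4 / (1 - q) - x\<^sup>2) \<noteq> 0"
    by (intro less_imp_neq[THEN not_sym] qou_speed_pos) (use assms in auto)
  have YM: "Y \<epsilon> \<in> M \<rightarrow>\<^sub>M borel_sets_of skorohod" and Ycad: "\<omega> \<in> space M \<Longrightarrow> Y \<epsilon> \<omega> \<in> cadlag" if "0 < \<epsilon>" for \<epsilon> \<omega>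
    unfolding Y_def using rescaled_trajectory[OF cadX that] by auto
  have WM: "W \<in> N \<rightarrow>\<^sub>M borel_sets_of skorohod" and Wcad: "\<omega> \<in> space N \<Longrightarrow> W \<omega> \<in> cadlag" for \<omega>
    unfolding W_def using scaled_trajectory[OF cadZ c] by auto
  have "\<forall>\<^sub>F \<epsilon> in at_right (0::real). 0 < \<epsilon>"
    by (simp add: eventually_at_filter)
  then show "\<forall>\<^sub>F \<epsilon> in at_right 0. trajectory (\<lambda>t \<omega>. (X (\<epsilon> * t) \<omega> - X 0 \<omega>) / \<epsilon>) \<in> M \<rightarrow>\<^sub>M borel_sets_of skorohod"
    by eventually_elim (use YM in \<open>simp add: Y_def\<close>)
  show "trajectory (\<lambda>t \<omega>. sqrt (4 / (1 - q) - x\<^sup>2) * Z t \<omega>) \<in> N \<rightarrow>\<^sub>M borel_sets_of skorohod"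
    using WM by (simp add: W_def)
  fix f assume "continuous_map skorohod euclideanreal f \<and> bounded (f ` topspace skorohod)"
  then have f: "continuous_map skorohod euclideanreal f" and "bounded (f ` cadlag)"
    by (auto simp: topspace_skorohod)
  then obtain K where K: "\<And>\<alpha>. \<alpha> \<in> cadlag \<Longrightarrow> \<bar>f \<alpha>\<bar> \<le> K"
    unfolding bounded_iff by auto
  have fm: "f \<in> borel_measurable (borel_sets_of skorohod)"
    by (rule continuous_map_borel_measurable[OF f])
  have intY: "integrable M (\<lambda>\<omega>. f (Y \<epsilon> \<omega>))" if "0 < \<epsilon>" for \<epsilon>
    using K Ycad[OF that] measurable_compose[OF YM[OF that] fm]
    by (intro M.integrable_const_bound[of _ K]) auto
  have intW: "integrable N (\<lambda>\<omega>. f (W \<omega>))"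
    using K Wcad measurable_compose[OF WM fm]
    by (intro N.integrable_const_bound[of _ K]) auto
  have lower: "\<forall>\<^sub>F j in sequentially. (LINT \<omega>|N. a * f (W \<omega>)) - r < (LINT \<omega>|M. a * f (Y (e j) \<omega>))"
    if e: "\<And>j. 0 < e j" "e \<longlonglongrightarrow> 0" and a: "\<bar>a\<bar> = 1" and r: "0 < r" for a r :: real and e :: "nat \<Rightarrow> real"
  proof -
    \<comment> \<open>\<open>a = 1\<close> gives the lower bound and \<open>a = -1\<close> the upper bound; adding \<open>K\<close> makes the functional nonnegative\<close>
    let ?g = "\<lambda>\<beta>. a * f \<beta> + K"
    have g: "?g \<alpha> \<in> {0..2 * K}" if "\<alpha> \<in> cadlag" for \<alpha>
      using K[OF that] a by (auto simp: abs_if split: if_splits)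
    have gc: "continuous_map skorohod euclideanreal ?g"
      using f by (intro continuous_map_add continuous_map_real_mult_left) auto
    have Z: "(\<integral>\<^sup>+\<omega>. ennreal (?g (W \<omega>)) \<partial>N) = ennreal ((LINT \<omega>|N. a * f (W \<omega>)) + K)"
      using intW g Wcad by (subst nn_integral_eq_integral) (auto simp: N.prob_space intro!: AE_I2)
    have Y: "(\<integral>\<^sup>+\<omega>. ennreal (?g (Y (e j) \<omega>)) \<partial>M) = ennreal ((LINT \<omega>|M. a * f (Y (e j) \<omega>)) + K)" for j
      using intY[OF e(1)] g Ycad[OF e(1)] by (subst nn_integral_eq_integral) (auto simp: M.prob_space intro!: AE_I2)
    have "ennreal ((LINT \<omega>|N. a * f (W \<omega>)) + K) \<le> liminf (\<lambda>j. ennreal ((LINT \<omega>|M. a * f (Y (e j) \<omega>)) + K))"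
      using qou_liminf[OF q assms(2,3,4) e gc g] unfolding Y_def[symmetric] W_def[symmetric] Z Y .
    moreover have "0 \<le> (LINT \<omega>|M. a * f (Y (e j) \<omega>)) + K" for j
    proof -
      have "0 \<le> (LINT \<omega>|M. a * f (Y (e j) \<omega>) + K)"
        using g Ycad[OF e(1)] by (intro integral_nonneg_AE AE_I2) auto
      then show ?thesis
        using intY[OF e(1)] by (simp add: M.prob_space)
    qed
    ultimately have "\<forall>\<^sub>F j in sequentially. (LINT \<omega>|N. a * f (W \<omega>)) + K - r < (LINT \<omega>|M. a * f (Y (e j) \<omega>)) + K"
      using r by (rule eventually_gt_of_ennreal_liminf)
    then show ?thesis
      by eventually_elim linarith
  qed
  have "((\<lambda>\<epsilon>. LINT \<omega>|M. f (Y \<epsilon> \<omega>)) \<longlongrightarrow> (LINT \<omega>|N. f (W \<omega>))) (at_right 0)"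
    unfolding tendsto_at_iff_sequentially
  proof (intro allI impI)
    fix e :: "nat \<Rightarrow> real" assume "\<forall>i. e i \<in> {0<..} - {0}" and e0: "e \<longlonglongrightarrow> 0"
    then have e: "0 < e j" for j
      by auto
    show "((\<lambda>\<epsilon>. LINT \<omega>|M. f (Y \<epsilon> \<omega>)) \<circ> e) \<longlonglongrightarrow> (LINT \<omega>|N. f (W \<omega>))"
    proof (rule tendstoI)
      fix r :: real assume r: "0 < r"
      from lower[OF e e0 _ r, of 1] lower[OF e e0 _ r, of "-1"]
      have "\<forall>\<^sub>F j in sequentially. (LINT \<omega>|N. f (W \<omega>)) - r < (LINT \<omega>|M. f (Y (e j) \<omega>))"
        "\<forall>\<^sub>F j in sequentially. - (LINT \<omega>|N. f (W \<omega>)) - r < - (LINT \<omega>|M. f (Y (e j) \<omega>))"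
        by simp_all
      then show "\<forall>\<^sub>F j in sequentially. dist (((\<lambda>\<epsilon>. LINT \<omega>|M. f (Y \<epsilon> \<omega>)) \<circ> e) j) (LINT \<omega>|N. f (W \<omega>)) < r"
        by eventually_elim (simp add: dist_real_def abs_less_iff)
    qed
  qed
  also have "?this \<longleftrightarrow> ((\<lambda>\<epsilon>. LINT w|distr M (borel_sets_of skorohod) (Y \<epsilon>). f w) \<longlongrightarrow>
      (LINT w|distr N (borel_sets_of skorohod) W. f w)) (at_right 0)"
  proof -
    have "(LINT w|distr N (borel_sets_of skorohod) W. f w) = (LINT \<omega>|N. f (W \<omega>))"
      by (rule integral_distr[OF WM fm])
    moreover have "\<forall>\<^sub>F \<epsilon> in at_right 0. (LINT \<omega>|M. f (Y \<epsilon> \<omega>)) = (LINT w|distr M (borel_sets_of skorohod) (Y \<epsilon>). f w)"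
      using \<open>\<forall>\<^sub>F \<epsilon> in at_right (0::real). 0 < \<epsilon>\<close> by eventually_elim (simp add: integral_distr[OF YM fm])
    ultimately show ?thesis
      by (simp add: filterlim_cong)
  qed
  finally show "((\<lambda>\<epsilon>. LINT w|distr M (borel_sets_of skorohod) (trajectory (\<lambda>t \<omega>. (X (\<epsilon> * t) \<omega> - X 0 \<omega>) / \<epsilon>)). f w) \<longlongrightarrow>
      (LINT w|distr N (borel_sets_of skorohod) (trajectory (\<lambda>t \<omega>. sqrt (4 / (1 - q) - x\<^sup>2) * Z t \<omega>)). f w)) (at_right 0)"
    unfolding Y_def W_def .
qed

end
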